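(* Let $(\Omega,\mathcal F,m)$ be a localizable measure space and $1\le p,q<\infty$. Let $S,T$ be positive $C_0$-semigroups on $L_2(m)$ with generators $A_S,A_T$, respectively. Assume that $S$ also acts on $L_p(m)$ and $T$ also acts on $L_q(m)$. Let $0\le f\in L_p(m)$, $0\le g'\in L_{q'}(m)$ and $C\ge 0$. Then the following are equivalent: (a) For all $t\ge 0$, $0\le u\in L_2(m)\cap L_q(m)$ and $0\le v'\in L_2(m)\cap L_{p'}(m)$, $$\langle T(t)u,v'\rangle_{2,2}\le \langle S(t)u,v'\rangle_{2,2}+C\int_0^t\langle T(t-s)u,g'\rangle_{q,q'}\,\langle f,S(s)'v'\rangle_{p,p'}\,ds.$$ (b) For all $0\le u\in D(A_T)\cap L_q(m)$ and $0\le v'\in D(A_S^\sigma)\cap L_{p'}(m)$, $$\langle A_Tu,v'\rangle_{2,2}\le\langle u,A_S^\sigma v'\rangle_{2,2}+C\,\langle u,g'\rangle_{q,q'}\,\langle f,v'\rangle_{p,p'}.$$ (c) For all sufficiently large $\lambda\in\mathbb R$ and all $0\le u\in L_2(m)\cap L_q(m)$, $0\le v'\in L_2(m)\cap L_{p'}(m)$, $$\langle(\lambda-A_T)^{-1}u,v'\rangle_{2,2}\le\langle(\lambda-A_S)^{-1}u,v'\rangle_{2,2}+C\,\langle(\lambda-A_T)^{-1}u,g'\rangle_{q,q'}\,\langle f,(\lambda-A_S^\sigma)^{-1}v'\rangle_{p,p'}.$$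
   Context: All vector spaces are over $\mathbb R$. A measure space $(\Omega,\mathcal F,m)$ is semifinite if every $A\in\mathcal F$ with $m(A)=\infty$ contains some $B\in\mathcal F$ with $0<m(B)<\infty$. It is localizable if it is semifinite and for every $\mathcal E\subseteq\mathcal F$ there is $A\in\mathcal F$ such that $m(E\setminus A)=0$ for all $E\in\mathcal E$, and $m(A\setminus B)=0$ whenever $B\in\mathcal F$ satisfies $m(E\setminus B)=0$ for all $E\in\mathcal E$. (Equivalently, $L_1(m)'=L_\infty(m)$ canonically.) For $1\le p<\infty$, $p'$ is the dual exponent, $\frac1p+\frac1{p'}=1$ (with $\frac1\infty=0$), and likewise for $q$. For $\varphi\in L_p(m)$, $\psi\in L_{p'}(m)=L_p(m)'$, $\langle\varphi,\psi\rangle_{p,p'}:=\int_\Omega\varphi\psi\,dm$. A semigroup is positive if it maps nonnegative functions to nonnegative functions. A $C_0$-semigroup $T$ on $L_2(m)$ also acts on $L_q(m)$ if there are $M\ge1$, $\omega\in\mathbb R$ with $\|T(t)u\|_q\le Me^{\omega t}\|u\|_q$ for all $u\in L_2(m)\cap L_q(m)$, $t\ge0$; then $T$ extends to a $C_0$-semigroup on $L_q(m)$, again denoted by $T$ (its generator coincides with that of $T$ on common elements). The same convention is used for resolvents, dual semigroups $S(s)'$ and dual resolvents acting on $L_2(m)$ and on $L_{p'}(m)=L_p(m)'$ consistently. For a $C_0$-semigroup $S$ with generator $A$ on a Banach space $X$, the weak$^*$-generator of $S(\cdot)'$ is $A^\sigma:=\{(x',y')\in X'\times X':\ \text{w}^*\text{-}\lim_{t\downarrow0}\frac1t(S(t)'x'-x')=y'\}$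 (which equals the dual operator $A'$). Here $A_S^\sigma$ is formed for $S$ on $X=L_2(m)$, with $L_2(m)'=L_2(m)$. *)

theory Defs
  imports "HOL-Analysis.Analysis" "HOL-Probability.Essential_Supremum"
begin

(* Elements of L_p(m) are represented by measurable functions, and operators on L_p(m) by maps
   on representatives that respect a.e. equality.  Accordingly "u = v" and "u \<ge> 0" in L_p(m)
   are the a.e. statements on representatives. *)

definition semifinite_measure :: "'a measure \<Rightarrow> bool" where
  "semifinite_measure M \<longleftrightarrow>
     (\<forall>A\<in>sets M. emeasure M A = \<infinity> \<longrightarrow>
        (\<exists>B\<in>sets M. B \<subseteq> A \<and> 0 < emeasure M B \<and> emeasure M B < \<infinity>))"

definition localizable_measure :: "'a measure \<Rightarrow> bool" where
  "localizable_measure M \<longleftrightarrow> semifinite_measure M \<and>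
     (\<forall>\<E>\<subseteq>sets M. \<exists>A\<in>sets M.
        (\<forall>E\<in>\<E>. emeasure M (E - A) = 0) \<and>
        (\<forall>B\<in>sets M. (\<forall>E\<in>\<E>. emeasure M (E - B) = 0) \<longrightarrow> emeasure M (A - B) = 0))"

definition Lp :: "ennreal \<Rightarrow> 'a measure \<Rightarrow> ('a \<Rightarrow> real) set" where
  "Lp p M = (if p = \<infinity>
     then {f \<in> borel_measurable M. esssup M (\<lambda>x. ennreal \<bar>f x\<bar>) < \<infinity>}
     else {f \<in> borel_measurable M. integrable M (\<lambda>x. \<bar>f x\<bar> powr enn2real p)})"

definition Lp_norm :: "ennreal \<Rightarrow> 'a measure \<Rightarrow> ('a \<Rightarrow> real) \<Rightarrow> real" where
  "Lp_norm p M f = (if p = \<infinity>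
     then enn2real (esssup M (\<lambda>x. ennreal \<bar>f x\<bar>))
     else (\<integral>x. \<bar>f x\<bar> powr enn2real p \<partial>M) powr (1 / enn2real p))"

definition pairing :: "'a measure \<Rightarrow> ('a \<Rightarrow> real) \<Rightarrow> ('a \<Rightarrow> real) \<Rightarrow> real" where
  "pairing M f g = (\<integral>x. f x * g x \<partial>M)"

definition nonneg_ae :: "'a measure \<Rightarrow> ('a \<Rightarrow> real) \<Rightarrow> bool" where
  "nonneg_ae M u \<longleftrightarrow> (AE x in M. 0 \<le> u x)"

definition bounded_operator_Lp ::
    "ennreal \<Rightarrow> 'a measure \<Rightarrow> (('a \<Rightarrow> real) \<Rightarrow> ('a \<Rightarrow> real)) \<Rightarrow> bool" where
  "bounded_operator_Lp p M B \<longleftrightarrow>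
     (\<forall>u\<in>Lp p M. B u \<in> Lp p M) \<and>
     (\<forall>u\<in>Lp p M. \<forall>v\<in>Lp p M. (AE x in M. u x = v x) \<longrightarrow> (AE x in M. B u x = B v x)) \<and>
     (\<forall>u\<in>Lp p M. \<forall>v\<in>Lp p M. AE x in M. B (\<lambda>y. u y + v y) x = B u x + B v x) \<and>
     (\<forall>u\<in>Lp p M. \<forall>c. AE x in M. B (\<lambda>y. c * u y) x = c * B u x) \<and>
     (\<exists>K. \<forall>u\<in>Lp p M. Lp_norm p M (B u) \<le> K * Lp_norm p M u)"

(* Only the values at times t \<ge> 0 and on elements of L_p(m) matter. *)
definition C0_semigroup_Lp ::
    "ennreal \<Rightarrow> 'a measure \<Rightarrow> (real \<Rightarrow> ('a \<Rightarrow> real) \<Rightarrow> ('a \<Rightarrow> real)) \<Rightarrow> bool" where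
  "C0_semigroup_Lp p M T \<longleftrightarrow>
     (\<forall>t\<ge>0. bounded_operator_Lp p M (T t)) \<and>
     (\<forall>u\<in>Lp p M. AE x in M. T 0 u x = u x) \<and>
     (\<forall>s\<ge>0. \<forall>t\<ge>0. \<forall>u\<in>Lp p M. AE x in M. T (s + t) u x = T s (T t u) x) \<and>
     (\<forall>u\<in>Lp p M. ((\<lambda>t. Lp_norm p M (\<lambda>x. T t u x - u x)) \<longlongrightarrow> 0) (at_right 0))"

definition positive_semigroup_Lp ::
    "ennreal \<Rightarrow> 'a measure \<Rightarrow> (real \<Rightarrow> ('a \<Rightarrow> real) \<Rightarrow> ('a \<Rightarrow> real)) \<Rightarrow> bool" where
  "positive_semigroup_Lp p M T \<longleftrightarrow>
     (\<forall>t\<ge>0. \<forall>u\<in>Lp p M. nonneg_ae M u \<longrightarrow> nonneg_ae M (T t u))"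

definition also_acts_on_Lp ::
    "ennreal \<Rightarrow> 'a measure \<Rightarrow> (real \<Rightarrow> ('a \<Rightarrow> real) \<Rightarrow> ('a \<Rightarrow> real)) \<Rightarrow> bool" where
  "also_acts_on_Lp q M T \<longleftrightarrow>
     (\<exists>K\<ge>1. \<exists>\<omega>. \<forall>u\<in>Lp 2 M \<inter> Lp q M. \<forall>t\<ge>0.
        T t u \<in> Lp q M \<and> Lp_norm q M (T t u) \<le> K * exp (\<omega> * t) * Lp_norm q M u)"

(* Generators are given by their graphs; the second component is unique up to a.e. equality. *)
definition generator_Lp ::
    "ennreal \<Rightarrow> 'a measure \<Rightarrow> (real \<Rightarrow> ('a \<Rightarrow> real) \<Rightarrow> ('a \<Rightarrow> real)) \<Rightarrow>
     (('a \<Rightarrow> real) \<times> ('a \<Rightarrow> real)) set" where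
  "generator_Lp p M T =
     {(u, w). u \<in> Lp p M \<and> w \<in> Lp p M \<and>
        ((\<lambda>t. Lp_norm p M (\<lambda>x. (T t u x - u x) / t - w x)) \<longlongrightarrow> 0) (at_right 0)}"

(* The dual of a bounded operator on L_2(m), with L_2(m)' identified with L_2(m). *)
definition L2_dual ::
    "'a measure \<Rightarrow> (('a \<Rightarrow> real) \<Rightarrow> ('a \<Rightarrow> real)) \<Rightarrow> ('a \<Rightarrow> real) \<Rightarrow> ('a \<Rightarrow> real)" where
  "L2_dual M B v = (SOME w. w \<in> Lp 2 M \<and> (\<forall>u\<in>Lp 2 M. pairing M (B u) v = pairing M u w))"

definition L2_weak_star_generator ::
    "'a measure \<Rightarrow> (real \<Rightarrow> ('a \<Rightarrow> real) \<Rightarrow> ('a \<Rightarrow> real)) \<Rightarrow>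
     (('a \<Rightarrow> real) \<times> ('a \<Rightarrow> real)) set" where
  "L2_weak_star_generator M S =
     {(v, w). v \<in> Lp 2 M \<and> w \<in> Lp 2 M \<and>
        (\<forall>u\<in>Lp 2 M. ((\<lambda>t. pairing M u (\<lambda>x. (L2_dual M (S t) v x - v x) / t))
            \<longlongrightarrow> pairing M u w) (at_right 0))}"

(* A representative of (\<lambda> - A)^{-1} u for an operator A given by its graph; meaningful when \<lambda> lies
   in the resolvent set of A. *)
definition resolvent ::
    "'a measure \<Rightarrow> (('a \<Rightarrow> real) \<times> ('a \<Rightarrow> real)) set \<Rightarrow> real \<Rightarrow> ('a \<Rightarrow> real) \<Rightarrow> ('a \<Rightarrow> real)" where
  "resolvent M A lam u = (SOME w. \<exists>z. (w, z) \<in> A \<and> (AE x in M. lam * w x - z x = u x))"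

end

theory Submission
  imports Defs "HOL-Probability.Sinc_Integral"
begin

text \<open>
  Write $Q(s)$ for the adjoint of $S(s)$ and $R$ for resolvents. Dividing (a) by $t$ and letting
  $t \downarrow 0$ gives (b); (b) for the pair $R_T(\lambda) u$, $R_Q(\lambda) v$ is (c); multiplying (c) by
  $\lambda^2$ and letting $\lambda \to \infty$ gives back (b). For (b) $\Rightarrow$ (a) let $u$ and $v$ first
  lie in the domains: then
  $s \mapsto \langle T(t-s)u, Q(s)v \rangle + C \int_0^s \langle T(t-r)u, g' \rangle \langle Q(r)v, f \rangle \, dr$
  has a nonnegative right derivative on $[0,t)$, so its values at $0$ and $t$ compare as claimed.
  General $u$, $v$ are approximated by $\lambda R_T(\lambda) u$ and $\lambda R_Q(\lambda) v$.

  All these limits need $t \mapsto \langle T(t)u, g' \rangle$ to be continuous. If $q > 1$, approximate $g'$ by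
  elements of $L_2 \cap L_{q'}$. If $q = 1$, mass could escape to infinity, and positivity is used: for
  $u \ge 0$ the function $E = R_T(\lambda) u$ and its shifts $E_h = e^{-\lambda h} T(h) E$ are supermedian,
  and $e^{-\lambda t} T(t) e \to e$ in $L_1$ for supermedian $e$ because $0 \le e^{-\lambda t} T(t) e \le e$. Supermedian
  functions are stable under sums and minima, so the truncations $\min((E - E_h)/h, nE)$ are differences
  of such functions; they tend in $L_1$ to $\min(u, nE)$ as $h \downarrow 0$, and this tends to $u$
  as $n \to \infty$.
\<close>

section \<open>The Hilbert space structure of L2\<close>

text \<open>The two semigroups enter asymmetrically. \<open>T\<close> is strongly continuous, while
  the adjoints of \<open>S\<close> are handled through weak continuity alone, a property that passes
  to adjoints by its very form. In <T(t-s)u, Q(s)v> one factor then converges in norm and the other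
  weakly. That is enough for limits, but the weak generator only yields derivatives from the right,
  so monotonicity has to be deduced from one-sided derivatives.

  The case distinction on q has no counterpart for p: \<open>f\<close> lies in L_p with p finite and
  can be approximated from L_2 even when v' runs through L_\<infinity>, whereas \<open>g'\<close>
  may be a genuine L_\<infinity> function.

  Elements of L_p are representatives, not points of a normed space. Vector-valued integrals are
  therefore replaced by scalar ones: adjoints and resolvents come from the Riesz theorem through
  their pairings, and L_r bounds come from testing with L_2 \<inter> L_r'. Such tests succeed
  because a function in L_2 can be truncated to sets of finite measure on which it is bounded and
  bounded away from 0.\<close>

lemma Lp_measurable: "f \<in> Lp p M \<Longrightarrow> f \<in> borel_measurable M"
  by (auto simp: Lp_def split: if_splits)

lemma Lp_norm_nonneg: "0 \<le> Lp_norm p M f"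
  by (simp add: Lp_norm_def)

lemma L2_iff: "f \<in> Lp 2 M \<longleftrightarrow> f \<in> borel_measurable M \<and> integrable M (\<lambda>x. f x * f x)"
  by (auto simp: Lp_def power2_eq_square)

lemma L2_norm_eq: "Lp_norm 2 M f = sqrt (pairing M f f)"
  by (simp add: Lp_norm_def pairing_def powr_half_sqrt power2_eq_square)

lemma L2_mult_integrable:
  assumes "f \<in> Lp 2 M" "g \<in> Lp 2 M"
  shows "integrable M (\<lambda>x. f x * g x)"
proof (rule Bochner_Integration.integrable_bound)
  show "integrable M (\<lambda>x. f x * f x + g x * g x)"
    using assms by (auto simp: L2_iff)
  show "(\<lambda>x. f x * g x) \<in> borel_measurable M"
    using assms by (auto simp: L2_iff)
  have "\<bar>a * b\<bar> \<le> \<bar>a * a + b * b\<bar>" for a b :: real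
  proof -
    have "0 \<le> (\<bar>a\<bar> - \<bar>b\<bar>)\<^sup>2" by simp
    then have "2 * (\<bar>a\<bar> * \<bar>b\<bar>) \<le> a * a + b * b"
      by (simp add: power2_diff) (simp add: power2_eq_square)
    moreover have "0 \<le> \<bar>a\<bar> * \<bar>b\<bar>" by simp
    ultimately show ?thesis unfolding abs_mult by linarith
  qed
  then show "AE x in M. norm (f x * g x) \<le> norm (f x * f x + g x * g x)"
    by auto
qed

lemma L2_add [intro]:
  assumes "f \<in> Lp 2 M" "g \<in> Lp 2 M"
  shows "(\<lambda>x. f x + g x) \<in> Lp 2 M"
proof -
  have "integrable M (\<lambda>x. f x * f x + 2 * (f x * g x) + g x * g x)"
    using assms L2_mult_integrable[OF assms]
    by (intro Bochner_Integration.integrable_add) (auto simp: L2_iff)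
  moreover have "(\<lambda>x. f x * f x + 2 * (f x * g x) + g x * g x) = (\<lambda>x. (f x + g x) * (f x + g x))"
    by (auto simp: algebra_simps)
  ultimately show ?thesis
    using assms by (auto simp: L2_iff)
qed

lemma L2_cmult [intro]:
  assumes "f \<in> Lp 2 M"
  shows "(\<lambda>x. c * f x) \<in> Lp 2 M"
proof -
  have "integrable M (\<lambda>x. (c * c) * (f x * f x))"
    using assms by (intro integrable_mult_right) (auto simp: L2_iff)
  moreover have "(\<lambda>x. (c * c) * (f x * f x)) = (\<lambda>x. (c * f x) * (c * f x))"
    by (auto simp: algebra_simps)
  ultimately show ?thesis
    using assms by (auto simp: L2_iff)
qed

lemma L2_minus [intro]: "f \<in> Lp 2 M \<Longrightarrow> (\<lambda>x. - f x) \<in> Lp 2 M"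
  using L2_cmult[of f M "-1"] by simp

lemma L2_diff [intro]: "f \<in> Lp 2 M \<Longrightarrow> g \<in> Lp 2 M \<Longrightarrow> (\<lambda>x. f x - g x) \<in> Lp 2 M"
  using L2_add[OF _ L2_minus, of f M g] by simp

lemma L2_divide [intro]: "f \<in> Lp 2 M \<Longrightarrow> (\<lambda>x. f x / c) \<in> Lp 2 M"
  using L2_cmult[of f M "1/c"] by simp

lemma L2_zero [intro, simp]: "(\<lambda>x. 0) \<in> Lp 2 M"
  by (simp add: L2_iff)

lemma L2_dominated:
  assumes "g \<in> Lp 2 M" "f \<in> borel_measurable M" "AE x in M. \<bar>f x\<bar> \<le> \<bar>g x\<bar>"
  shows "f \<in> Lp 2 M"
  unfolding L2_iff
proof (intro conjI Bochner_Integration.integrable_bound[where g = "\<lambda>x. f x * f x" and f = "\<lambda>x. g x * g x"])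
  show "AE x in M. norm (f x * f x) \<le> norm (g x * g x)"
    using assms(3) by eventually_elim (metis abs_ge_zero abs_mult mult_mono real_norm_def)
qed (use assms in \<open>auto simp: L2_iff\<close>)

lemma L2_abs [intro]: "f \<in> Lp 2 M \<Longrightarrow> (\<lambda>x. \<bar>f x\<bar>) \<in> Lp 2 M"
  by (rule L2_dominated) (auto simp: L2_iff)

lemma L2_max [intro]: "f \<in> Lp 2 M \<Longrightarrow> g \<in> Lp 2 M \<Longrightarrow> (\<lambda>x. max (f x) (g x)) \<in> Lp 2 M"
  by (rule L2_dominated[of "\<lambda>x. \<bar>f x\<bar> + \<bar>g x\<bar>"])
    (auto intro: borel_measurable_max Lp_measurable[of _ 2])

lemma L2_min [intro]: "f \<in> Lp 2 M \<Longrightarrow> g \<in> Lp 2 M \<Longrightarrow> (\<lambda>x. min (f x) (g x)) \<in> Lp 2 M"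
  by (rule L2_dominated[of "\<lambda>x. \<bar>f x\<bar> + \<bar>g x\<bar>"])
    (auto intro: borel_measurable_min Lp_measurable[of _ 2])

lemma pairing_commute: "pairing M f g = pairing M g f"
  by (simp add: pairing_def mult.commute)

lemma pairing_cong_AE:
  assumes "AE x in M. f x = f' x" "AE x in M. g x = g' x"
    "f \<in> borel_measurable M" "f' \<in> borel_measurable M" "g \<in> borel_measurable M" "g' \<in> borel_measurable M"
  shows "pairing M f g = pairing M f' g'"
  unfolding pairing_def using assms by (intro integral_cong_AE) auto

lemma pairing_add_left:
  "f \<in> Lp 2 M \<Longrightarrow> g \<in> Lp 2 M \<Longrightarrow> h \<in> Lp 2 M \<Longrightarrow>
    pairing M (\<lambda>x. f x + g x) h = pairing M f h + pairing M g h"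
  by (simp add: pairing_def distrib_right L2_mult_integrable)

lemma pairing_diff_left:
  "f \<in> Lp 2 M \<Longrightarrow> g \<in> Lp 2 M \<Longrightarrow> h \<in> Lp 2 M \<Longrightarrow>
    pairing M (\<lambda>x. f x - g x) h = pairing M f h - pairing M g h"
  by (simp add: pairing_def left_diff_distrib L2_mult_integrable)

lemma pairing_cmult_left: "pairing M (\<lambda>x. c * f x) h = c * pairing M f h"
  by (simp add: pairing_def mult.assoc)

lemma pairing_divide_left: "pairing M (\<lambda>x. f x / c) h = pairing M f h / c"
  by (simp add: pairing_def)

lemma pairing_add_right:
  "f \<in> Lp 2 M \<Longrightarrow> g \<in> Lp 2 M \<Longrightarrow> h \<in> Lp 2 M \<Longrightarrow>
    pairing M h (\<lambda>x. f x + g x) = pairing M h f + pairing M h g"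
  by (simp add: pairing_commute[of M h] pairing_add_left)

lemma pairing_diff_right:
  "f \<in> Lp 2 M \<Longrightarrow> g \<in> Lp 2 M \<Longrightarrow> h \<in> Lp 2 M \<Longrightarrow>
    pairing M h (\<lambda>x. f x - g x) = pairing M h f - pairing M h g"
  by (simp add: pairing_commute[of M h] pairing_diff_left)

lemma pairing_cmult_right: "pairing M h (\<lambda>x. c * f x) = c * pairing M h f"
  by (simp add: pairing_commute[of M h] pairing_cmult_left)

lemma pairing_divide_right: "pairing M h (\<lambda>x. f x / c) = pairing M h f / c"
  by (simp add: pairing_commute[of M h] pairing_divide_left)

lemmas pairing_linear = pairing_add_left pairing_diff_left pairing_cmult_left pairing_divide_left
  pairing_add_right pairing_diff_right pairing_cmult_right pairing_divide_right

lemma pairing_self_nonneg: "0 \<le> pairing M f f"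
  by (simp add: pairing_def)

lemma L2_norm_sq: "(Lp_norm 2 M f)\<^sup>2 = pairing M f f"
  by (simp add: L2_norm_eq pairing_self_nonneg)

lemma pairing_nonneg: "nonneg_ae M f \<Longrightarrow> nonneg_ae M g \<Longrightarrow> 0 \<le> pairing M f g"
  unfolding pairing_def nonneg_ae_def by (rule integral_nonneg_AE) auto

text \<open>The polynomial c \<mapsto> <f - cg, f - cg> is nonnegative. Its minimum point c =
  <f,g>/<g,g> gives the inequality when <g,g> is nonzero; otherwise the polynomial is affine in c,
  which forces <f,g> = 0.\<close>

lemma L2_Cauchy_Schwarz:
  assumes f: "f \<in> Lp 2 M" and g: "g \<in> Lp 2 M"
  shows "\<bar>pairing M f g\<bar> \<le> Lp_norm 2 M f * Lp_norm 2 M g"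
proof -
  have *: "0 \<le> pairing M f f - 2 * c * pairing M f g + c\<^sup>2 * pairing M g g" for c
  proof -
    have "0 \<le> pairing M (\<lambda>x. f x - c * g x) (\<lambda>x. f x - c * g x)"
      by (rule pairing_self_nonneg)
    also have "\<dots> = pairing M f f - 2 * c * pairing M f g + c\<^sup>2 * pairing M g g"
      using f g by (simp add: pairing_linear L2_cmult L2_diff pairing_commute[of M g f]
          algebra_simps power2_eq_square)
    finally show ?thesis .
  qed
  have "(pairing M f g)\<^sup>2 \<le> pairing M f f * pairing M g g"
  proof (cases "pairing M g g = 0")
    case True
    have "pairing M f g = 0"
    proof (rule ccontr)
      assume "pairing M f g \<noteq> 0"
      then show False
        using *[of "(pairing M f f + 1) / (2 * pairing M f g)"] True by simp
    qed
    then show ?thesis using True by simp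
  next
    case False
    then have "0 < pairing M g g" using pairing_self_nonneg[of M g] by linarith
    then show ?thesis
      using *[of "pairing M f g / pairing M g g"] by (simp add: field_simps power2_eq_square)
  qed
  then have "sqrt ((pairing M f g)\<^sup>2) \<le> sqrt (pairing M f f * pairing M g g)"
    by (rule real_sqrt_le_mono)
  then show ?thesis by (simp add: L2_norm_eq real_sqrt_mult)
qed

lemma L2_norm_cmult: "Lp_norm 2 M (\<lambda>x. c * f x) = \<bar>c\<bar> * Lp_norm 2 M f"
  by (simp add: L2_norm_eq pairing_linear real_sqrt_mult flip: mult.assoc)

lemma L2_norm_minus: "Lp_norm 2 M (\<lambda>x. - f x) = Lp_norm 2 M f"
  using L2_norm_cmult[of M "-1" f] by simp

lemma L2_norm_minus_commute: "Lp_norm 2 M (\<lambda>x. f x - g x) = Lp_norm 2 M (\<lambda>x. g x - f x)"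
  using L2_norm_minus[of M "\<lambda>x. f x - g x"] by simp

lemma L2_norm_triangle:
  assumes f: "f \<in> Lp 2 M" and g: "g \<in> Lp 2 M"
  shows "Lp_norm 2 M (\<lambda>x. f x + g x) \<le> Lp_norm 2 M f + Lp_norm 2 M g"
proof (rule power2_le_imp_le)
  have "(Lp_norm 2 M (\<lambda>x. f x + g x))\<^sup>2 = pairing M f f + 2 * pairing M f g + pairing M g g"
    using f g by (simp add: L2_norm_sq pairing_linear L2_add pairing_commute[of M g f])
  also have "\<dots> \<le> (Lp_norm 2 M f + Lp_norm 2 M g)\<^sup>2"
    using L2_Cauchy_Schwarz[OF f g] by (simp add: power2_sum L2_norm_sq)
  finally show "(Lp_norm 2 M (\<lambda>x. f x + g x))\<^sup>2 \<le> (Lp_norm 2 M f + Lp_norm 2 M g)\<^sup>2" .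
qed (simp add: Lp_norm_nonneg)

lemma L2_norm_triangle_diff:
  assumes "f \<in> Lp 2 M" "g \<in> Lp 2 M"
  shows "Lp_norm 2 M (\<lambda>x. f x - g x) \<le> Lp_norm 2 M f + Lp_norm 2 M g"
  using L2_norm_triangle[OF assms(1) L2_minus[OF assms(2)]] by (simp add: L2_norm_minus)

lemma L2_norm_mono:
  assumes "g \<in> Lp 2 M" "f \<in> borel_measurable M" "AE x in M. \<bar>f x\<bar> \<le> \<bar>g x\<bar>"
  shows "Lp_norm 2 M f \<le> Lp_norm 2 M g"
proof -
  have "pairing M f f \<le> pairing M g g"
    unfolding pairing_def
  proof (rule integral_mono_AE)
    show "AE x in M. f x * f x \<le> g x * g x"
      using assms(3) by eventually_elim (metis abs_ge_zero abs_mult abs_mult_self_eq mult_mono)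
  qed (use L2_dominated[OF assms] assms in \<open>auto simp: L2_iff\<close>)
  then show ?thesis by (simp add: L2_norm_eq)
qed

lemma L2_norm_cong_AE:
  assumes "f \<in> borel_measurable M" "g \<in> borel_measurable M" "AE x in M. f x = g x"
  shows "Lp_norm 2 M f = Lp_norm 2 M g"
  using assms by (simp add: L2_norm_eq pairing_cong_AE[of f g M f g])

lemma L2_AE_zeroI:
  assumes "f \<in> Lp 2 M" "pairing M f f \<le> 0"
  shows "AE x in M. f x = 0"
proof -
  have "(\<integral>x. f x * f x \<partial>M) = 0"
    using assms(2) pairing_self_nonneg[of M f] unfolding pairing_def by linarith
  then have "AE x in M. f x * f x = 0"
    using assms(1) by (subst (asm) integral_nonneg_eq_0_iff_AE) (auto simp: L2_iff)
  then show ?thesis by simp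
qed

lemma L2_eqI:
  assumes "f \<in> Lp 2 M" "g \<in> Lp 2 M" "\<And>v. v \<in> Lp 2 M \<Longrightarrow> pairing M f v = pairing M g v"
  shows "AE x in M. f x = g x"
proof -
  have "pairing M (\<lambda>x. f x - g x) (\<lambda>x. f x - g x) = 0"
    using assms by (simp add: pairing_diff_left L2_diff)
  then have "AE x in M. f x - g x = 0"
    using assms by (intro L2_AE_zeroI) auto
  then show ?thesis by simp
qed

text \<open>Testing with v = f suffices. This turns estimates that are uniform over test vectors
  into norm estimates, for objects known only through their pairings: adjoints and averages of
  orbits.\<close>

lemma L2_norm_leI:
  assumes "f \<in> Lp 2 M" "0 \<le> N" "\<And>v. v \<in> Lp 2 M \<Longrightarrow> \<bar>pairing M f v\<bar> \<le> N * Lp_norm 2 M v"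
  shows "Lp_norm 2 M f \<le> N"
proof (cases "Lp_norm 2 M f = 0")
  case False
  then have pos: "0 < Lp_norm 2 M f" using Lp_norm_nonneg[of 2 M f] by linarith
  have "Lp_norm 2 M f * Lp_norm 2 M f = \<bar>pairing M f f\<bar>"
    using L2_norm_sq[of M f] pairing_self_nonneg[of M f] by (simp add: power2_eq_square)
  also have "\<dots> \<le> N * Lp_norm 2 M f" by (intro assms)
  finally show ?thesis using pos by simp
qed (use assms in simp)

text \<open>The negative part v of f satisfies <v,v> = -<f,v>, which the hypothesis makes
  nonpositive. Positivity of adjoints and resolvents, which are given only weakly, is obtained in
  this way.\<close>

lemma L2_nonnegI:
  assumes "f \<in> Lp 2 M" "\<And>v. v \<in> Lp 2 M \<Longrightarrow> nonneg_ae M v \<Longrightarrow> 0 \<le> pairing M f v"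
  shows "nonneg_ae M f"
proof -
  define v where "v = (\<lambda>x. max (- f x) 0)"
  have v: "v \<in> Lp 2 M" using assms(1) unfolding v_def by auto
  have "pairing M v v = pairing M (\<lambda>x. - f x) v"
    unfolding pairing_def v_def by (intro Bochner_Integration.integral_cong) auto
  also have "\<dots> = - pairing M f v"
    using pairing_cmult_left[of M "-1" f v] by simp
  also have "\<dots> \<le> 0" using assms(2)[OF v] by (simp add: nonneg_ae_def v_def)
  finally have "AE x in M. v x = 0" using v by (intro L2_AE_zeroI)
  then show ?thesis by (auto simp: nonneg_ae_def v_def max_def split: if_splits elim!: eventually_mono)
qed

lemma L2_leI:
  assumes "f \<in> Lp 2 M" "g \<in> Lp 2 M"
    "\<And>v. v \<in> Lp 2 M \<Longrightarrow> nonneg_ae M v \<Longrightarrow> pairing M f v \<le> pairing M g v"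
  shows "AE x in M. f x \<le> g x"
proof -
  have "nonneg_ae M (\<lambda>x. g x - f x)"
    using assms by (intro L2_nonnegI) (auto simp: pairing_diff_left)
  then show ?thesis by (simp add: nonneg_ae_def)
qed

section \<open>Completeness of L_2 and the Riesz representation theorem\<close>

text \<open>The squares of the partial sums increase and have integrals at most 4, so by monotone
  convergence their supremum is integrable, hence finite almost everywhere. Besides completeness
  this also supplies the single vector on which a family of positive operators would blow
  up.\<close>

lemma L2_series_bound:
  assumes u: "\<And>n. u n \<in> Lp 2 M" and nonneg: "\<And>n x. 0 \<le> u n x"
    and norm: "\<And>n. Lp_norm 2 M (u n) \<le> (1/2)^n"
  obtains U where "U \<in> Lp 2 M" "AE x in M. summable (\<lambda>n. u n x) \<and> (\<Sum>n. u n x) = U x"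
proof -
  define s where "s n x = (\<Sum>i<n. u i x)" for n x
  have s0: "0 \<le> s n x" for n x unfolding s_def by (simp add: sum_nonneg nonneg)
  \<comment> \<open>The bound is the partial sum of the geometric series, which makes the induction
    close.\<close>
  have sL: "s n \<in> Lp 2 M \<and> Lp_norm 2 M (s n) \<le> 2 - 2 * (1/2)^n" for n
  proof (induction n)
    case 0
    then show ?case by (simp add: s_def[abs_def] L2_norm_eq pairing_def)
  next
    case (Suc n)
    have eq: "s (Suc n) = (\<lambda>x. s n x + u n x)" by (auto simp: s_def)
    have "Lp_norm 2 M (s (Suc n)) \<le> Lp_norm 2 M (s n) + Lp_norm 2 M (u n)"
      unfolding eq using Suc u by (intro L2_norm_triangle) auto
    then show ?case using Suc norm[of n] u[of n] unfolding eq by auto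
  qed
  have nn: "(\<integral>\<^sup>+x. ennreal (s n x * s n x) \<partial>M) \<le> ennreal 4" for n
  proof -
    have "(\<integral>\<^sup>+x. ennreal (s n x * s n x) \<partial>M) = ennreal (pairing M (s n) (s n))"
      unfolding pairing_def using sL[of n] by (intro nn_integral_eq_integral) (auto simp: L2_iff)
    also have "\<dots> \<le> ennreal 4"
    proof (rule ennreal_leI)
      have "Lp_norm 2 M (s n) \<le> 2" using sL[of n] zero_le_power[of "1/2::real" n] by linarith
      then have "(Lp_norm 2 M (s n))\<^sup>2 \<le> 2\<^sup>2" by (rule power_mono) (rule Lp_norm_nonneg)
      then show "pairing M (s n) (s n) \<le> 4" by (simp add: L2_norm_sq)
    qed
    finally show ?thesis .
  qed
  have mono: "mono (\<lambda>n. ennreal (s n x * s n x))" for x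
    unfolding mono_def
  proof (intro allI impI)
    fix m n :: nat assume "m \<le> n"
    then have "s m x \<le> s n x" unfolding s_def by (intro sum_mono2) (auto simp: nonneg)
    then show "ennreal (s m x * s m x) \<le> ennreal (s n x * s n x)"
      using s0 by (intro ennreal_leI mult_mono) auto
  qed
  have m [measurable]: "s n \<in> borel_measurable M" for n using sL[of n] Lp_measurable by blast
  have um [measurable]: "u n \<in> borel_measurable M" for n using u[of n] Lp_measurable by blast
  have "(\<integral>\<^sup>+x. (SUP n. ennreal (s n x * s n x)) \<partial>M) = (SUP n. \<integral>\<^sup>+x. ennreal (s n x * s n x) \<partial>M)"
    using mono by (intro nn_integral_monotone_convergence_SUP) (auto simp: mono_def le_fun_def)
  also have "\<dots> \<le> ennreal 4" by (intro SUP_least nn)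
  finally have le4: "(\<integral>\<^sup>+x. (SUP n. ennreal (s n x * s n x)) \<partial>M) \<le> ennreal 4" .
  then have "AE x in M. (SUP n. ennreal (s n x * s n x)) \<noteq> \<infinity>"
    by (intro nn_integral_PInf_AE) (auto simp: top_unique)
  then have conv: "AE x in M. summable (\<lambda>n. u n x)"
  proof eventually_elim
    case (elim x)
    define B where "B = enn2real (SUP n. ennreal (s n x * s n x))"
    have B_eq: "ennreal B = (SUP n. ennreal (s n x * s n x))"
      unfolding B_def using elim by (intro ennreal_enn2real) (simp only: less_top infinity_ennreal_def)
    have B0: "0 \<le> B" by (simp add: B_def)
    have "s n x \<le> sqrt B" for n
    proof (rule real_le_rsqrt)
      have "ennreal (s n x * s n x) \<le> ennreal B"
        unfolding B_eq by (rule SUP_upper) simp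
      then show "(s n x)\<^sup>2 \<le> B"
        using B0 by (simp add: power2_eq_square)
    qed
    then show ?case unfolding s_def
      by (intro summableI_nonneg_bounded[where x = "sqrt B"] nonneg) auto
  qed
  define U where "U x = (\<Sum>n. u n x)" for x
  have Um [measurable]: "U \<in> borel_measurable M" unfolding U_def by measurable
  have "AE x in M. ennreal (U x * U x) \<le> (SUP n. ennreal (s n x * s n x))"
    using conv
  proof eventually_elim
    case (elim x)
    then have "(\<lambda>n. s n x) \<longlonglongrightarrow> U x"
      unfolding s_def U_def by (rule summable_LIMSEQ)
    then have "(\<lambda>n. ennreal (s n x * s n x)) \<longlonglongrightarrow> ennreal (U x * U x)"
      by (intro tendsto_ennrealI tendsto_mult)
    then have "(SUP n. ennreal (s n x * s n x)) = ennreal (U x * U x)"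
      using LIMSEQ_SUP[OF mono[of x]] LIMSEQ_unique by blast
    then show ?case by simp
  qed
  then have "(\<integral>\<^sup>+x. ennreal (U x * U x) \<partial>M) \<le> ennreal 4"
    by (rule order_trans[OF nn_integral_mono_AE le4])
  then have "integrable M (\<lambda>x. U x * U x)"
    by (intro integrableI_nonneg) (auto intro: le_less_trans[of _ "ennreal 4"])
  then have "U \<in> Lp 2 M" by (simp add: L2_iff)
  then show thesis using conv that[of U] by (auto simp: U_def)
qed

text \<open>Applied to the absolute differences, the series lemma gives pointwise convergence almost
  everywhere and one function U in L_2 above every |u_n - w|; dominated convergence with U^2 does
  the rest.\<close>

lemma L2_complete:
  assumes u: "\<And>n. u n \<in> Lp 2 M"
    and norm: "\<And>n. Lp_norm 2 M (\<lambda>x. u (Suc n) x - u n x) \<le> (1/2)^n"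
  obtains w where "w \<in> Lp 2 M" "(\<lambda>n. Lp_norm 2 M (\<lambda>x. u n x - w x)) \<longlonglongrightarrow> 0"
proof -
  define d where "d n x = \<bar>u (Suc n) x - u n x\<bar>" for n x
  have d: "d n \<in> Lp 2 M" for n unfolding d_def by (intro L2_abs L2_diff u)
  have d0: "0 \<le> d n x" for n x by (simp add: d_def)
  have dn: "Lp_norm 2 M (d n) \<le> (1/2)^n" for n
    using norm[of n] by (simp add: d_def L2_norm_eq pairing_def)
  obtain U where U: "U \<in> Lp 2 M"
    and sums: "AE x in M. summable (\<lambda>n. d n x) \<and> (\<Sum>n. d n x) = U x"
    by (rule L2_series_bound[of d M, OF d d0 dn])
  have um [measurable]: "u n \<in> borel_measurable M" for n using u[of n] Lp_measurable by blast
  have Um [measurable]: "U \<in> borel_measurable M" using U Lp_measurable by blast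
  \<comment> \<open>Where the sequence diverges the value of \<open>lim\<close> is unspecified; this
    is a null set, and measurability holds regardless.\<close>
  define w where "w x = lim (\<lambda>n. u n x)" for x
  have wm [measurable]: "w \<in> borel_measurable M" unfolding w_def by (rule borel_measurable_lim_metric) (rule um)
  have conv: "AE x in M. (\<lambda>n. u n x) \<longlonglongrightarrow> w x \<and> (\<forall>n. \<bar>u n x - w x\<bar> \<le> U x)"
    using sums
  proof eventually_elim
    case (elim x)
    have s: "summable (\<lambda>n. u (Suc n) x - u n x)"
      by (rule summable_rabs_cancel) (use elim in \<open>simp add: d_def\<close>)
    have eq: "(\<Sum>i<n. u (Suc i) x - u i x) = u n x - u 0 x" for n
      by (rule sum_lessThan_telescope)
    have "(\<lambda>n. u n x - u 0 x) \<longlonglongrightarrow> (\<Sum>n. u (Suc n) x - u n x)"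
      using summable_LIMSEQ[OF s] unfolding eq .
    then have "(\<lambda>n. (u n x - u 0 x) + u 0 x) \<longlonglongrightarrow> (\<Sum>n. u (Suc n) x - u n x) + u 0 x"
      by (rule tendsto_add) (rule tendsto_const)
    then have "convergent (\<lambda>n. u n x)" unfolding convergent_def by auto
    then have c: "(\<lambda>n. u n x) \<longlonglongrightarrow> w x"
      unfolding w_def by (simp only: convergent_LIMSEQ_iff)
    moreover have "\<bar>u n x - w x\<bar> \<le> U x" for n
    proof (rule LIMSEQ_le_const2)
      show "(\<lambda>m. \<bar>u n x - u m x\<bar>) \<longlonglongrightarrow> \<bar>u n x - w x\<bar>"
        by (intro tendsto_intros c)
      have "\<bar>u n x - u m x\<bar> \<le> U x" if "n \<le> m" for m
      proof -
        have "u m x - u n x = (\<Sum>i=n..<m. u (Suc i) x - u i x)"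
          using sum_Suc_diff'[OF that, of "\<lambda>i. u i x"] by simp
        then have "\<bar>u n x - u m x\<bar> \<le> (\<Sum>i=n..<m. d i x)"
          unfolding d_def by (metis abs_minus_commute sum_abs)
        also have "\<dots> \<le> U x"
          using elim sum_le_suminf[of "\<lambda>n. d n x" "{n..<m}"] by (auto simp: d_def)
        finally show ?thesis .
      qed
      then show "\<exists>N. \<forall>m\<ge>N. \<bar>u n x - u m x\<bar> \<le> U x" by blast
    qed
    ultimately show ?case by blast
  qed
  have diff: "(\<lambda>x. u 0 x - w x) \<in> Lp 2 M"
  proof (rule L2_dominated[OF U])
    show "AE x in M. \<bar>u 0 x - w x\<bar> \<le> \<bar>U x\<bar>"
      using conv by eventually_elim (auto intro: order_trans[OF _ abs_ge_self])
  qed simp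
  have w: "w \<in> Lp 2 M"
    using L2_diff[OF u[of 0] diff] by simp
  have "(\<lambda>n. \<integral>x. (u n x - w x) * (u n x - w x) \<partial>M) \<longlonglongrightarrow> (\<integral>x. 0 \<partial>M)"
  proof (rule integral_dominated_convergence[where w = "\<lambda>x. U x * U x"])
    show "integrable M (\<lambda>x. U x * U x)" using U by (simp add: L2_iff)
    show "AE x in M. (\<lambda>n. (u n x - w x) * (u n x - w x)) \<longlonglongrightarrow> 0"
      using conv
    proof eventually_elim
      case (elim x)
      then have "(\<lambda>n. u n x - w x) \<longlonglongrightarrow> 0" by (simp add: LIM_zero)
      from tendsto_mult[OF this this] show ?case by simp
    qed
    show "AE x in M. norm ((u n x - w x) * (u n x - w x)) \<le> U x * U x" for n
      using conv
    proof eventually_elim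
      case (elim x)
      then have "\<bar>u n x - w x\<bar> * \<bar>u n x - w x\<bar> \<le> U x * U x"
        by (intro mult_mono) (auto intro: order_trans[OF abs_ge_zero])
      then show ?case by (simp add: abs_mult)
    qed
  qed auto
  then have "(\<lambda>n. Lp_norm 2 M (\<lambda>x. u n x - w x)) \<longlonglongrightarrow> sqrt 0"
    unfolding L2_norm_eq pairing_def by (intro tendsto_real_sqrt) simp
  then show thesis using that[OF w] by simp
qed

text \<open>The Riesz vector minimises J(u) = <u,u> - 2\<phi>(u): the parallelogram law makes a fast
  minimising sequence Cauchy, and the vanishing first variation of J at the minimiser is the
  representation.\<close>

lemma L2_Riesz:
  assumes add: "\<And>u v. u \<in> Lp 2 M \<Longrightarrow> v \<in> Lp 2 M \<Longrightarrow> \<phi> (\<lambda>x. u x + v x) = \<phi> u + \<phi> v"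
    and scale: "\<And>c u. u \<in> Lp 2 M \<Longrightarrow> \<phi> (\<lambda>x. c * u x) = c * \<phi> u"
    and bound: "\<And>u. u \<in> Lp 2 M \<Longrightarrow> \<bar>\<phi> u\<bar> \<le> N * Lp_norm 2 M u"
  obtains w where "w \<in> Lp 2 M" "\<And>u. u \<in> Lp 2 M \<Longrightarrow> \<phi> u = pairing M w u"
proof -
  define J where "J u = pairing M u u - 2 * \<phi> u" for u
  have diff: "\<phi> (\<lambda>x. u x - v x) = \<phi> u - \<phi> v" if "u \<in> Lp 2 M" "v \<in> Lp 2 M" for u v
    using add[OF that(1) L2_cmult[OF that(2), of "-1"]] scale[OF that(2), of "-1"] by simp
  have lower: "- N\<^sup>2 \<le> J u" if "u \<in> Lp 2 M" for u
  proof -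
    have "0 \<le> (Lp_norm 2 M u - N)\<^sup>2" by simp
    then show ?thesis
      using bound[OF that] by (simp add: J_def power2_diff L2_norm_sq mult.commute)
  qed
  define m where "m = Inf (J ` Lp 2 M)"
  have bdd: "bdd_below (J ` Lp 2 M)" using lower by (auto intro!: bdd_belowI)
  have m: "m \<le> J u" if "u \<in> Lp 2 M" for u
    unfolding m_def using bdd that by (intro cInf_lower) auto
  \<comment> \<open>With this excess the parallelogram estimate bounds the squared step by (1/8 +
    1/2) (1/4)^n, below the square of the (1/2)^n that \<open>L2_complete\<close> asks for.\<close>
  have "\<exists>u. u \<in> Lp 2 M \<and> J u < m + (1/2)^(2*n+2)" for n
  proof -
    have "Inf (J ` Lp 2 M) < m + (1/2)^(2*n+2)" by (simp add: m_def)
    then show ?thesis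
      using bdd L2_zero[of M] by (subst (asm) cInf_less_iff) auto
  qed
  then obtain u where u: "\<And>n. u n \<in> Lp 2 M" and J: "\<And>n. J (u n) < m + (1/2)^(2*n+2)"
    by metis
  \<comment> \<open>The midpoint of f and g cannot lie below the infimum m; expanding J there gives
    the estimate.\<close>
  have par: "(Lp_norm 2 M (\<lambda>x. f x - g x))\<^sup>2 \<le> 2 * (J f - m) + 2 * (J g - m)"
    if f: "f \<in> Lp 2 M" and g: "g \<in> Lp 2 M" for f g
  proof -
    have "m \<le> J (\<lambda>x. 1/2 * (f x + g x))" by (intro m L2_cmult L2_add f g)
    also have "\<dots> = (pairing M f f + 2 * pairing M f g + pairing M g g) / 4 - (\<phi> f + \<phi> g)"
      unfolding J_def using f g
      by (simp only: scale add L2_add pairing_linear)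
        (simp add: pairing_commute[of M g f] field_simps)
    finally have "4 * m \<le> pairing M f f + 2 * pairing M f g + pairing M g g - 4 * \<phi> f - 4 * \<phi> g"
      by argo
    moreover have "(Lp_norm 2 M (\<lambda>x. f x - g x))\<^sup>2 = pairing M f f - 2 * pairing M f g + pairing M g g"
      unfolding L2_norm_sq using f g
      by (simp add: pairing_linear L2_diff pairing_commute[of M g f])
    ultimately show ?thesis unfolding J_def by argo
  qed
  have step: "Lp_norm 2 M (\<lambda>x. u (Suc n) x - u n x) \<le> (1/2)^n" for n
  proof (rule power2_le_imp_le)
    have "(Lp_norm 2 M (\<lambda>x. u (Suc n) x - u n x))\<^sup>2
        \<le> 2 * (J (u (Suc n)) - m) + 2 * (J (u n) - m)"
      by (intro par u)
    also have "\<dots> \<le> 2 * (1/2)^(2*Suc n+2) + 2 * (1/2)^(2*n+2)"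
      using J[of n] J[of "Suc n"] by (intro add_mono mult_left_mono) auto
    also have "\<dots> \<le> ((1/2)^n)\<^sup>2"
      by (simp add: power_mult_distrib power_add field_simps flip: power_mult)
    finally show "(Lp_norm 2 M (\<lambda>x. u (Suc n) x - u n x))\<^sup>2 \<le> ((1/2)^n)\<^sup>2" .
  qed simp
  obtain w where w: "w \<in> Lp 2 M" and lim: "(\<lambda>n. Lp_norm 2 M (\<lambda>x. u n x - w x)) \<longlonglongrightarrow> 0"
    by (rule L2_complete[OF u step])
  have J': "(\<lambda>n. J (u n)) \<longlonglongrightarrow> m"
  proof (rule tendsto_sandwich)
    show "\<forall>\<^sub>F n in sequentially. m \<le> J (u n)" using m u by simp
    show "\<forall>\<^sub>F n in sequentially. J (u n) \<le> m + (1/2)^(2*n+2)" using J by (simp add: less_imp_le)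
    have "(\<lambda>n. m + (1/4) * (1/4)^n) \<longlonglongrightarrow> m + (1/4) * 0"
      by (intro tendsto_intros LIMSEQ_power_zero) simp
    moreover have "(1/2::real)^(2*n+2) = (1/4) * (1/4)^n" for n
      by (induction n) (simp_all add: eval_nat_numeral)
    ultimately show "(\<lambda>n. m + (1/2)^(2*n+2)) \<longlonglongrightarrow> m"
      by simp
  qed simp
  have "J w \<le> m"
  proof (rule LIMSEQ_le_const[where X = "\<lambda>n. J (u n) + 2 * (N + Lp_norm 2 M w) * Lp_norm 2 M (\<lambda>x. u n x - w x)"])
    show "(\<lambda>n. J (u n) + 2 * (N + Lp_norm 2 M w) * Lp_norm 2 M (\<lambda>x. u n x - w x)) \<longlonglongrightarrow> m"
      using tendsto_add[OF J' tendsto_mult_left[OF lim, of "2 * (N + Lp_norm 2 M w)"]] by simp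
    have "J w \<le> J (u n) + 2 * (N + Lp_norm 2 M w) * Lp_norm 2 M (\<lambda>x. u n x - w x)" for n
    proof -
      let ?d = "\<lambda>x. u n x - w x"
      have d: "?d \<in> Lp 2 M" using u w by auto
      have "J (u n) = J w + 2 * pairing M w ?d + pairing M ?d ?d - 2 * \<phi> ?d"
        unfolding J_def using u[of n] w
        by (simp add: diff pairing_linear L2_diff pairing_commute[of M "u n" w])
      moreover have "\<bar>pairing M w ?d\<bar> \<le> Lp_norm 2 M w * Lp_norm 2 M ?d"
        by (rule L2_Cauchy_Schwarz[OF w d])
      ultimately show ?thesis
        using bound[OF d] pairing_self_nonneg[of M ?d] by (simp add: algebra_simps)
    qed
    then show "\<exists>N'. \<forall>n\<ge>N'. J w \<le> J (u n) + 2 * (N + Lp_norm 2 M w) * Lp_norm 2 M (\<lambda>x. u n x - w x)"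
      by blast
  qed
  have "\<phi> v = pairing M w v" if v: "v \<in> Lp 2 M" for v
  proof -
    define a where "a = pairing M w v - \<phi> v"
    have *: "0 \<le> 2 * c * a + c\<^sup>2 * pairing M v v" for c
    proof -
      have "m \<le> J (\<lambda>x. w x + c * v x)" using v w by (intro m) auto
      also have "\<dots> = J w + 2 * c * a + c\<^sup>2 * pairing M v v"
        unfolding J_def a_def using v w
        by (simp add: add scale pairing_linear L2_cmult L2_add pairing_commute[of M v w]
            algebra_simps power2_eq_square)
      finally show ?thesis using \<open>J w \<le> m\<close> by simp
    qed
    have "a = 0"
    proof (rule ccontr)
      assume "a \<noteq> 0"
      \<comment> \<open>The exact minimiser in c would be -a/<v,v>. Adding 1 keeps the denominator
        positive when v vanishes and still makes the value at most -a^2/k.\<close>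
      define k where "k = pairing M v v + 1"
      have k: "0 < k" "pairing M v v < k" using pairing_self_nonneg[of M v] by (auto simp: k_def)
      have "0 \<le> 2 * (- a / k) * a + (- a / k)\<^sup>2 * pairing M v v" by (rule *)
      also have "\<dots> \<le> 2 * (- a / k) * a + (- a / k)\<^sup>2 * k"
        using k by (intro add_left_mono mult_left_mono) auto
      also have "\<dots> = - (a * a / k)" using k by (simp add: field_simps power2_eq_square)
      also have "\<dots> < 0" using k \<open>a \<noteq> 0\<close> by (auto simp: zero_less_divide_iff zero_less_mult_iff)
      finally show False by simp
    qed
    then show ?thesis by (simp add: a_def)
  qed
  then show thesis using that w by blast
qed

section \<open>Conjugate exponents and the Hoelder inequality\<close>

text \<open>In \<open>ennreal\<close>, 1/\<infinity> = 0 and 1/0 = \<infinity>, so the relation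
  includes the endpoints and excludes r' = 0. The case r = \<infinity> does occur later, as p' for p
  = 1.\<close>

lemma conjugate_exponents_cases:
  fixes r r' :: ennreal
  assumes "1 \<le> r" "1 / r + 1 / r' = 1"
  obtains "r = 1" "r' = \<infinity>" | "r = \<infinity>" "r' = 1"
  | a b where "r = ennreal a" "r' = ennreal b" "1 < a" "1 < b" "1 / a + 1 / b = 1"
proof (cases r)
  case top
  then have "1 / r' = 1" using assms by simp
  then have "r' = 1"
  proof (cases r')
    case (real b)
    show ?thesis
    proof (cases "b = 0")
      case False
      then show ?thesis
        using real \<open>1 / r' = 1\<close> by (simp add: divide_ennreal flip: ennreal_1)
    qed (use real \<open>1 / r' = 1\<close> in simp)
  qed (use \<open>1 / r' = 1\<close> in simp)
  then show thesis using that(2) top by simp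
next
  case (real a)
  then have a: "1 \<le> a" using assms(1) by (metis ennreal_1 ennreal_le_iff)
  then have ra: "1 / r = ennreal (1 / a)" using real by (simp add: divide_ennreal flip: ennreal_1)
  show thesis
  proof (cases r')
    case top
    then have "ennreal (1 / a) = 1" using ra assms(2) by simp
    then have "1 / a = 1" using a by (metis ennreal_1 ennreal_inj zero_le_divide_1_iff zero_le_one order_trans)
    then show thesis using that(1) top real by simp
  next
    case (real b)
    have "b \<noteq> 0"
    proof
      assume "b = 0"
      then have "1 / r' = \<infinity>" using real by simp
      then show False using assms(2) by simp
    qed
    then have b: "0 < b" using real by simp
    have "ennreal (1 / a) + ennreal (1 / b) = 1"
      using assms(2) ra real b by (simp add: divide_ennreal flip: ennreal_1)
    then have "ennreal (1 / a + 1 / b) = ennreal 1"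
      using a b by (subst ennreal_plus) auto
    then have sum: "1 / a + 1 / b = 1"
      using a b by (subst (asm) ennreal_inj) auto
    have "0 < 1 / a" "0 < 1 / b" using a b by auto
    then have "1 / a < 1" "1 / b < 1" using sum by linarith+
    then have "1 < a" "1 < b" using a b by (auto simp: divide_less_eq_1)
    then show thesis using that(3) sum real \<open>r = ennreal a\<close> by blast
  qed
qed

lemma Lp_real_iff:
  "0 < a \<Longrightarrow> f \<in> Lp (ennreal a) M \<longleftrightarrow> f \<in> borel_measurable M \<and> integrable M (\<lambda>x. \<bar>f x\<bar> powr a)"
  by (simp add: Lp_def)

lemma Lp_real_norm: "0 < a \<Longrightarrow> Lp_norm (ennreal a) M f = (\<integral>x. \<bar>f x\<bar> powr a \<partial>M) powr (1/a)"
  by (simp add: Lp_norm_def)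

lemma L1_iff: "f \<in> Lp 1 M \<longleftrightarrow> integrable M f"
  using Lp_real_iff[of 1 f M] by (auto simp: integrable_abs_iff)

lemma L1_norm: "Lp_norm 1 M f = (\<integral>x. \<bar>f x\<bar> \<partial>M)"
  using Lp_real_norm[of 1 M f] by (simp add: integral_nonneg)

lemma Linf_AE:
  assumes "f \<in> Lp \<infinity> M"
  shows "AE x in M. \<bar>f x\<bar> \<le> Lp_norm \<infinity> M f"
  using esssup_AE[of "\<lambda>x. ennreal \<bar>f x\<bar>" M]
proof eventually_elim
  case (elim x)
  moreover have "esssup M (\<lambda>x. ennreal \<bar>f x\<bar>) = ennreal (Lp_norm \<infinity> M f)"
    using assms by (simp add: Lp_def Lp_norm_def)
  ultimately show ?case by (simp add: Lp_norm_nonneg)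
qed

lemma LinfI:
  assumes "f \<in> borel_measurable M" "AE x in M. \<bar>f x\<bar> \<le> c" "0 \<le> c"
  shows "f \<in> Lp \<infinity> M" "Lp_norm \<infinity> M f \<le> c"
proof -
  have "esssup M (\<lambda>x. ennreal \<bar>f x\<bar>) \<le> ennreal c"
    using assms by (intro esssup_I) (auto elim!: eventually_mono intro: ennreal_leI)
  then show "f \<in> Lp \<infinity> M" "Lp_norm \<infinity> M f \<le> c"
    using assms by (auto simp: Lp_def Lp_norm_def enn2real_leI intro: le_less_trans)
qed

text \<open>Young's inequality is applied to f/A and g/B with A and B the norms: after integration
  the two terms contribute 1/a and 1/b, which sum to 1. A vanishing norm cannot be divided by; then
  the function is 0 almost everywhere.\<close>

lemma Holder_real:
  assumes ab: "1 < a" "1 < b" "1 / a + 1 / b = (1::real)"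
    and f: "f \<in> Lp (ennreal a) M" and g: "g \<in> Lp (ennreal b) M"
  shows "integrable M (\<lambda>x. f x * g x)"
    and "\<bar>pairing M f g\<bar> \<le> Lp_norm (ennreal a) M f * Lp_norm (ennreal b) M g"
proof -
  have fm [measurable]: "f \<in> borel_measurable M" and gm [measurable]: "g \<in> borel_measurable M"
    using f g Lp_measurable by blast+
  have fi: "integrable M (\<lambda>x. \<bar>f x\<bar> powr a)" and gi: "integrable M (\<lambda>x. \<bar>g x\<bar> powr b)"
    using f g ab by (auto simp: Lp_real_iff)
  define A where "A = Lp_norm (ennreal a) M f"
  define B where "B = Lp_norm (ennreal b) M g"
  have A: "A powr a = (\<integral>x. \<bar>f x\<bar> powr a \<partial>M)" and B: "B powr b = (\<integral>x. \<bar>g x\<bar> powr b \<partial>M)"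
    using ab by (auto simp: A_def B_def Lp_real_norm powr_powr)
  have "A \<ge> 0" "B \<ge> 0" by (auto simp: A_def B_def Lp_norm_nonneg)
  show int: "integrable M (\<lambda>x. f x * g x)"
  proof (rule Bochner_Integration.integrable_bound)
    show "integrable M (\<lambda>x. \<bar>f x\<bar> powr a / a + \<bar>g x\<bar> powr b / b)"
      using fi gi by auto
    show "AE x in M. norm (f x * g x) \<le> norm (\<bar>f x\<bar> powr a / a + \<bar>g x\<bar> powr b / b)"
    proof (rule AE_I2)
      fix x
      have "\<bar>f x\<bar> * \<bar>g x\<bar> \<le> \<bar>f x\<bar> powr a / a + \<bar>g x\<bar> powr b / b"
        using ab by (intro Youngs_inequality) auto
      then show "norm (f x * g x) \<le> norm (\<bar>f x\<bar> powr a / a + \<bar>g x\<bar> powr b / b)"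
        by (simp add: abs_mult)
    qed
  qed simp
  have zero: "pairing M f g = 0" if "A = 0 \<or> B = 0"
  proof -
    from that have "(AE x in M. f x = 0) \<or> (AE x in M. g x = 0)"
    proof
      assume "A = 0"
      then have "(\<integral>x. \<bar>f x\<bar> powr a \<partial>M) = 0" using A ab by simp
      then show ?thesis using fi by (subst (asm) integral_nonneg_eq_0_iff_AE) auto
    next
      assume "B = 0"
      then have "(\<integral>x. \<bar>g x\<bar> powr b \<partial>M) = 0" using B ab by simp
      then show ?thesis using gi by (subst (asm) integral_nonneg_eq_0_iff_AE) auto
    qed
    then have "AE x in M. f x * g x = 0" by (auto elim: eventually_mono)
    then have "(\<integral>x. f x * g x \<partial>M) = (\<integral>x. 0 \<partial>M)" by (intro integral_cong_AE) auto
    then show ?thesis by (simp add: pairing_def)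
  qed
  show "\<bar>pairing M f g\<bar> \<le> Lp_norm (ennreal a) M f * Lp_norm (ennreal b) M g"
  proof (cases "A = 0 \<or> B = 0")
    case True
    then show ?thesis using zero by (simp add: Lp_norm_nonneg)
  next
    case False
    then have AB: "0 < A" "0 < B" using \<open>A \<ge> 0\<close> \<open>B \<ge> 0\<close> by auto
    have le: "\<bar>f x * g x\<bar> \<le> A * B * (\<bar>f x\<bar> powr a / (a * A powr a) + \<bar>g x\<bar> powr b / (b * B powr b))" for x
    proof -
      have "(\<bar>f x\<bar> / A) * (\<bar>g x\<bar> / B) \<le> (\<bar>f x\<bar> / A) powr a / a + (\<bar>g x\<bar> / B) powr b / b"
        using ab AB by (intro Youngs_inequality) auto
      also have "\<dots> = \<bar>f x\<bar> powr a / (a * A powr a) + \<bar>g x\<bar> powr b / (b * B powr b)"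
        using AB by (simp add: powr_divide mult.commute)
      finally have "A * B * ((\<bar>f x\<bar> / A) * (\<bar>g x\<bar> / B)) \<le> A * B * (\<bar>f x\<bar> powr a / (a * A powr a) + \<bar>g x\<bar> powr b / (b * B powr b))"
        using AB by (intro mult_left_mono) auto
      then show ?thesis using AB by (simp add: abs_mult)
    qed
    have "\<bar>pairing M f g\<bar> \<le> (\<integral>x. \<bar>f x * g x\<bar> \<partial>M)"
      unfolding pairing_def by (rule integral_abs_bound)
    also have "\<dots> \<le> (\<integral>x. A * B * (\<bar>f x\<bar> powr a / (a * A powr a) + \<bar>g x\<bar> powr b / (b * B powr b)) \<partial>M)"
      using le int fi gi by (intro integral_mono) auto
    also have "\<dots> = A * B * (A powr a / (a * A powr a) + B powr b / (b * B powr b))"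
      using fi gi by (simp add: A B)
    also have "\<dots> = A * B * (1 / a + 1 / b)" using AB by simp
    finally show ?thesis using ab by (simp add: A_def B_def)
  qed
qed

lemma Holder_1_inf:
  assumes f: "f \<in> Lp 1 M" and g: "g \<in> Lp \<infinity> M"
  shows "integrable M (\<lambda>x. f x * g x)" "\<bar>pairing M f g\<bar> \<le> Lp_norm 1 M f * Lp_norm \<infinity> M g"
proof -
  have fi: "integrable M f" using f by (simp add: L1_iff)
  have gm [measurable]: "g \<in> borel_measurable M" using g by (rule Lp_measurable)
  have le: "AE x in M. \<bar>f x * g x\<bar> \<le> \<bar>f x\<bar> * Lp_norm \<infinity> M g"
    using Linf_AE[OF g] by eventually_elim (simp add: abs_mult mult_left_mono)
  have i2: "integrable M (\<lambda>x. \<bar>f x\<bar> * Lp_norm \<infinity> M g)" using fi by auto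
  show int: "integrable M (\<lambda>x. f x * g x)"
    by (rule Bochner_Integration.integrable_bound[OF i2])
      (use fi le in \<open>auto simp: Lp_norm_nonneg elim: eventually_mono\<close>)
  have "\<bar>pairing M f g\<bar> \<le> (\<integral>x. \<bar>f x * g x\<bar> \<partial>M)"
    unfolding pairing_def by (rule integral_abs_bound)
  also have "\<dots> \<le> (\<integral>x. \<bar>f x\<bar> * Lp_norm \<infinity> M g \<partial>M)"
    using int i2 le by (intro integral_mono_AE) auto
  finally show "\<bar>pairing M f g\<bar> \<le> Lp_norm 1 M f * Lp_norm \<infinity> M g" by (simp add: L1_norm)
qed

lemma Holder:
  fixes r r' :: ennreal
  assumes "1 \<le> r" "1 / r + 1 / r' = 1" and f: "f \<in> Lp r M" and g: "g \<in> Lp r' M"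
  shows "integrable M (\<lambda>x. f x * g x)" "\<bar>pairing M f g\<bar> \<le> Lp_norm r M f * Lp_norm r' M g"
proof -
  have "integrable M (\<lambda>x. f x * g x) \<and> \<bar>pairing M f g\<bar> \<le> Lp_norm r M f * Lp_norm r' M g"
    using assms(1,2)
  proof (cases rule: conjugate_exponents_cases)
    case 1
    then show ?thesis using Holder_1_inf[of f M g] f g by simp
  next
    case 2
    then show ?thesis using Holder_1_inf[of g M f] f g
      by (simp add: mult.commute pairing_commute)
  next
    case (3 a b)
    then show ?thesis using Holder_real[OF 3(3-5), of f M g] f g by auto
  qed
  then show "integrable M (\<lambda>x. f x * g x)" "\<bar>pairing M f g\<bar> \<le> Lp_norm r M f * Lp_norm r' M g"
    by auto
qed

section \<open>Norms by duality: the converse of the Hoelder inequality\<close>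

lemma integral_Fatou_bound:
  fixes F :: "'a \<Rightarrow> real"
  assumes "\<And>n. integrable M (f n)" "\<And>n x. 0 \<le> f n x" "\<And>n. (\<integral>x. f n x \<partial>M) \<le> c"
    "\<And>x. (\<lambda>n. f n x) \<longlonglongrightarrow> F x"
  shows "integrable M F" "(\<integral>x. F x \<partial>M) \<le> c"
proof -
  have fm [measurable]: "f n \<in> borel_measurable M" for n using assms(1)[of n] by auto
  have Fm: "F \<in> borel_measurable M"
    by (rule borel_measurable_LIMSEQ_metric[OF fm assms(4)])
  have F0: "0 \<le> F x" for x by (rule LIMSEQ_le_const[OF assms(4)]) (use assms(2) in auto)
  have c0: "0 \<le> c" by (rule order_trans[OF _ assms(3)[of 0]]) (simp add: assms(2))
  have "(\<integral>\<^sup>+x. ennreal (F x) \<partial>M) = (\<integral>\<^sup>+x. liminf (\<lambda>n. ennreal (f n x)) \<partial>M)"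
    by (intro nn_integral_cong) (metis assms(4) lim_imp_Liminf sequentially_bot tendsto_ennrealI)
  also have "\<dots> \<le> liminf (\<lambda>n. \<integral>\<^sup>+x. ennreal (f n x) \<partial>M)"
    by (intro nn_integral_liminf) simp
  also have "\<dots> \<le> ennreal c"
  proof (rule Liminf_le)
    show "\<forall>\<^sub>F n in sequentially. (\<integral>\<^sup>+x. ennreal (f n x) \<partial>M) \<le> ennreal c"
      using assms by (intro always_eventually allI) (subst nn_integral_eq_integral, auto intro: ennreal_leI)
  qed simp
  finally have le: "(\<integral>\<^sup>+x. ennreal (F x) \<partial>M) \<le> ennreal c" .
  then show int: "integrable M F"
    using Fm F0 by (intro integrableI_nonneg) (auto intro: le_less_trans[of _ "ennreal c"])
  show "(\<integral>x. F x \<partial>M) \<le> c"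
    using le F0 c0 int by (subst (asm) nn_integral_eq_integral) auto
qed

text \<open>On this set any two powers of |w| are comparable, so truncating w to it moves between
  the spaces L_p with finite p; the sets exhaust {w \<noteq> 0} as n grows. Exhausting the whole
  space by sets of finite measure would require \<sigma>-finiteness.\<close>

definition band :: "('a \<Rightarrow> real) \<Rightarrow> nat \<Rightarrow> 'a set" where
  "band w n = {x. 1 / real (Suc n) \<le> \<bar>w x\<bar> \<and> \<bar>w x\<bar> \<le> real (Suc n)}"

lemma band_indicator_eventually:
  "w x \<noteq> 0 \<Longrightarrow> \<forall>\<^sub>F n in sequentially. indicator (band w n) x = (1::real)"
proof -
  assume "w x \<noteq> 0"
  obtain m where m: "\<bar>w x\<bar> \<le> real m" using real_arch_simple by blast
  obtain k where k: "1 / real (Suc k) < \<bar>w x\<bar>"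
    using reals_Archimedean[of "\<bar>w x\<bar>"] \<open>w x \<noteq> 0\<close> by (auto simp: inverse_eq_divide)
  have "x \<in> band w n" if "n \<ge> max m k" for n
  proof -
    have "1 / real (Suc n) \<le> 1 / real (Suc k)" using that by (intro divide_left_mono) auto
    then show ?thesis using m k that by (auto simp: band_def)
  qed
  then show ?thesis
    unfolding eventually_sequentially by (intro exI[of _ "max m k"]) simp
qed

lemma band_measurable [measurable]:
  "w \<in> borel_measurable M \<Longrightarrow> Measurable.pred M (\<lambda>x. x \<in> band w n)"
  unfolding band_def by simp

text \<open>The test function v is the one with equality in Hoelder. With J the integral of |w|^a
  over the band, J = <w,v> \<le> N J^(1-1/a), and J is finite because w is in L_2; so J \<le> N^a,
  and Fatou removes the band. The hypothesis names only these v, since they are measured in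
  L_\<infinity> for a = 1 and in L_b for a > 1.\<close>

lemma converse_Holder_real:
  assumes a: "1 \<le> a" and w: "w \<in> Lp 2 M" and N: "0 \<le> N"
    and le: "\<And>n v. v = (\<lambda>x. sgn (w x) * \<bar>w x\<bar> powr (a - 1) * indicator (band w n) x) \<Longrightarrow>
      v \<in> Lp 2 M \<Longrightarrow> integrable M (\<lambda>x. \<bar>w x\<bar> powr a * indicator (band w n) x) \<Longrightarrow>
      pairing M w v \<le> N * (\<integral>x. \<bar>w x\<bar> powr a * indicator (band w n) x \<partial>M) powr (1 - 1/a)"
  shows "w \<in> Lp (ennreal a) M \<and> Lp_norm (ennreal a) M w \<le> N"
proof
  have wm [measurable]: "w \<in> borel_measurable M" using w Lp_measurable by blast
  have w2: "integrable M (\<lambda>x. w x * w x)" using w by (simp add: L2_iff)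
  define I where "I n x = \<bar>w x\<bar> powr a * indicator (band w n) x" for n x
  have I0: "0 \<le> I n x" for n x by (simp add: I_def)
  have Im [measurable]: "I n \<in> borel_measurable M" for n unfolding I_def by measurable
  have Ii: "integrable M (I n)" for n
  proof (rule Bochner_Integration.integrable_bound)
    show "integrable M (\<lambda>x. real (Suc n) powr a * (real (Suc n))\<^sup>2 * (w x * w x))" using w2 by simp
    show "AE x in M. norm (I n x) \<le> norm (real (Suc n) powr a * (real (Suc n))\<^sup>2 * (w x * w x))"
    proof (rule AE_I2)
      fix x
      show "norm (I n x) \<le> norm (real (Suc n) powr a * (real (Suc n))\<^sup>2 * (w x * w x))"
      proof (cases "x \<in> band w n")
        case True
        then have b: "1 \<le> real (Suc n) * \<bar>w x\<bar>" "\<bar>w x\<bar> \<le> real (Suc n)"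
          by (auto simp: band_def field_simps)
        have "1 * 1 \<le> (real (Suc n) * \<bar>w x\<bar>) * (real (Suc n) * \<bar>w x\<bar>)"
          using b by (intro mult_mono) auto
        then have "1 \<le> (real (Suc n))\<^sup>2 * (w x * w x)"
          by (simp add: power2_eq_square mult_ac flip: abs_mult)
        moreover have "\<bar>w x\<bar> powr a \<le> real (Suc n) powr a"
          using b a by (intro powr_mono2) auto
        ultimately have "\<bar>w x\<bar> powr a * 1 \<le> real (Suc n) powr a * ((real (Suc n))\<^sup>2 * (w x * w x))"
          by (intro mult_mono) auto
        then show ?thesis using True by (simp add: I_def mult.assoc abs_mult)
      qed (simp add: I_def)
    qed
  qed simp
  have bound: "(\<integral>x. I n x \<partial>M) \<le> N powr a" for n
  proof -
    define J where "J = (\<integral>x. I n x \<partial>M)"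
    have J0: "0 \<le> J" unfolding J_def by (simp add: I0)
    define v where "v = (\<lambda>x. sgn (w x) * \<bar>w x\<bar> powr (a - 1) * indicator (band w n) x)"
    have v: "v \<in> Lp 2 M"
    proof (rule L2_dominated)
      show "(\<lambda>x. real (Suc n) powr (a - 1) * real (Suc n) * w x) \<in> Lp 2 M" using w by (rule L2_cmult)
      show "v \<in> borel_measurable M" unfolding v_def by measurable
      show "AE x in M. \<bar>v x\<bar> \<le> \<bar>real (Suc n) powr (a - 1) * real (Suc n) * w x\<bar>"
      proof (rule AE_I2)
        fix x
        show "\<bar>v x\<bar> \<le> \<bar>real (Suc n) powr (a - 1) * real (Suc n) * w x\<bar>"
        proof (cases "x \<in> band w n")
          case True
          then have b: "1 \<le> real (Suc n) * \<bar>w x\<bar>" "\<bar>w x\<bar> \<le> real (Suc n)"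
            by (auto simp: band_def field_simps)
          have "\<bar>v x\<bar> \<le> \<bar>w x\<bar> powr (a - 1) * 1"
            using True by (auto simp: v_def abs_mult sgn_if)
          also have "\<dots> \<le> real (Suc n) powr (a - 1) * (real (Suc n) * \<bar>w x\<bar>)"
            using b a by (intro mult_mono powr_mono2) auto
          finally show ?thesis by (simp add: abs_mult mult.assoc)
        qed (simp add: v_def)
      qed
    qed
    have "J = pairing M w v"
      unfolding J_def pairing_def
    proof (rule Bochner_Integration.integral_cong)
      fix x
      have "w x * (sgn (w x) * \<bar>w x\<bar> powr (a - 1)) = \<bar>w x\<bar> powr a" if "w x \<noteq> 0"
        using that powr_add[of "\<bar>w x\<bar>" 1 "a - 1"] by (simp add: sgn_if abs_if)
      then show "I n x = w x * v x"
        by (cases "w x = 0") (auto simp: I_def v_def simp flip: mult.assoc)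
    qed simp
    also have "\<dots> \<le> N * J powr (1 - 1/a)"
      unfolding J_def I_def using Ii[of n] unfolding I_def by (intro le v_def v)
    finally have le: "J \<le> N * J powr (1 - 1/a)" .
    have "J \<le> N powr a"
    proof (cases "J = 0")
      case False
      then have J: "0 < J" using J0 by simp
      have "J powr (1 / a) * J powr (1 - 1/a) = J"
        using J by (simp flip: powr_add)
      then have "J powr (1 / a) * J powr (1 - 1/a) \<le> N * J powr (1 - 1/a)" using le by simp
      then have "J powr (1 / a) \<le> N" using J by simp
      then have "(J powr (1 / a)) powr a \<le> N powr a" using a by (intro powr_mono2) auto
      then show ?thesis using J a by (simp add: powr_powr)
    qed simp
    then show ?thesis by (simp add: J_def)
  qed
  have lim: "(\<lambda>n. I n x) \<longlonglongrightarrow> \<bar>w x\<bar> powr a" for x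
  proof (cases "w x = 0")
    case False
    have "\<forall>\<^sub>F n in sequentially. I n x = \<bar>w x\<bar> powr a"
      using band_indicator_eventually[of w x, OF False] by eventually_elim (simp add: I_def)
    then show ?thesis by (rule tendsto_eventually)
  qed (simp add: I_def)
  note F = integral_Fatou_bound[of M I "N powr a", OF Ii I0 bound lim]
  show "w \<in> Lp (ennreal a) M" using F(1) a by (simp add: Lp_real_iff)
  have "(\<integral>x. \<bar>w x\<bar> powr a \<partial>M) powr (1 / a) \<le> (N powr a) powr (1 / a)"
    using F(2) a by (intro powr_mono2) auto
  also have "\<dots> = N" using a N by (simp add: powr_powr)
  finally show "Lp_norm (ennreal a) M w \<le> N" using a by (simp add: Lp_real_norm)
qed

text \<open>Where |w| is at least N + 1/(k+1), test with the sign of w. By Chebyshev that set has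
  finite measure, so v is in both L_1 and L_2, and the two bounds for <w,v> force the measure to be
  0.\<close>

lemma converse_Holder_inf:
  assumes w: "w \<in> Lp 2 M" and N: "0 \<le> N"
    and le: "\<And>v. v \<in> Lp 2 M \<Longrightarrow> v \<in> Lp 1 M \<Longrightarrow> \<bar>pairing M w v\<bar> \<le> N * Lp_norm 1 M v"
  shows "w \<in> Lp \<infinity> M" "Lp_norm \<infinity> M w \<le> N"
proof -
  have wm [measurable]: "w \<in> borel_measurable M" using w Lp_measurable by blast
  have w2: "integrable M (\<lambda>x. w x * w x)" using w by (simp add: L2_iff)
  have "AE x in M. \<not> (N + 1 / real (Suc k) \<le> \<bar>w x\<bar>)" for k
  proof -
    define B where "B = {x. N + 1 / real (Suc k) \<le> \<bar>w x\<bar>}"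
    have Bm [measurable]: "Measurable.pred M (\<lambda>x. x \<in> B)"
      unfolding B_def by simp
    have b: "1 \<le> real (Suc k) * \<bar>w x\<bar>" if "x \<in> B" for x
    proof -
      have "1 / real (Suc k) \<le> \<bar>w x\<bar>" using that N by (simp add: B_def)
      then show ?thesis by (simp add: field_simps)
    qed
    define v where "v x = sgn (w x) * indicator B x" for x
    have vm [measurable]: "v \<in> borel_measurable M" unfolding v_def by measurable
    have v: "v \<in> Lp 2 M"
    proof (rule L2_dominated[of "\<lambda>x. real (Suc k) * w x"])
      show "AE x in M. \<bar>v x\<bar> \<le> \<bar>real (Suc k) * w x\<bar>"
      proof (rule AE_I2)
        fix x
        show "\<bar>v x\<bar> \<le> \<bar>real (Suc k) * w x\<bar>"
          using b[of x] by (cases "x \<in> B") (auto simp: v_def abs_mult sgn_if)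
      qed
    qed (use w in \<open>auto intro: L2_cmult\<close>)
    have av: "\<bar>v x\<bar> = indicator B x" for x
      using b[of x] by (cases "x \<in> B") (auto simp: v_def abs_mult sgn_if)
    have iB: "integrable M (\<lambda>x. indicator B x :: real)"
    proof (rule Bochner_Integration.integrable_bound)
      show "integrable M (\<lambda>x. v x * v x)" using v by (simp add: L2_iff)
      have "v x * v x = indicator B x" for x
        using av[of x] by (metis abs_mult_self_eq indicator_simps mult_1 mult_zero_left)
      then show "AE x in M. norm (indicator B x :: real) \<le> norm (v x * v x)" by simp
    qed simp
    have v1: "v \<in> Lp 1 M"
      unfolding L1_iff by (rule Bochner_Integration.integrable_bound[OF iB]) (auto simp: av)
    have "(\<integral>x. (N + 1 / real (Suc k)) * indicator B x \<partial>M) \<le> pairing M w v"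
      unfolding pairing_def
    proof (rule integral_mono)
      show "integrable M (\<lambda>x. w x * v x)" using w v by (rule L2_mult_integrable)
      show "(N + 1 / real (Suc k)) * indicator B x \<le> w x * v x" for x
        by (cases "x \<in> B") (auto simp: v_def B_def sgn_if)
    qed (use iB in simp)
    also have "\<dots> \<le> N * Lp_norm 1 M v" using le[OF v v1] by simp
    also have "\<dots> = N * (\<integral>x. indicator B x \<partial>M)" unfolding L1_norm av ..
    finally have "(N + 1 / real (Suc k)) * (\<integral>x. indicator B x \<partial>M) \<le> N * (\<integral>x. indicator B x \<partial>M)"
      unfolding integral_mult_right_zero .
    then have "1 / real (Suc k) * (\<integral>x. indicator B x \<partial>M) \<le> 0"
      by (simp only: distrib_right)
    then have "(\<integral>x. indicator B x \<partial>M) \<le> (0::real)"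
      by (simp only: mult_le_0_iff) auto
    then have "(\<integral>x. indicator B x \<partial>M) = (0::real)" by (intro antisym integral_nonneg) auto
    then have "AE x in M. indicator B x = (0::real)"
      using iB by (subst (asm) integral_nonneg_eq_0_iff_AE) auto
    then show ?thesis by eventually_elim (simp add: B_def indicator_def split: if_splits)
  qed
  then have "AE x in M. \<forall>k. \<not> (N + 1 / real (Suc k) \<le> \<bar>w x\<bar>)"
    by (simp add: AE_all_countable)
  then have "AE x in M. \<bar>w x\<bar> \<le> N"
  proof eventually_elim
    case (elim x)
    show ?case
    proof (rule ccontr)
      assume "\<not> \<bar>w x\<bar> \<le> N"
      then obtain k where "1 / real (Suc k) < \<bar>w x\<bar> - N"
        using reals_Archimedean[of "\<bar>w x\<bar> - N"] by (auto simp: inverse_eq_divide)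
      then show False using elim by (metis add.commute less_diff_eq less_imp_le)
    qed
  qed
  then show "w \<in> Lp \<infinity> M" "Lp_norm \<infinity> M w \<le> N" using LinfI[OF wm _ N] by auto
qed

lemma converse_Holder:
  fixes r r' :: ennreal
  assumes r: "1 \<le> r" "1 / r + 1 / r' = 1" and w: "w \<in> Lp 2 M" and N: "0 \<le> N"
    and le: "\<And>v. v \<in> Lp 2 M \<Longrightarrow> v \<in> Lp r' M \<Longrightarrow> \<bar>pairing M w v\<bar> \<le> N * Lp_norm r' M v"
  shows "w \<in> Lp r M \<and> Lp_norm r M w \<le> N"
  using r
proof (cases rule: conjugate_exponents_cases)
  case 1
  have "w \<in> Lp (ennreal 1) M \<and> Lp_norm (ennreal 1) M w \<le> N"
  proof (intro converse_Holder_real[OF order.refl w N])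
    fix n v assume v: "v = (\<lambda>x. sgn (w x) * \<bar>w x\<bar> powr (1 - 1) * indicator (band w n) x)" "v \<in> Lp 2 M"
      and int: "integrable M (\<lambda>x. \<bar>w x\<bar> powr 1 * indicator (band w n) x)"
    have "v \<in> Lp \<infinity> M \<and> Lp_norm \<infinity> M v \<le> 1"
      by (intro conjI LinfI[where c = 1] Lp_measurable[OF v(2)])
        (auto simp: v(1) abs_mult sgn_if indicator_def)
    then have "pairing M w v \<le> N * 1"
      using le[OF v(2)] 1 N by (metis abs_le_D1 mult_left_mono order_trans)
    moreover have "AE x in M. \<bar>w x\<bar> powr 1 * indicator (band w n) x = 0"
      if "(\<integral>x. \<bar>w x\<bar> powr 1 * indicator (band w n) x \<partial>M) = 0"
      using that int by (subst (asm) integral_nonneg_eq_0_iff_AE) auto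
    moreover have "pairing M w v = (\<integral>x. \<bar>w x\<bar> powr 1 * indicator (band w n) x \<partial>M)"
      unfolding pairing_def v(1)
      by (intro Bochner_Integration.integral_cong) (auto simp: sgn_if)
    \<comment> \<open>The exponent is 0, and \<open>0 powr 0\<close> is 0 rather than 1. So a
      vanishing integral is a case of its own, settled by <w,v> being that very integral.\<close>
    ultimately show "pairing M w v \<le> N * (\<integral>x. \<bar>w x\<bar> powr 1 * indicator (band w n) x \<partial>M) powr (1 - 1 / 1)"
      using N by (auto simp: powr_def)
  qed
  then show ?thesis using 1 by simp
next
  case 2
  then show ?thesis using converse_Holder_inf[OF w N] le by simp
next
  case (3 a b)
  have "w \<in> Lp (ennreal a) M \<and> Lp_norm (ennreal a) M w \<le> N"
  proof (intro converse_Holder_real[OF less_imp_le[OF 3(3)] w N])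
    fix n v assume v: "v = (\<lambda>x. sgn (w x) * \<bar>w x\<bar> powr (a - 1) * indicator (band w n) x)" "v \<in> Lp 2 M"
      and int: "integrable M (\<lambda>x. \<bar>w x\<bar> powr a * indicator (band w n) x)"
    have ab: "(a - 1) * b = a" "1 - 1 / a = 1 / b"
      using 3 by (auto simp: field_simps)
    have eq: "\<bar>v x\<bar> powr b = \<bar>w x\<bar> powr a * indicator (band w n) x" for x
      using 3(3,4) by (cases "x \<in> band w n") (auto simp: v(1) abs_mult sgn_if powr_powr ab(1))
    have "v \<in> Lp r' M" "Lp_norm r' M v = (\<integral>x. \<bar>w x\<bar> powr a * indicator (band w n) x \<partial>M) powr (1 - 1/a)"
      using 3 int Lp_measurable[OF v(2)] by (auto simp: Lp_real_iff Lp_real_norm eq ab(2))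
    then show "pairing M w v \<le> N * (\<integral>x. \<bar>w x\<bar> powr a * indicator (band w n) x \<partial>M) powr (1 - 1/a)"
      using le[OF v(2)] by auto
  qed
  then show ?thesis using 3 by simp
qed

text \<open>On a band of h, |h|^2 is bounded and 1 is at most a multiple of |h|^a, so the truncation
  lies in L_2; it converges to h by dominated convergence. In L_\<infinity> there is no such
  approximation, already for constants on a space of infinite measure.\<close>

lemma L2_dense_Lp:
  fixes r :: ennreal
  assumes r: "1 \<le> r" "r < \<infinity>" and h: "h \<in> Lp r M" and \<epsilon>: "0 < \<epsilon>"
  obtains k where "k \<in> Lp 2 M" "k \<in> Lp r M" "(\<lambda>x. h x - k x) \<in> Lp r M"
    "Lp_norm r M (\<lambda>x. h x - k x) < \<epsilon>"
proof -
  define a where "a = enn2real r"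
  have ra: "r = ennreal a" using r by (simp add: a_def)
  then have a: "1 \<le> a" using r by (metis a_def ennreal_1 ennreal_le_iff enn2real_nonneg)
  have hm [measurable]: "h \<in> borel_measurable M" using h Lp_measurable by blast
  have hi: "integrable M (\<lambda>x. \<bar>h x\<bar> powr a)" using h a by (simp add: ra Lp_real_iff)
  define k where "k n x = h x * indicator (band h n) x" for n x
  have km [measurable]: "k n \<in> borel_measurable M" for n unfolding k_def by measurable
  have kr: "k n \<in> Lp r M" for n
    unfolding ra using a by (subst Lp_real_iff)
      (auto intro!: Bochner_Integration.integrable_bound[OF hi] simp: k_def indicator_def)
  have dr: "(\<lambda>x. h x - k n x) \<in> Lp r M" for n
    unfolding ra using a by (subst Lp_real_iff)
      (auto intro!: Bochner_Integration.integrable_bound[OF hi] simp: k_def indicator_def)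
  have k2: "k n \<in> Lp 2 M" for n
    unfolding L2_iff
  proof
    show "integrable M (\<lambda>x. k n x * k n x)"
    proof (rule Bochner_Integration.integrable_bound)
      show "integrable M (\<lambda>x. (real (Suc n))\<^sup>2 * real (Suc n) powr a * \<bar>h x\<bar> powr a)"
        using hi by simp
      show "AE x in M. norm (k n x * k n x) \<le> norm ((real (Suc n))\<^sup>2 * real (Suc n) powr a * \<bar>h x\<bar> powr a)"
      proof (rule AE_I2)
        fix x
        show "norm (k n x * k n x) \<le> norm ((real (Suc n))\<^sup>2 * real (Suc n) powr a * \<bar>h x\<bar> powr a)"
        proof (cases "x \<in> band h n")
          case True
          then have b: "1 \<le> real (Suc n) * \<bar>h x\<bar>" "\<bar>h x\<bar> \<le> real (Suc n)"
            by (auto simp: band_def field_simps)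
          have "\<bar>h x\<bar> * \<bar>h x\<bar> \<le> (real (Suc n))\<^sup>2"
            unfolding power2_eq_square using b by (intro mult_mono) auto
          moreover have "1 powr a \<le> (real (Suc n) * \<bar>h x\<bar>) powr a"
            using b a by (intro powr_mono2) auto
          ultimately have "(\<bar>h x\<bar> * \<bar>h x\<bar>) * 1 \<le> (real (Suc n))\<^sup>2 * (real (Suc n) powr a * \<bar>h x\<bar> powr a)"
            by (intro mult_mono) (auto simp: powr_mult)
          then show ?thesis using True by (simp add: k_def abs_mult mult.assoc)
        qed (simp add: k_def)
      qed
    qed simp
  qed simp
  have "(\<lambda>n. \<integral>x. \<bar>h x - k n x\<bar> powr a \<partial>M) \<longlonglongrightarrow> (\<integral>x. 0 \<partial>M)"
  proof (rule integral_dominated_convergence[where w = "\<lambda>x. \<bar>h x\<bar> powr a"])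
    show "AE x in M. (\<lambda>n. \<bar>h x - k n x\<bar> powr a) \<longlonglongrightarrow> 0"
    proof (rule AE_I2)
      fix x
      show "(\<lambda>n. \<bar>h x - k n x\<bar> powr a) \<longlonglongrightarrow> 0"
      proof (cases "h x = 0")
        case False
        have "\<forall>\<^sub>F n in sequentially. \<bar>h x - k n x\<bar> powr a = 0"
          using band_indicator_eventually[of h x, OF False] by eventually_elim (use a in \<open>simp add: k_def\<close>)
        then show ?thesis by (rule tendsto_eventually)
      qed (use a in \<open>simp add: k_def\<close>)
    qed
    show "AE x in M. norm (\<bar>h x - k n x\<bar> powr a) \<le> \<bar>h x\<bar> powr a" for n
      by (auto simp: k_def indicator_def)
  qed (use hi in auto)
  then have "\<forall>\<^sub>F n in sequentially. (\<integral>x. \<bar>h x - k n x\<bar> powr a \<partial>M) < \<epsilon> powr a"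
    using \<epsilon> by (intro order_tendstoD(2)) auto
  then obtain n where n: "(\<integral>x. \<bar>h x - k n x\<bar> powr a \<partial>M) < \<epsilon> powr a"
    by (auto simp: eventually_sequentially)
  have "(\<integral>x. \<bar>h x - k n x\<bar> powr a \<partial>M) powr (1/a) < (\<epsilon> powr a) powr (1/a)"
    using n a by (intro powr_less_mono2) auto
  then have "Lp_norm r M (\<lambda>x. h x - k n x) < \<epsilon>"
    using a \<epsilon> by (simp add: ra Lp_real_norm powr_powr)
  then show thesis using that[OF k2 kr dr] by blast
qed

section \<open>Laplace transforms\<close>

definition laplace :: "real \<Rightarrow> (real \<Rightarrow> real) \<Rightarrow> real" where
  "laplace l \<phi> = (\<integral>t. indicator {0..} t * (exp (- (l * t)) * \<phi> t) \<partial>lborel)"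

text \<open>What e^(-lh) P(h) takes away from a resolvent. Divided by h it is the average that
  recovers the starting point of the orbit as h tends to 0.\<close>

definition laplace_part :: "real \<Rightarrow> real \<Rightarrow> (real \<Rightarrow> real) \<Rightarrow> real" where
  "laplace_part l h \<phi> = (\<integral>t. indicator {0..<h} t * (exp (- (l * t)) * \<phi> t) \<partial>lborel)"

lemma has_bochner_integral_exp:
  fixes c :: real
  assumes "0 < c"
  shows "has_bochner_integral lborel (\<lambda>t. indicator {0..} t * exp (- (c * t))) (1 / c)"
proof -
  have *: "has_bochner_integral lborel (\<lambda>x. exp (- x) * indicator {0::real..} x) 1"
    using has_bochner_integral_I0i_power_exp_m'[of 0] by (simp add: mult.commute)
  have "has_bochner_integral lborel (\<lambda>x. exp (- (0 + c * x)) * indicator {0::real..} (0 + c * x)) (1 /\<^sub>R \<bar>c\<bar>)"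
    using assms by (intro lborel_has_bochner_integral_real_affine_iff[THEN iffD1] *) auto
  moreover have "exp (- (0 + c * x)) * indicator {0::real..} (0 + c * x) = indicator {0..} x * exp (- (c * x))" for x
    using assms by (auto simp: indicator_def zero_le_mult_iff)
  ultimately show ?thesis using assms by (simp only: inverse_eq_divide real_scaleR_def mult_1_right abs_of_pos)
qed

lemma continuous_on_indicator_measurable:
  fixes \<phi> :: "real \<Rightarrow> real"
  assumes "continuous_on A \<phi>" "A \<in> sets borel"
  shows "(\<lambda>t. indicator A t * \<phi> t) \<in> borel_measurable lborel"
  using borel_measurable_continuous_on_indicator[OF assms(2,1)] by simp

lemma laplace_measurable:
  fixes \<phi> :: "real \<Rightarrow> real"
  assumes "continuous_on {0..} \<phi>"
  shows "(\<lambda>t. indicator {0..} t * (exp (- (l * t)) * \<phi> t)) \<in> borel_measurable lborel"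
  using assms by (intro continuous_on_indicator_measurable continuous_intros) auto

lemma laplace_integrable:
  fixes \<phi> :: "real \<Rightarrow> real" and B w l :: real
  assumes c: "continuous_on {0..} \<phi>" and b: "\<And>t. 0 \<le> t \<Longrightarrow> \<bar>\<phi> t\<bar> \<le> B * exp (w * t)" and l: "w < l"
  shows "integrable lborel (\<lambda>t. indicator {0..} t * (exp (- (l * t)) * \<phi> t))"
proof (rule Bochner_Integration.integrable_bound)
  show "integrable lborel (\<lambda>t. B * (indicator {0..} t * exp (- ((l - w) * t))))"
    using has_bochner_integral_exp[of "l - w"] l by (intro integrable_mult_right) (auto simp: has_bochner_integral_iff)
  show "AE t in lborel. norm (indicator {0..} t * (exp (- (l * t)) * \<phi> t))
      \<le> norm (B * (indicator {0..} t * exp (- ((l - w) * t))))"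
  proof (rule AE_I2)
    fix t :: real
    show "norm (indicator {0..} t * (exp (- (l * t)) * \<phi> t)) \<le> norm (B * (indicator {0..} t * exp (- ((l - w) * t))))"
    proof (cases "0 \<le> t")
      case True
      have "exp (- (l * t)) * \<bar>\<phi> t\<bar> \<le> exp (- (l * t)) * (B * exp (w * t))"
        using b[OF True] by (intro mult_left_mono) auto
      then have "exp (- (l * t)) * \<bar>\<phi> t\<bar> \<le> B * exp (- ((l - w) * t))"
        by (simp add: algebra_simps flip: exp_add)
      moreover have "0 \<le> B" using b[of 0] by simp
      ultimately show ?thesis using True by (simp add: abs_mult)
    qed simp
  qed
qed (rule laplace_measurable[OF c])

lemma laplace_bound:
  fixes \<phi> :: "real \<Rightarrow> real" and B w l :: real
  assumes c: "continuous_on {0..} \<phi>" and b: "\<And>t. 0 \<le> t \<Longrightarrow> \<bar>\<phi> t\<bar> \<le> B * exp (w * t)" and l: "w < l"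
  shows "\<bar>laplace l \<phi>\<bar> \<le> B / (l - w)"
proof -
  have "\<bar>laplace l \<phi>\<bar> \<le> (\<integral>t. \<bar>indicator {0..} t * (exp (- (l * t)) * \<phi> t)\<bar> \<partial>lborel)"
    unfolding laplace_def by (rule integral_abs_bound)
  also have "\<dots> \<le> (\<integral>t. B * (indicator {0..} t * exp (- ((l - w) * t))) \<partial>lborel)"
  proof (rule integral_mono)
    show "integrable lborel (\<lambda>t. \<bar>indicator {0..} t * (exp (- (l * t)) * \<phi> t)\<bar>)"
      using laplace_integrable[OF assms] by simp
    show "integrable lborel (\<lambda>t. B * (indicator {0..} t * exp (- ((l - w) * t))))"
      using has_bochner_integral_exp[of "l - w"] l by (intro integrable_mult_right) (auto simp: has_bochner_integral_iff)
    fix t :: real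
    show "\<bar>indicator {0..} t * (exp (- (l * t)) * \<phi> t)\<bar> \<le> B * (indicator {0..} t * exp (- ((l - w) * t)))"
    proof (cases "0 \<le> t")
      case True
      have "exp (- (l * t)) * \<bar>\<phi> t\<bar> \<le> exp (- (l * t)) * (B * exp (w * t))"
        using b[OF True] by (intro mult_left_mono) auto
      also have "\<dots> = B * exp (- ((l - w) * t))"
        by (simp add: algebra_simps flip: exp_add)
      finally show ?thesis using True by (simp add: abs_mult)
    qed simp
  qed
  also have "\<dots> = B * (1 / (l - w))"
    using has_bochner_integral_exp[of "l - w"] l by (simp add: has_bochner_integral_iff)
  finally show ?thesis by simp
qed

lemma laplace_cong: "(\<And>t. 0 \<le> t \<Longrightarrow> \<phi> t = \<psi> t) \<Longrightarrow> laplace l \<phi> = laplace l \<psi>"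
  unfolding laplace_def by (intro Bochner_Integration.integral_cong) (auto simp: indicator_def)

lemma laplace_cmult: "laplace l (\<lambda>t. c * \<phi> t) = c * laplace l \<phi>"
proof -
  have "indicator {0..} t * (exp (- (l * t)) * (c * \<phi> t)) = c * (indicator {0..} t * (exp (- (l * t)) * \<phi> t))" for t
    by simp
  then show ?thesis unfolding laplace_def by (simp only: integral_mult_right_zero)
qed

lemma laplace_add:
  assumes "continuous_on {0..} \<phi>" "\<And>t. 0 \<le> t \<Longrightarrow> \<bar>\<phi> t\<bar> \<le> B * exp (w * t)"
    "continuous_on {0..} \<psi>" "\<And>t. 0 \<le> t \<Longrightarrow> \<bar>\<psi> t\<bar> \<le> B' * exp (w * t)" "w < l"
  shows "laplace l (\<lambda>t. \<phi> t + \<psi> t) = laplace l \<phi> + laplace l \<psi>"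
  unfolding laplace_def distrib_left
  by (rule Bochner_Integration.integral_add[OF laplace_integrable[OF assms(1,2,5)]
        laplace_integrable[OF assms(3,4,5)]])

lemma laplace_nonneg: "(\<And>t. 0 \<le> t \<Longrightarrow> 0 \<le> \<phi> t) \<Longrightarrow> 0 \<le> laplace l \<phi>"
  unfolding laplace_def by (intro Bochner_Integration.integral_nonneg) (auto simp: indicator_def)

lemma laplace_abs_le:
  fixes \<phi> \<psi> :: "real \<Rightarrow> real" and B w l :: real
  assumes "continuous_on {0..} \<phi>" "continuous_on {0..} \<psi>"
    and le: "\<And>t. 0 \<le> t \<Longrightarrow> \<bar>\<phi> t\<bar> \<le> \<psi> t" and b: "\<And>t. 0 \<le> t \<Longrightarrow> \<bar>\<psi> t\<bar> \<le> B * exp (w * t)" and l: "w < l"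
  shows "\<bar>laplace l \<phi>\<bar> \<le> laplace l \<psi>"
proof -
  have b': "\<bar>\<phi> t\<bar> \<le> B * exp (w * t)" if "0 \<le> t" for t
    using le[OF that] b[OF that] by linarith
  have "\<bar>laplace l \<phi>\<bar> \<le> (\<integral>t. \<bar>indicator {0..} t * (exp (- (l * t)) * \<phi> t)\<bar> \<partial>lborel)"
    unfolding laplace_def by (rule integral_abs_bound)
  also have "\<dots> \<le> laplace l \<psi>"
    unfolding laplace_def
  proof (rule integral_mono)
    show "integrable lborel (\<lambda>t. \<bar>indicator {0..} t * (exp (- (l * t)) * \<phi> t)\<bar>)"
      using laplace_integrable[OF assms(1) b' l] by simp
    show "integrable lborel (\<lambda>t. indicator {0..} t * (exp (- (l * t)) * \<psi> t))"
      by (rule laplace_integrable[OF assms(2) b l])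
    show "\<bar>indicator {0..} t * (exp (- (l * t)) * \<phi> t)\<bar> \<le> indicator {0..} t * (exp (- (l * t)) * \<psi> t)" for t
      using le[of t] by (cases "0 \<le> t") (auto simp: abs_mult)
  qed
  finally show ?thesis .
qed

lemma laplace_part_nonneg: "(\<And>t. 0 \<le> t \<Longrightarrow> 0 \<le> \<phi> t) \<Longrightarrow> 0 \<le> laplace_part l h \<phi>"
  unfolding laplace_part_def by (intro Bochner_Integration.integral_nonneg) (auto simp: indicator_def)

lemma laplace_shift:
  assumes c: "continuous_on {0..} \<phi>" and b: "\<And>t. 0 \<le> t \<Longrightarrow> \<bar>\<phi> t\<bar> \<le> B * exp (w * t)" and l: "w < l"
    and h: "0 \<le> h"
  shows "exp (- (l * h)) * laplace l (\<lambda>t. \<phi> (t + h)) = laplace l \<phi> - laplace_part l h \<phi>"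
proof -
  let ?f = "\<lambda>t. exp (- (l * t)) * \<phi> t"
  have int: "integrable lborel (\<lambda>t. indicator {0..} t * ?f t)" by (rule laplace_integrable[OF c b l])
  have i1: "integrable lborel (\<lambda>t. indicator {0..<h} t * ?f t)"
  proof -
    have "integrable lborel (\<lambda>t. indicator {0..<h} t * (indicator {0..} t * ?f t))"
      using integrable_real_mult_indicator[OF _ int, of "{0..<h}"] by (simp add: mult.commute)
    moreover have "indicator {0..<h} t * (indicator {0..} t * ?f t) = indicator {0..<h} t * ?f t" for t
      by (auto simp: indicator_def)
    ultimately show ?thesis by simp
  qed
  have "laplace l \<phi> - laplace_part l h \<phi> = (\<integral>t. indicator {0..} t * ?f t - indicator {0..<h} t * ?f t \<partial>lborel)"
    unfolding laplace_def laplace_part_def by (rule Bochner_Integration.integral_diff[symmetric, OF int i1])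
  \<comment> \<open>The half-open segment \<open>{0..<h}\<close> is the exact complement of
    \<open>{h..}\<close> in \<open>{0..}\<close>, so the integrands agree pointwise and not only
    almost everywhere.\<close>
  also have "\<dots> = (\<integral>t. indicator {h..} t * ?f t \<partial>lborel)"
    using h by (intro Bochner_Integration.integral_cong) (auto simp: indicator_def)
  also have "\<dots> = (\<integral>t. indicator {h..} (h + t) * ?f (h + t) \<partial>lborel)"
    using lborel_integral_real_affine[of 1 "\<lambda>t. indicator {h..} t * ?f t" h] by simp
  also have "\<dots> = (\<integral>t. exp (- (l * h)) * (indicator {0..} t * (exp (- (l * t)) * \<phi> (t + h))) \<partial>lborel)"
  proof (rule Bochner_Integration.integral_cong[OF refl])
    fix t
    have "exp (- (l * (h + t))) = exp (- (l * h)) * exp (- (l * t))"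
      by (simp add: algebra_simps flip: exp_add)
    then show "indicator {h..} (h + t) * ?f (h + t) = exp (- (l * h)) * (indicator {0..} t * (exp (- (l * t)) * \<phi> (t + h)))"
      by (simp add: indicator_def add.commute)
  qed
  also have "\<dots> = exp (- (l * h)) * laplace l (\<lambda>t. \<phi> (t + h))"
    unfolding laplace_def by (rule integral_mult_right_zero)
  finally show ?thesis ..
qed

text \<open>Stated with an explicit error instead of a limit, because for averages of orbits the
  error is a multiple of the norm of the test vector; uniformity in that vector is what yields
  convergence in norm.\<close>

lemma laplace_part_average:
  assumes c: "continuous_on {0..} \<phi>" and h: "0 < h"
    and e: "\<And>t. 0 \<le> t \<Longrightarrow> t < h \<Longrightarrow> \<bar>exp (- (l * t)) * \<phi> t - a\<bar> \<le> \<epsilon>"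
  shows "\<bar>laplace_part l h \<phi> / h - a\<bar> \<le> \<epsilon>"
proof -
  let ?g = "\<lambda>t. exp (- (l * t)) * \<phi> t"
  have ind: "integrable lborel (\<lambda>t. indicator {0..<h} t * k)" "(\<integral>t. indicator {0..<h} t * k \<partial>lborel) = h * k" for k :: real
    using h by auto
  have meas: "(\<lambda>t. indicator {0..<h} t * ?g t) \<in> borel_measurable lborel"
    by (intro continuous_on_indicator_measurable continuous_intros continuous_on_subset[OF c]) auto
  have b: "(a - \<epsilon>) * indicator {0..<h} t \<le> indicator {0..<h} t * ?g t"
    "indicator {0..<h} t * ?g t \<le> (a + \<epsilon>) * indicator {0..<h} t" for t
    using e[of t] by (auto simp: indicator_def abs_le_iff)
  have int: "integrable lborel (\<lambda>t. indicator {0..<h} t * ?g t)"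
  proof (rule Bochner_Integration.integrable_bound[OF ind(1)[of "\<bar>a\<bar> + \<epsilon>"] meas])
    show "AE t in lborel. norm (indicator {0..<h} t * ?g t) \<le> norm (indicator {0..<h} t * (\<bar>a\<bar> + \<epsilon>))"
    proof (rule AE_I2)
      fix t
      show "norm (indicator {0..<h} t * ?g t) \<le> norm (indicator {0..<h} t * (\<bar>a\<bar> + \<epsilon>))"
      proof (cases "t \<in> {0..<h}")
        case True
        then show ?thesis using e[of t] by (simp only: indicator_simps mult_1 real_norm_def) auto
      qed simp
    qed
  qed
  have "h * (a - \<epsilon>) \<le> laplace_part l h \<phi>"
    unfolding laplace_part_def ind(2)[symmetric] using int ind(1) b(1)
    by (intro integral_mono) (auto simp: mult.commute)
  moreover have "laplace_part l h \<phi> \<le> h * (a + \<epsilon>)"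
    unfolding laplace_part_def ind(2)[symmetric] using int ind(1) b(2)
    by (intro integral_mono) (auto simp: mult.commute)
  ultimately show ?thesis using h by (auto simp: abs_le_iff field_simps)
qed

text \<open>The substitution s = lt turns l times the transform into the integral of e^(-s)
  \<phi>(s/l), whose integrand tends to e^(-s) \<phi>(0).\<close>

lemma laplace_Abelian:
  assumes c: "continuous_on {0..} \<phi>" and b: "\<And>t. 0 \<le> t \<Longrightarrow> \<bar>\<phi> t\<bar> \<le> B * exp (w * t)"
  shows "((\<lambda>l. l * laplace l \<phi>) \<longlongrightarrow> \<phi> 0) at_top"
proof -
  \<comment> \<open>\<open>max l 1\<close> keeps the argument of \<phi> in [0,\<infinity>) for every
    real l, so that measurability, required for all l, holds; it changes nothing for l \<ge>
    1.\<close>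
  let ?s = "\<lambda>l s. indicator {0..} s * (exp (- s) * \<phi> (s / max l 1))"
  have B: "0 \<le> B" using b[of 0] by simp
  have scale: "l * laplace l \<phi> = (\<integral>s. ?s l s \<partial>lborel)" if "1 \<le> l" for l
  proof -
    have "(\<integral>s. ?s l s \<partial>lborel) = l * (\<integral>t. ?s l (0 + l * t) \<partial>lborel)"
      using lborel_integral_real_affine[of l "?s l" 0] that by simp
    also have "(\<integral>t. ?s l (0 + l * t) \<partial>lborel) = laplace l \<phi>"
      unfolding laplace_def using that
      by (intro Bochner_Integration.integral_cong) (auto simp: indicator_def zero_le_mult_iff max_def)
    finally show ?thesis ..
  qed
  have lim: "((\<lambda>l. \<integral>s. ?s l s \<partial>lborel) \<longlongrightarrow> (\<integral>s. indicator {0..} s * (exp (- s) * \<phi> 0) \<partial>lborel)) at_top"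
  proof (rule integral_dominated_convergence_at_top)
    \<comment> \<open>The rate 1/2 leaves room for the growth of \<phi>: for l \<ge> 2|w| the factor
      e^(ws/l) is at most e^(s/2).\<close>
    show "integrable lborel (\<lambda>s. B * (indicator {0..} s * exp (- (1/2 * s))))"
      using has_bochner_integral_exp[of "1/2"] by (intro integrable_mult_right) (auto simp: has_bochner_integral_iff)
    show "(\<lambda>s. indicator {0..} s * (exp (- s) * \<phi> 0)) \<in> borel_measurable lborel" by measurable
    show "?s l \<in> borel_measurable lborel" for l
      by (intro continuous_on_indicator_measurable continuous_intros continuous_on_compose2[OF c]) auto
    show "\<forall>\<^sub>F l in at_top. AE s in lborel. norm (?s l s) \<le> B * (indicator {0..} s * exp (- (1/2 * s)))"
    proof (rule eventually_mono[OF eventually_ge_at_top[of "max 1 (2 * \<bar>w\<bar>)"]], rule AE_I2)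
      fix l s :: real
      assume l: "max 1 (2 * \<bar>w\<bar>) \<le> l"
      show "norm (?s l s) \<le> B * (indicator {0..} s * exp (- (1/2 * s)))"
      proof (cases "0 \<le> s")
        case True
        have "w * (s / l) \<le> 1/2 * s"
        proof -
          have "w * s \<le> (1/2 * l) * s" using True l by (intro mult_right_mono) auto
          then show ?thesis using l by (simp add: field_simps)
        qed
        then have "B * exp (w * (s / l)) \<le> B * exp (1/2 * s)" using B by (intro mult_left_mono) auto
        moreover have "\<bar>\<phi> (s / l)\<bar> \<le> B * exp (w * (s / l))" using True l by (intro b) auto
        moreover have "max l 1 = l" using l by auto
        ultimately have "exp (- s) * \<bar>\<phi> (s / max l 1)\<bar> \<le> exp (- s) * (B * exp (1/2 * s))"
          by (intro mult_left_mono) (auto intro: order_trans)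
        also have "\<dots> = B * exp (- (1/2 * s))" by (simp flip: exp_add)
        finally show ?thesis using True by (simp add: abs_mult)
      qed simp
    qed
    show "AE s in lborel. ((\<lambda>l. ?s l s) \<longlongrightarrow> indicator {0..} s * (exp (- s) * \<phi> 0)) at_top"
    proof (rule AE_I2)
      fix s :: real
      show "((\<lambda>l. ?s l s) \<longlongrightarrow> indicator {0..} s * (exp (- s) * \<phi> 0)) at_top"
      proof (cases "0 \<le> s")
        case True
        have "((\<lambda>l. \<phi> (s / max l 1)) \<longlongrightarrow> \<phi> 0) at_top"
        proof (rule continuous_on_tendsto_compose[OF c])
          have "filterlim (\<lambda>l. max l (1::real)) at_top at_top"
            by (rule filterlim_at_top_mono[OF filterlim_ident]) auto
          then show "((\<lambda>l. s / max l 1) \<longlongrightarrow> 0) at_top"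
            by (intro tendsto_divide_0[OF tendsto_const] filterlim_at_top_imp_at_infinity)
          show "\<forall>\<^sub>F l in at_top. s / max l 1 \<in> {0..}" using True by simp
        qed simp
        then show ?thesis by (intro tendsto_intros)
      qed simp
    qed
  qed
  have "(\<integral>s. indicator {0..} s * (exp (- s) * \<phi> 0) \<partial>lborel) = \<phi> 0"
    using has_bochner_integral_mult_left[OF has_bochner_integral_exp[of 1], of "\<phi> 0"]
    by (simp add: has_bochner_integral_iff mult.assoc)
  then have "((\<lambda>l. \<integral>s. ?s l s \<partial>lborel) \<longlongrightarrow> \<phi> 0) at_top" using lim by simp
  then show ?thesis
    by (rule Lim_transform_eventually)
      (use eventually_ge_at_top[of 1] in eventually_elim, simp add: scale)
qed

section \<open>Weakly continuous positive semigroups on L2\<close>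

lemma pairing_cong_left:
  "u \<in> Lp 2 M \<Longrightarrow> u' \<in> Lp 2 M \<Longrightarrow> v \<in> borel_measurable M \<Longrightarrow> AE x in M. u x = u' x \<Longrightarrow>
    pairing M u v = pairing M u' v"
  by (intro pairing_cong_AE) (auto simp: Lp_measurable)

lemma pairing_cong_right:
  "v \<in> Lp 2 M \<Longrightarrow> v' \<in> Lp 2 M \<Longrightarrow> u \<in> borel_measurable M \<Longrightarrow> AE x in M. v x = v' x \<Longrightarrow>
    pairing M u v = pairing M u v'"
  by (intro pairing_cong_AE) (auto simp: Lp_measurable)

text \<open>The formula of \<open>L2_weak_star_generator\<close> with an arbitrary family in place
  of the duals, so that one theory serves \<open>T\<close>, \<open>S\<close> and the adjoints of
  \<open>S\<close>. In L_2 weak and weak* limits are the same.\<close>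

definition weak_generator ::
    "'a measure \<Rightarrow> (real \<Rightarrow> ('a \<Rightarrow> real) \<Rightarrow> ('a \<Rightarrow> real)) \<Rightarrow> (('a \<Rightarrow> real) \<times> ('a \<Rightarrow> real)) set" where
  "weak_generator M P = {(v, z). v \<in> Lp 2 M \<and> z \<in> Lp 2 M \<and>
     (\<forall>u\<in>Lp 2 M. ((\<lambda>t. pairing M u (\<lambda>x. (P t v x - v x) / t)) \<longlongrightarrow> pairing M u z) (at_right 0))}"

lemma L2_weak_star_generator_eq: "L2_weak_star_generator M S = weak_generator M (\<lambda>t. L2_dual M (S t))"
  by (simp add: L2_weak_star_generator_def weak_generator_def)

text \<open>The assumptions come in layers because the exponential bound is derived rather than
  assumed: this layer has algebra and order alone, and positivity helps to produce the bound.
  Identities hold almost everywhere, since operators act on representatives.\<close>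

locale positive_L2_semigroup =
  fixes M :: "'a measure" and P :: "real \<Rightarrow> ('a \<Rightarrow> real) \<Rightarrow> ('a \<Rightarrow> real)"
  assumes P_in: "\<And>t u. 0 \<le> t \<Longrightarrow> u \<in> Lp 2 M \<Longrightarrow> P t u \<in> Lp 2 M"
    and P_cong: "\<And>t u v. 0 \<le> t \<Longrightarrow> u \<in> Lp 2 M \<Longrightarrow> v \<in> Lp 2 M \<Longrightarrow> AE x in M. u x = v x \<Longrightarrow>
      AE x in M. P t u x = P t v x"
    and P_add: "\<And>t u v. 0 \<le> t \<Longrightarrow> u \<in> Lp 2 M \<Longrightarrow> v \<in> Lp 2 M \<Longrightarrow>
      AE x in M. P t (\<lambda>y. u y + v y) x = P t u x + P t v x"
    and P_cmult: "\<And>t u c. 0 \<le> t \<Longrightarrow> u \<in> Lp 2 M \<Longrightarrow> AE x in M. P t (\<lambda>y. c * u y) x = c * P t u x"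
    and P_0: "\<And>u. u \<in> Lp 2 M \<Longrightarrow> AE x in M. P 0 u x = u x"
    and P_plus: "\<And>s t u. 0 \<le> s \<Longrightarrow> 0 \<le> t \<Longrightarrow> u \<in> Lp 2 M \<Longrightarrow> AE x in M. P (s + t) u x = P s (P t u) x"
    and P_pos: "\<And>t u. 0 \<le> t \<Longrightarrow> u \<in> Lp 2 M \<Longrightarrow> nonneg_ae M u \<Longrightarrow> nonneg_ae M (P t u)"
begin

lemma P_meas: "0 \<le> t \<Longrightarrow> u \<in> Lp 2 M \<Longrightarrow> P t u \<in> borel_measurable M"
  using P_in Lp_measurable by blast

lemma P_diff: "0 \<le> t \<Longrightarrow> u \<in> Lp 2 M \<Longrightarrow> v \<in> Lp 2 M \<Longrightarrow>
    AE x in M. P t (\<lambda>y. u y - v y) x = P t u x - P t v x"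
  using P_add[of t u "\<lambda>y. -1 * v y"] P_cmult[of t v "-1"] L2_cmult[of v M "-1"]
  by (auto elim: eventually_elim2)

lemma P_mono:
  assumes "0 \<le> t" "u \<in> Lp 2 M" "v \<in> Lp 2 M" "AE x in M. u x \<le> v x"
  shows "AE x in M. P t u x \<le> P t v x"
proof -
  have "nonneg_ae M (P t (\<lambda>y. v y - u y))"
    using assms by (intro P_pos) (auto simp: nonneg_ae_def)
  then show ?thesis using P_diff[OF assms(1,3,2)] unfolding nonneg_ae_def by eventually_elim simp
qed

end

locale bounded_L2_semigroup = positive_L2_semigroup M P
  for M :: "'a measure" and P :: "real \<Rightarrow> ('a \<Rightarrow> real) \<Rightarrow> ('a \<Rightarrow> real)" +
  fixes K w :: real
  assumes P_bound: "\<And>t u. 0 \<le> t \<Longrightarrow> u \<in> Lp 2 M \<Longrightarrow> Lp_norm 2 M (P t u) \<le> K * exp (w * t) * Lp_norm 2 M u"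
    and K_nonneg: "0 \<le> K"

text \<open>Weak continuity is symmetric in u and v, hence passes to adjoints at once, and so does
  the bound with the same K and w.\<close>

locale L2_semigroup = bounded_L2_semigroup M P K w
  for M :: "'a measure" and P :: "real \<Rightarrow> ('a \<Rightarrow> real) \<Rightarrow> ('a \<Rightarrow> real)" and K w :: real +
  assumes P_cont: "\<And>u v. u \<in> Lp 2 M \<Longrightarrow> v \<in> Lp 2 M \<Longrightarrow> continuous_on {0..} (\<lambda>t. pairing M (P t u) v)"
begin

lemma P_pair_bound:
  assumes "u \<in> Lp 2 M" "v \<in> Lp 2 M" "0 \<le> t"
  shows "\<bar>pairing M (P t u) v\<bar> \<le> (K * Lp_norm 2 M u * Lp_norm 2 M v) * exp (w * t)"
proof -
  have "\<bar>pairing M (P t u) v\<bar> \<le> Lp_norm 2 M (P t u) * Lp_norm 2 M v"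
    using assms by (intro L2_Cauchy_Schwarz P_in)
  also have "\<dots> \<le> (K * exp (w * t) * Lp_norm 2 M u) * Lp_norm 2 M v"
    using assms by (intro mult_right_mono P_bound) (auto simp: Lp_norm_nonneg)
  finally show ?thesis by (simp add: mult_ac)
qed

lemma P_pair_plus: "0 \<le> s \<Longrightarrow> 0 \<le> t \<Longrightarrow> u \<in> Lp 2 M \<Longrightarrow> v \<in> Lp 2 M \<Longrightarrow>
    pairing M (P (s + t) u) v = pairing M (P s (P t u)) v"
  by (intro pairing_cong_left P_plus P_in) (auto simp: Lp_measurable)

lemma P_pair_0: "u \<in> Lp 2 M \<Longrightarrow> v \<in> borel_measurable M \<Longrightarrow> pairing M (P 0 u) v = pairing M u v"
  by (intro pairing_cong_left P_0 P_in) auto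

section \<open>The adjoint semigroup\<close>

text \<open>\<open>L2_dual\<close> is defined by choice; the Riesz theorem shows that there is a
  vector to choose.\<close>

lemma L2_dual_in_pair:
  assumes t: "0 \<le> t" and v: "v \<in> Lp 2 M"
  shows "L2_dual M (P t) v \<in> Lp 2 M \<and> (\<forall>u\<in>Lp 2 M. pairing M (P t u) v = pairing M u (L2_dual M (P t) v))"
proof -
  have vm: "v \<in> borel_measurable M" using v by (rule Lp_measurable)
  obtain x where "x \<in> Lp 2 M" "\<And>u. u \<in> Lp 2 M \<Longrightarrow> pairing M (P t u) v = pairing M x u"
  proof (rule L2_Riesz[where \<phi> = "\<lambda>u. pairing M (P t u) v" and N = "K * exp (w * t) * Lp_norm 2 M v" and M = M])
    fix u u' assume u: "u \<in> Lp 2 M" "u' \<in> Lp 2 M"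
    have "pairing M (P t (\<lambda>x. u x + u' x)) v = pairing M (\<lambda>x. P t u x + P t u' x) v"
      using u t vm by (intro pairing_cong_left P_add) (auto intro: P_in)
    then show "pairing M (P t (\<lambda>x. u x + u' x)) v = pairing M (P t u) v + pairing M (P t u') v"
      using u t v by (simp add: pairing_linear P_in)
  next
    fix c u assume u: "u \<in> Lp 2 M"
    have "pairing M (P t (\<lambda>x. c * u x)) v = pairing M (\<lambda>x. c * P t u x) v"
      using u t vm by (intro pairing_cong_left P_cmult) (auto intro: P_in)
    then show "pairing M (P t (\<lambda>x. c * u x)) v = c * pairing M (P t u) v"
      by (simp add: pairing_linear)
  next
    fix u assume "u \<in> Lp 2 M"
    then show "\<bar>pairing M (P t u) v\<bar> \<le> K * exp (w * t) * Lp_norm 2 M v * Lp_norm 2 M u"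
      using P_pair_bound[OF _ v t] by (simp add: mult_ac)
  qed (rule that)
  then have "\<exists>x. x \<in> Lp 2 M \<and> (\<forall>u\<in>Lp 2 M. pairing M (P t u) v = pairing M u x)"
    by (auto simp: pairing_commute)
  then show ?thesis unfolding L2_dual_def by (rule someI_ex)
qed

lemma L2_dual_in: "0 \<le> t \<Longrightarrow> v \<in> Lp 2 M \<Longrightarrow> L2_dual M (P t) v \<in> Lp 2 M"
  using L2_dual_in_pair by blast

lemma L2_dual_pair: "0 \<le> t \<Longrightarrow> v \<in> Lp 2 M \<Longrightarrow> u \<in> Lp 2 M \<Longrightarrow>
    pairing M (L2_dual M (P t) v) u = pairing M (P t u) v"
  using L2_dual_in_pair by (metis pairing_commute)

lemma L2_semigroup_dual: "L2_semigroup M (\<lambda>t. L2_dual M (P t)) K w"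
proof
  let ?Q = "\<lambda>t. L2_dual M (P t)"
  note in' = L2_dual_in and pair = L2_dual_pair
  show "?Q t u \<in> Lp 2 M" if "0 \<le> t" "u \<in> Lp 2 M" for t u using that by (rule in')
  show "AE x in M. ?Q t u x = ?Q t v x"
    if "0 \<le> t" "u \<in> Lp 2 M" "v \<in> Lp 2 M" "AE x in M. u x = v x" for t u v
  proof (rule L2_eqI)
    fix y assume y: "y \<in> Lp 2 M"
    show "pairing M (?Q t u) y = pairing M (?Q t v) y"
      using that y by (simp add: pair pairing_cong_right[of u M v "P t y"] P_meas)
  qed (use that in' in auto)
  show "AE x in M. ?Q t (\<lambda>y. u y + v y) x = ?Q t u x + ?Q t v x"
    if "0 \<le> t" "u \<in> Lp 2 M" "v \<in> Lp 2 M" for t u v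
    by (rule L2_eqI) (use that in' in \<open>auto simp: pair pairing_linear L2_add P_in\<close>)
  show "AE x in M. ?Q t (\<lambda>y. c * u y) x = c * ?Q t u x" if "0 \<le> t" "u \<in> Lp 2 M" for t u c
    by (rule L2_eqI) (use that in' in \<open>auto simp: pair pairing_linear L2_cmult P_in\<close>)
  show "AE x in M. ?Q 0 u x = u x" if "u \<in> Lp 2 M" for u
  proof (rule L2_eqI)
    fix v assume v: "v \<in> Lp 2 M"
    show "pairing M (?Q 0 u) v = pairing M u v"
      using that v by (simp add: pair P_pair_0 Lp_measurable pairing_commute[of M v u])
  qed (use that in' in auto)
  show "AE x in M. ?Q (s + t) u x = ?Q s (?Q t u) x" if "0 \<le> s" "0 \<le> t" "u \<in> Lp 2 M" for s t u
  proof (rule L2_eqI)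
    fix y assume y: "y \<in> Lp 2 M"
    \<comment> \<open>Adjoints reverse the order of composition, so the times are swapped before the
      semigroup law is applied.\<close>
    have "pairing M (?Q (s + t) u) y = pairing M (P (t + s) y) u"
      using that y by (simp add: pair add.commute)
    also have "\<dots> = pairing M (P t (P s y)) u" using that y by (simp add: P_pair_plus)
    also have "\<dots> = pairing M (?Q s (?Q t u)) y"
      using that y by (simp add: pair in' P_in pairing_commute[of M "P s y"])
    finally show "pairing M (?Q (s + t) u) y = pairing M (?Q s (?Q t u)) y" .
  qed (use that in' in auto)
  show "nonneg_ae M (?Q t u)" if "0 \<le> t" "u \<in> Lp 2 M" "nonneg_ae M u" for t u
    by (rule L2_nonnegI) (use that in' in \<open>auto simp: pair intro!: pairing_nonneg P_pos\<close>)
  show "Lp_norm 2 M (?Q t u) \<le> K * exp (w * t) * Lp_norm 2 M u" if "0 \<le> t" "u \<in> Lp 2 M" for t u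
  proof (rule L2_norm_leI)
    show "\<bar>pairing M (?Q t u) v\<bar> \<le> K * exp (w * t) * Lp_norm 2 M u * Lp_norm 2 M v" if "v \<in> Lp 2 M" for v
      using P_pair_bound[OF \<open>v \<in> _\<close> \<open>u \<in> _\<close> \<open>0 \<le> t\<close>] that \<open>u \<in> _\<close> \<open>0 \<le> t\<close> by (simp add: pair mult_ac)
  qed (use that in' K_nonneg in \<open>auto simp: Lp_norm_nonneg\<close>)
  show "continuous_on {0..} (\<lambda>t. pairing M (?Q t u) v)" if "u \<in> Lp 2 M" "v \<in> Lp 2 M" for u v
    using P_cont[OF that(2,1)] by (rule continuous_on_eq) (use that pair in simp)
qed (rule K_nonneg)

section \<open>Resolvents as weak Laplace integrals\<close>

text \<open>A vector-valued Laplace integral taken through its pairings: representatives do not form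
  a normed space in which a Bochner integral could be taken. That it inverts l minus the generator
  is proved below.\<close>

definition R :: "real \<Rightarrow> ('a \<Rightarrow> real) \<Rightarrow> ('a \<Rightarrow> real)" where
  "R l u = (SOME x. x \<in> Lp 2 M \<and> (\<forall>v\<in>Lp 2 M. pairing M x v = laplace l (\<lambda>t. pairing M (P t u) v)))"

lemma R_in_pair:
  assumes l: "w < l" and u: "u \<in> Lp 2 M"
  shows "R l u \<in> Lp 2 M \<and> (\<forall>v\<in>Lp 2 M. pairing M (R l u) v = laplace l (\<lambda>t. pairing M (P t u) v))"
proof -
  obtain x where "x \<in> Lp 2 M"
    "\<And>v. v \<in> Lp 2 M \<Longrightarrow> laplace l (\<lambda>t. pairing M (P t u) v) = pairing M x v"
  proof (rule L2_Riesz[where \<phi> = "\<lambda>v. laplace l (\<lambda>t. pairing M (P t u) v)"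
        and N = "K * Lp_norm 2 M u / (l - w)" and M = M])
    fix v v' assume v: "v \<in> Lp 2 M" "v' \<in> Lp 2 M"
    have "laplace l (\<lambda>t. pairing M (P t u) (\<lambda>x. v x + v' x))
        = laplace l (\<lambda>t. pairing M (P t u) v + pairing M (P t u) v')"
      using v u by (intro laplace_cong) (simp add: pairing_linear P_in)
    also have "\<dots> = laplace l (\<lambda>t. pairing M (P t u) v) + laplace l (\<lambda>t. pairing M (P t u) v')"
      by (rule laplace_add[OF P_cont[OF u v(1)] P_pair_bound[OF u v(1)]
            P_cont[OF u v(2)] P_pair_bound[OF u v(2)] l])
    finally show "laplace l (\<lambda>t. pairing M (P t u) (\<lambda>x. v x + v' x))
      = laplace l (\<lambda>t. pairing M (P t u) v) + laplace l (\<lambda>t. pairing M (P t u) v')" .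
  next
    fix v assume v: "v \<in> Lp 2 M"
    show "laplace l (\<lambda>t. pairing M (P t u) (\<lambda>x. c * v x)) = c * laplace l (\<lambda>t. pairing M (P t u) v)" for c
      by (simp add: pairing_linear laplace_cmult)
    have "\<bar>laplace l (\<lambda>t. pairing M (P t u) v)\<bar> \<le> (K * Lp_norm 2 M u * Lp_norm 2 M v) / (l - w)"
      by (rule laplace_bound[OF P_cont[OF u v] P_pair_bound[OF u v] l])
    then show "\<bar>laplace l (\<lambda>t. pairing M (P t u) v)\<bar> \<le> K * Lp_norm 2 M u / (l - w) * Lp_norm 2 M v"
      by simp
  qed (rule that)
  then have "\<exists>x. x \<in> Lp 2 M \<and> (\<forall>v\<in>Lp 2 M. pairing M x v = laplace l (\<lambda>t. pairing M (P t u) v))"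
    by metis
  then show ?thesis unfolding R_def by (rule someI_ex)
qed

lemma R_in: "w < l \<Longrightarrow> u \<in> Lp 2 M \<Longrightarrow> R l u \<in> Lp 2 M"
  using R_in_pair by blast

lemma R_pair: "w < l \<Longrightarrow> u \<in> Lp 2 M \<Longrightarrow> v \<in> Lp 2 M \<Longrightarrow>
    pairing M (R l u) v = laplace l (\<lambda>t. pairing M (P t u) v)"
  using R_in_pair by blast

lemma R_nonneg: "w < l \<Longrightarrow> u \<in> Lp 2 M \<Longrightarrow> nonneg_ae M u \<Longrightarrow> nonneg_ae M (R l u)"
  by (rule L2_nonnegI) (auto simp: R_in R_pair intro!: laplace_nonneg pairing_nonneg P_pos)

text \<open>Both sides are the Laplace transform of the same scalar function, once
  \<open>P t\<close> has been moved across the pairing.\<close>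

lemma R_adjoint:
  assumes "w < l" "u \<in> Lp 2 M" "v \<in> Lp 2 M"
  shows "pairing M (R l u) v = pairing M u (L2_semigroup.R M (\<lambda>t. L2_dual M (P t)) l v)"
proof -
  interpret adj: L2_semigroup M "\<lambda>t. L2_dual M (P t)" K w by (rule L2_semigroup_dual)
  have "pairing M u (adj.R l v) = laplace l (\<lambda>t. pairing M (L2_dual M (P t) v) u)"
    using assms by (subst pairing_commute) (rule adj.R_pair)
  also have "\<dots> = laplace l (\<lambda>t. pairing M (P t u) v)"
    using assms by (intro laplace_cong) (simp add: L2_dual_pair)
  finally show ?thesis using assms by (simp add: R_pair)
qed

lemma P_R_pair:
  assumes "w < l" "u \<in> Lp 2 M" "v \<in> Lp 2 M" "0 \<le> h"
  shows "pairing M (P h (R l u)) v = laplace l (\<lambda>t. pairing M (P (t + h) u) v)"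
proof -
  have "pairing M (P h (R l u)) v = pairing M (R l u) (L2_dual M (P h) v)"
    using L2_dual_pair[of h v "R l u"] assms by (simp add: R_in pairing_commute)
  also have "\<dots> = laplace l (\<lambda>t. pairing M (P t u) (L2_dual M (P h) v))"
    using assms by (simp add: R_pair L2_dual_in)
  also have "\<dots> = laplace l (\<lambda>t. pairing M (P (t + h) u) v)"
  proof (rule laplace_cong)
    fix t :: real assume t: "0 \<le> t"
    have "pairing M (P t u) (L2_dual M (P h) v) = pairing M (P h (P t u)) v"
      using assms t by (subst pairing_commute) (simp add: L2_dual_pair P_in)
    then show "pairing M (P t u) (L2_dual M (P h) v) = pairing M (P (t + h) u) v"
      using assms t by (simp add: P_pair_plus add.commute[of t h])
  qed
  finally show ?thesis .
qed

text \<open>Weak form of the splitting of the resolvent integral at time h. From it come the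
  generator equation, the convergence of averages in norm and the supermedian property of
  resolvents.\<close>

lemma P_R_pair_part:
  assumes "w < l" "u \<in> Lp 2 M" "v \<in> Lp 2 M" "0 \<le> h"
  shows "exp (- (l * h)) * pairing M (P h (R l u)) v
    = pairing M (R l u) v - laplace_part l h (\<lambda>t. pairing M (P t u) v)"
  using laplace_shift[OF P_cont[OF assms(2,3)] P_pair_bound[OF assms(2,3)] assms(1,4)] assms
  by (simp add: P_R_pair R_pair)

lemma laplace_part_tendsto:
  assumes "u \<in> Lp 2 M" "v \<in> Lp 2 M"
  shows "((\<lambda>h. laplace_part l h (\<lambda>t. pairing M (P t u) v) / h) \<longlongrightarrow> pairing M u v) (at_right 0)"
proof (rule tendstoI)
  fix \<epsilon> :: real assume \<epsilon>: "0 < \<epsilon>"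
  have "continuous_on {0..} (\<lambda>t. exp (- (l * t)) * pairing M (P t u) v)"
    by (intro continuous_intros P_cont assms)
  then have "((\<lambda>t. exp (- (l * t)) * pairing M (P t u) v) \<longlongrightarrow> exp (- (l * 0)) * pairing M (P 0 u) v) (at 0 within {0..})"
    unfolding continuous_on_def by (rule bspec) simp
  then have "\<forall>\<^sub>F t in at 0 within {0..}. dist (exp (- (l * t)) * pairing M (P t u) v) (pairing M u v) < \<epsilon> / 2"
    using \<epsilon> assms by (intro tendstoD) (auto simp: P_pair_0 Lp_measurable)
  then obtain d where d: "0 < d"
    "\<And>t. 0 < t \<Longrightarrow> t < d \<Longrightarrow> dist (exp (- (l * t)) * pairing M (P t u) v) (pairing M u v) < \<epsilon> / 2"
    by (auto simp: eventually_at dist_real_def)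
  have *: "\<bar>exp (- (l * t)) * pairing M (P t u) v - pairing M u v\<bar> \<le> \<epsilon> / 2" if "0 \<le> t" "t < d" for t
    using d(2)[of t] that \<epsilon> assms
    by (cases "t = 0") (auto simp: P_pair_0 Lp_measurable dist_real_def less_imp_le)
  have "\<bar>laplace_part l h (\<lambda>t. pairing M (P t u) v) / h - pairing M u v\<bar> \<le> \<epsilon> / 2" if "0 < h" "h < d" for h
    using that * by (intro laplace_part_average P_cont assms) auto
  then show "\<forall>\<^sub>F h in at_right 0. dist (laplace_part l h (\<lambda>t. pairing M (P t u) v) / h) (pairing M u v) < \<epsilon>"
    unfolding eventually_at_right_field dist_real_def using d(1) \<epsilon> by (intro exI[of _ d]) force
qed

lemma exp_quotient_tendsto: "((\<lambda>h. (exp (l * h) - 1) / h) \<longlongrightarrow> l) (at_right (0::real))"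
proof -
  have "((\<lambda>h. exp (l * h)) has_real_derivative l) (at 0)"
    by (auto intro!: derivative_eq_intros)
  then have "((\<lambda>h. (exp (l * h) - 1) / h) \<longlongrightarrow> l) (at 0)"
    by (simp add: has_field_derivative_iff)
  then show ?thesis by (rule filterlim_mono) (simp_all add: at_le)
qed

section \<open>Weak generators and their resolvents\<close>

text \<open>Solved for P(h)R(l)u, the shift identity writes the difference quotient as (e^(lh) -
  1)/h times <R(l)u,v> minus e^(lh) times an average over [0,h); both limits are known.\<close>

lemma R_weak_generator:
  assumes l: "w < l" and u: "u \<in> Lp 2 M"
  shows "(R l u, \<lambda>x. l * R l u x - u x) \<in> weak_generator M P"
proof -
  have "((\<lambda>t. pairing M v (\<lambda>x. (P t (R l u) x - R l u x) / t)) \<longlongrightarrow> pairing M v (\<lambda>x. l * R l u x - u x)) (at_right 0)"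
    if v: "v \<in> Lp 2 M" for v
  proof -
    let ?q = "\<lambda>h. laplace_part l h (\<lambda>t. pairing M (P t u) v) / h"
    have "((\<lambda>h. (exp (l * h) - 1) / h * pairing M (R l u) v - exp (l * h) * ?q h)
        \<longlongrightarrow> l * pairing M (R l u) v - exp (l * 0) * pairing M u v) (at_right 0)"
      by (intro tendsto_intros exp_quotient_tendsto laplace_part_tendsto u v)
    also have "l * pairing M (R l u) v - exp (l * 0) * pairing M u v = pairing M v (\<lambda>x. l * R l u x - u x)"
      using u v l by (simp add: pairing_commute[of M v] pairing_linear R_in L2_cmult)
    finally show ?thesis
    proof (rule Lim_transform_eventually)
      show "\<forall>\<^sub>F h in at_right 0. (exp (l * h) - 1) / h * pairing M (R l u) v - exp (l * h) * ?q h
          = pairing M v (\<lambda>x. (P h (R l u) x - R l u x) / h)"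
      proof (rule eventually_at_rightI[of 0 1])
        fix h :: real assume "h \<in> {0<..<1}"
        then have h: "0 < h" by simp
        have "exp (l * h) * (exp (- (l * h)) * pairing M (P h (R l u)) v)
            = exp (l * h) * (pairing M (R l u) v - laplace_part l h (\<lambda>t. pairing M (P t u) v))"
          using P_R_pair_part[OF l u v, of h] h by simp
        then have "pairing M (P h (R l u)) v
            = exp (l * h) * (pairing M (R l u) v - laplace_part l h (\<lambda>t. pairing M (P t u) v))"
          by (simp flip: mult.assoc exp_add)
        moreover have "pairing M v (\<lambda>x. (P h (R l u) x - R l u x) / h)
            = (pairing M (P h (R l u)) v - pairing M (R l u) v) / h"
          using u v l h by (simp add: pairing_commute[of M v] pairing_linear R_in P_in)
        ultimately show "(exp (l * h) - 1) / h * pairing M (R l u) v - exp (l * h) * ?q h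
          = pairing M v (\<lambda>x. (P h (R l u) x - R l u x) / h)"
          using h by (simp add: diff_divide_distrib left_diff_distrib right_diff_distrib)
      qed simp
    qed
  qed
  then show ?thesis using u l unfolding weak_generator_def by (auto intro: R_in L2_diff[OF L2_cmult[OF R_in]])
qed

lemma weak_generatorD:
  assumes "(x, z) \<in> weak_generator M P"
  shows "x \<in> Lp 2 M" "z \<in> Lp 2 M"
    "v \<in> Lp 2 M \<Longrightarrow> ((\<lambda>t. (pairing M (P t x) v - pairing M x v) / t) \<longlongrightarrow> pairing M z v) (at_right 0)"
proof -
  show x: "x \<in> Lp 2 M" and "z \<in> Lp 2 M" using assms by (auto simp: weak_generator_def)
  assume v: "v \<in> Lp 2 M"
  have "((\<lambda>t. pairing M v (\<lambda>y. (P t x y - x y) / t)) \<longlongrightarrow> pairing M v z) (at_right 0)"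
    using assms v by (auto simp: weak_generator_def)
  moreover have "\<forall>\<^sub>F t in at_right 0. pairing M v (\<lambda>y. (P t x y - x y) / t) = (pairing M (P t x) v - pairing M x v) / t"
    using x v by (intro eventually_at_rightI[of 0 1])
      (auto simp: pairing_commute[of M v] pairing_linear P_in)
  ultimately show "((\<lambda>t. (pairing M (P t x) v - pairing M x v) / t) \<longlongrightarrow> pairing M z v) (at_right 0)"
    unfolding pairing_commute[of M v z] by (rule Lim_transform_eventually)
qed

text \<open>The weak form of R(l)(lx - z) = x. With v' the adjoint resolvent applied to v, the
  difference quotient of <P(t)x, v'> is evaluated twice: at x, and at v', which lies in the domain
  of the adjoint weak generator. Equating the limits avoids integrating along the orbit of
  x.\<close>

lemma weak_generator_pair:
  assumes xz: "(x, z) \<in> weak_generator M P" and v: "v \<in> Lp 2 M" and l: "w < l"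
  shows "pairing M x v = l * pairing M (R l x) v - pairing M (R l z) v"
proof -
  interpret adj: L2_semigroup M "\<lambda>t. L2_dual M (P t)" K w by (rule L2_semigroup_dual)
  note xD = weak_generatorD[OF xz]
  define v' where "v' = adj.R l v"
  have v': "v' \<in> Lp 2 M" unfolding v'_def using v l by (rule adj.R_in[rotated])
  have "((\<lambda>t. (pairing M (L2_dual M (P t) v') x - pairing M v' x) / t)
      \<longlongrightarrow> pairing M (\<lambda>y. l * v' y - v y) x) (at_right 0)"
    unfolding v'_def by (rule adj.weak_generatorD(3)[OF adj.R_weak_generator[OF l v] xD(1)])
  moreover have "\<forall>\<^sub>F t in at_right 0. (pairing M (L2_dual M (P t) v') x - pairing M v' x) / t
      = (pairing M (P t x) v' - pairing M x v') / t"
    using xD v' by (intro eventually_at_rightI[of 0 1]) (auto simp: L2_dual_pair pairing_commute[of M v' x])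
  ultimately have "((\<lambda>t. (pairing M (P t x) v' - pairing M x v') / t)
      \<longlongrightarrow> pairing M (\<lambda>y. l * v' y - v y) x) (at_right 0)"
    by (rule Lim_transform_eventually)
  moreover have "((\<lambda>t. (pairing M (P t x) v' - pairing M x v') / t) \<longlongrightarrow> pairing M z v') (at_right 0)"
    by (rule xD(3)[OF v'])
  ultimately have "pairing M z v' = pairing M (\<lambda>y. l * v' y - v y) x"
    by (intro tendsto_unique[OF _ \<open>(_ \<longlongrightarrow> pairing M z v') _\<close>]) auto
  also have "\<dots> = l * pairing M x v' - pairing M x v"
    using xD v' v by (simp add: pairing_linear pairing_commute[of M _ x] L2_cmult)
  finally show ?thesis
    using R_adjoint[OF l xD(1) v] R_adjoint[OF l xD(2) v] by (simp add: v'_def)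
qed

lemma weak_generator_R_unique:
  assumes xz: "(x, z) \<in> weak_generator M P" and u: "u \<in> Lp 2 M" and l: "w < l"
    and eq: "AE y in M. l * x y - z y = u y"
  shows "AE y in M. x y = R l u y"
proof (rule L2_eqI)
  interpret adj: L2_semigroup M "\<lambda>t. L2_dual M (P t)" K w by (rule L2_semigroup_dual)
  note xD = weak_generatorD[OF xz]
  show "x \<in> Lp 2 M" "R l u \<in> Lp 2 M" using xD R_in l u by auto
  fix v assume v: "v \<in> Lp 2 M"
  have v': "adj.R l v \<in> Lp 2 M" using v l by (rule adj.R_in[rotated])
  have "pairing M x v = l * pairing M (R l x) v - pairing M (R l z) v"
    by (rule weak_generator_pair[OF xz v l])
  also have "\<dots> = l * pairing M x (adj.R l v) - pairing M z (adj.R l v)"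
    using R_adjoint[OF l xD(1) v] R_adjoint[OF l xD(2) v] by simp
  also have "\<dots> = pairing M (\<lambda>y. l * x y - z y) (adj.R l v)"
    using xD v' by (simp add: pairing_linear L2_cmult)
  also have "\<dots> = pairing M u (adj.R l v)"
    by (rule pairing_cong_left[OF L2_diff[OF L2_cmult[OF xD(1)] xD(2)] u Lp_measurable[OF v'] eq])
  also have "\<dots> = pairing M (R l u) v" using R_adjoint[OF l u v] by simp
  finally show "pairing M x v = pairing M (R l u) v" .
qed

text \<open>\<open>resolvent\<close> may choose any solution of the equation, and solutions are
  unique up to null sets. The graph G is left open so that the norm generator and the weak generator
  are both covered.\<close>

lemma resolvent_AE_R:
  assumes G: "G \<subseteq> weak_generator M P" "(R l u, \<lambda>x. l * R l u x - u x) \<in> G"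
    and u: "u \<in> Lp 2 M" and l: "w < l"
  shows "resolvent M G l u \<in> Lp 2 M" "AE x in M. resolvent M G l u x = R l u x"
proof -
  have "(R l u, \<lambda>x. l * R l u x - u x) \<in> G \<and> (AE x in M. l * R l u x - (l * R l u x - u x) = u x)"
    using G(2) by simp
  then have "\<exists>y z. (y, z) \<in> G \<and> (AE x in M. l * y x - z x = u x)" by (intro exI)
  then have "\<exists>z. (resolvent M G l u, z) \<in> G \<and> (AE x in M. l * resolvent M G l u x - z x = u x)"
    unfolding resolvent_def by (rule someI_ex)
  then obtain z where z: "(resolvent M G l u, z) \<in> weak_generator M P"
    "AE x in M. l * resolvent M G l u x - z x = u x"
    using G(1) by (elim exE conjE) (auto dest: subsetD)
  show "resolvent M G l u \<in> Lp 2 M" by (rule weak_generatorD(1)[OF z(1)])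
  show "AE x in M. resolvent M G l u x = R l u x" by (rule weak_generator_R_unique[OF z(1) u l z(2)])
qed

text \<open>P(s) commutes with P(t) and is moved to the test vector, where it becomes its adjoint;
  the limit for x itself then applies.\<close>

lemma weak_generator_P:
  assumes xz: "(x, z) \<in> weak_generator M P" and s: "0 \<le> s"
  shows "(P s x, P s z) \<in> weak_generator M P"
proof -
  note xD = weak_generatorD[OF xz]
  have "((\<lambda>t. pairing M u (\<lambda>y. (P t (P s x) y - P s x y) / t)) \<longlongrightarrow> pairing M u (P s z)) (at_right 0)"
    if u: "u \<in> Lp 2 M" for u
  proof -
    let ?u = "L2_dual M (P s) u"
    have u': "?u \<in> Lp 2 M" by (rule L2_dual_in[OF s u])
    have "((\<lambda>t. (pairing M (P t x) ?u - pairing M x ?u) / t) \<longlongrightarrow> pairing M z ?u) (at_right 0)"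
      by (rule xD(3)[OF u'])
    also have "pairing M z ?u = pairing M u (P s z)"
      using L2_dual_pair[OF s u xD(2)] by (simp add: pairing_commute)
    finally show ?thesis
    proof (rule Lim_transform_eventually)
      show "\<forall>\<^sub>F t in at_right 0. (pairing M (P t x) ?u - pairing M x ?u) / t
          = pairing M u (\<lambda>y. (P t (P s x) y - P s x y) / t)"
      proof (rule eventually_at_rightI[of 0 1])
        fix t :: real assume "t \<in> {0<..<1}"
        then have t: "0 \<le> t" by simp
        have "pairing M (P t x) ?u = pairing M (P s (P t x)) u"
          using L2_dual_pair[OF s u P_in[OF t xD(1)]] by (simp add: pairing_commute)
        also have "\<dots> = pairing M (P t (P s x)) u"
          using P_pair_plus[OF s t xD(1) u] P_pair_plus[OF t s xD(1) u] by (simp add: add.commute)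
        finally show "(pairing M (P t x) ?u - pairing M x ?u) / t
            = pairing M u (\<lambda>y. (P t (P s x) y - P s x y) / t)"
          using L2_dual_pair[OF s u xD(1)] xD t s u
          by (simp add: pairing_commute[of M u] pairing_linear P_in pairing_commute[of M x])
      qed simp
    qed
  qed
  then show ?thesis using xD s unfolding weak_generator_def by (auto intro: P_in)
qed

lemma R_pair_Abelian:
  assumes "u \<in> Lp 2 M" "v \<in> Lp 2 M"
  shows "((\<lambda>l. l * pairing M (R l u) v) \<longlongrightarrow> pairing M u v) at_top"
proof -
  have "((\<lambda>l. l * laplace l (\<lambda>t. pairing M (P t u) v)) \<longlongrightarrow> pairing M (P 0 u) v) at_top"
    by (rule laplace_Abelian[OF P_cont[OF assms] P_pair_bound[OF assms]])
  then have "((\<lambda>l. l * laplace l (\<lambda>t. pairing M (P t u) v)) \<longlongrightarrow> pairing M u v) at_top"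
    using assms by (simp add: P_pair_0 Lp_measurable)
  then show ?thesis
    by (rule Lim_transform_eventually)
      (use eventually_gt_at_top[of w] in eventually_elim, use assms in \<open>simp add: R_pair\<close>)
qed

end

section \<open>Strongly continuous positive semigroups on L2\<close>

lemma pairing_tendsto:
  assumes "\<forall>\<^sub>F n in F. u n \<in> Lp 2 M" "y \<in> Lp 2 M" "v \<in> Lp 2 M"
    "((\<lambda>n. Lp_norm 2 M (\<lambda>x. u n x - y x)) \<longlongrightarrow> 0) F"
  shows "((\<lambda>n. pairing M (u n) v) \<longlongrightarrow> pairing M y v) F"
proof (rule LIM_zero_cancel, rule Lim_null_comparison)
  show "\<forall>\<^sub>F n in F. norm (pairing M (u n) v - pairing M y v) \<le> Lp_norm 2 M (\<lambda>x. u n x - y x) * Lp_norm 2 M v"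
    using assms(1)
  proof eventually_elim
    case (elim n)
    show ?case
      using L2_Cauchy_Schwarz[OF L2_diff[OF elim assms(2)] assms(3)] elim assms by (simp add: pairing_diff_left)
  qed
  show "((\<lambda>n. Lp_norm 2 M (\<lambda>x. u n x - y x) * Lp_norm 2 M v) \<longlongrightarrow> 0) F"
    using tendsto_mult_right[OF assms(4)] by simp
qed

text \<open>N r t stands for the distance of the orbit points at times r and t, and g for the
  distance from the start. The semigroup law compares two times by going back to the earlier one, so
  right continuity at 0 gives continuity from both sides everywhere. Kept free of a particular norm,
  it serves L_2 and L_1.\<close>

lemma orbit_modulus_tendsto:
  fixes N :: "real \<Rightarrow> real \<Rightarrow> real"
  assumes g: "(g \<longlongrightarrow> 0) (at_right 0)" and s: "0 \<le> s" and k: "0 \<le> k"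
    and g0: "\<And>t. 0 \<le> g t" and N0: "\<And>r t. 0 \<le> N r t" and sym: "\<And>r t. N r t = N t r"
    and le: "\<And>r t. 0 \<le> r \<Longrightarrow> r \<le> t \<Longrightarrow> N t r \<le> k * exp (w * r) * g (t - r)"
  shows "((\<lambda>t. N t s) \<longlongrightarrow> 0) (at s within {0..})"
proof (rule Lim_null_comparison)
  \<comment> \<open>Bounds k e^(wr) for all r in [0, s+1], whatever the sign of w.\<close>
  let ?C = "k * exp (\<bar>w\<bar> * (s + 1))"
  have "((\<lambda>t. \<bar>t - s\<bar>) \<longlongrightarrow> \<bar>s - s\<bar>) (at s within {0..})"
    by (intro tendsto_intros)
  then have "filterlim (\<lambda>t. \<bar>t - s\<bar>) (at_right 0) (at s within {0..})"
    by (auto simp: filterlim_at eventually_at_filter)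
  then have "((\<lambda>t. g \<bar>t - s\<bar>) \<longlongrightarrow> 0) (at s within {0..})"
    by (rule filterlim_compose[OF g])
  then show "((\<lambda>t. ?C * g \<bar>t - s\<bar>) \<longlongrightarrow> 0) (at s within {0..})"
    by (rule tendsto_mult_right_zero)
  have E: "k * exp (w * r) \<le> ?C" if "0 \<le> r" "r \<le> s + 1" for r
  proof -
    have "w * r \<le> \<bar>w\<bar> * (s + 1)" using that by (intro mult_mono) auto
    then show ?thesis using k by (intro mult_left_mono) auto
  qed
  have "norm (N t s) \<le> ?C * g \<bar>t - s\<bar>" if "0 \<le> t" "\<bar>t - s\<bar> < 1" for t
  proof (cases "s \<le> t")
    case True
    have "N t s \<le> k * exp (w * s) * g (t - s)" using s True by (rule le)
    also have "\<dots> \<le> ?C * g (t - s)" using s by (intro mult_right_mono E g0) auto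
    finally show ?thesis using True N0[of t s] by simp
  next
    case False
    then have "N s t \<le> k * exp (w * t) * g (s - t)" using that by (intro le) auto
    also have "\<dots> \<le> ?C * g (s - t)" using that False by (intro mult_right_mono E g0) auto
    finally show ?thesis using False N0[of t s] by (simp add: sym[of t s])
  qed
  then show "\<forall>\<^sub>F t in at s within {0..}. norm (N t s) \<le> ?C * g \<bar>t - s\<bar>"
    unfolding eventually_at dist_real_def by (intro exI[of _ 1]) auto
qed

context bounded_L2_semigroup
begin

lemma P_diff_norm_le:
  assumes "0 \<le> s" "s \<le> t" "u \<in> Lp 2 M"
  shows "Lp_norm 2 M (\<lambda>x. P t u x - P s u x) \<le> K * exp (w * s) * Lp_norm 2 M (\<lambda>x. P (t - s) u x - u x)"
proof -
  have i: "P (t - s) u \<in> Lp 2 M" using assms by (intro P_in) auto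
  have "AE x in M. P t u x - P s u x = P s (\<lambda>y. P (t - s) u y - u y) x"
    using P_plus[of s "t - s" u] P_diff[OF assms(1) i assms(3)] assms by (auto elim: eventually_elim2)
  then have "Lp_norm 2 M (\<lambda>x. P t u x - P s u x) = Lp_norm 2 M (P s (\<lambda>y. P (t - s) u y - u y))"
    using assms i by (intro L2_norm_cong_AE) (auto intro!: borel_measurable_diff P_meas L2_diff)
  also have "\<dots> \<le> K * exp (w * s) * Lp_norm 2 M (\<lambda>x. P (t - s) u x - u x)"
    using assms i by (intro P_bound) auto
  finally show ?thesis .
qed

lemma P_strong_continuous:
  assumes lim: "((\<lambda>t. Lp_norm 2 M (\<lambda>x. P t u x - u x)) \<longlongrightarrow> 0) (at_right 0)"
    and u: "u \<in> Lp 2 M" and s: "0 \<le> s"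
  shows "((\<lambda>t. Lp_norm 2 M (\<lambda>x. P t u x - P s u x)) \<longlongrightarrow> 0) (at s within {0..})"
  by (rule orbit_modulus_tendsto[OF lim s K_nonneg, where w = w
        and N = "\<lambda>t r. Lp_norm 2 M (\<lambda>x. P t u x - P r u x)"])
    (auto simp: Lp_norm_nonneg intro: L2_norm_minus_commute P_diff_norm_le u)

end

locale strong_L2_semigroup = L2_semigroup +
  assumes P_strong: "\<And>u. u \<in> Lp 2 M \<Longrightarrow> ((\<lambda>t. Lp_norm 2 M (\<lambda>x. P t u x - u x)) \<longlongrightarrow> 0) (at_right 0)"

section \<open>Growth bounds from positivity\<close>

context positive_L2_semigroup
begin

lemma P_abs:
  assumes "0 \<le> t" "u \<in> Lp 2 M"
  shows "AE x in M. \<bar>P t u x\<bar> \<le> P t (\<lambda>y. \<bar>u y\<bar>) x"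
proof -
  have m: "(\<lambda>y. -1 * u y) \<in> Lp 2 M" using assms(2) by (rule L2_cmult)
  have "AE x in M. P t u x \<le> P t (\<lambda>y. \<bar>u y\<bar>) x"
    using assms by (intro P_mono) auto
  moreover have "AE x in M. P t (\<lambda>y. -1 * u y) x \<le> P t (\<lambda>y. \<bar>u y\<bar>) x"
    using assms by (intro P_mono m) auto
  moreover have "AE x in M. P t (\<lambda>y. -1 * u y) x = -1 * P t u x"
    using assms by (rule P_cmult)
  ultimately show ?thesis by eventually_elim auto
qed

text \<open>No Baire category argument is needed for positive operators: if $P(t_n)$ blows up on normalised
  $u_n$ fast enough, then it also blows up on the single vector $\sum_n 2^{-n} |u_n|$.\<close>

lemma P_bounded_near_0:
  assumes bdd: "\<And>t. 0 \<le> t \<Longrightarrow> \<exists>k. \<forall>u\<in>Lp 2 M. Lp_norm 2 M (P t u) \<le> k * Lp_norm 2 M u"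
    and strong: "\<And>u. u \<in> Lp 2 M \<Longrightarrow> ((\<lambda>t. Lp_norm 2 M (\<lambda>x. P t u x - u x)) \<longlongrightarrow> 0) (at_right 0)"
  shows "\<exists>\<delta>>0. \<exists>k. \<forall>t. 0 \<le> t \<longrightarrow> t \<le> \<delta> \<longrightarrow> (\<forall>u\<in>Lp 2 M. Lp_norm 2 M (P t u) \<le> k * Lp_norm 2 M u)"
proof (rule ccontr)
  assume neg: "\<not> ?thesis"
  have "\<exists>t u. 0 \<le> t \<and> t \<le> 1 / real (Suc n) \<and> u \<in> Lp 2 M \<and> 4 ^ n * Lp_norm 2 M u < Lp_norm 2 M (P t u)" for n
  proof -
    have "0 < 1 / real (Suc n)" by simp
    then show ?thesis using neg by (meson not_le)
  qed
  then obtain t u where t: "\<And>n. 0 \<le> t n" "\<And>n. t n \<le> 1 / real (Suc n)" and u: "\<And>n. u n \<in> Lp 2 M"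
    and big: "\<And>n. 4 ^ n * Lp_norm 2 M (u n) < Lp_norm 2 M (P (t n) (u n))"
    by metis
  have pos: "0 < Lp_norm 2 M (u n)" for n
  proof (rule ccontr)
    assume "\<not> ?thesis"
    then have "Lp_norm 2 M (u n) = 0" using Lp_norm_nonneg[of 2 M "u n"] by simp
    then show False using bdd[OF t(1)[of n]] u[of n] big[of n] by fastforce
  qed
  \<comment> \<open>Once the vectors are scaled to norm 2^(-n), the assumed growth factor 4^n still
    leaves the 2^n of \<open>low\<close>.\<close>
  define c where "c n = (1/2)^n / Lp_norm 2 M (u n)" for n
  have c: "0 < c n" for n using pos by (simp add: c_def)
  define v where "v n x = c n * \<bar>u n x\<bar>" for n x
  have v: "v n \<in> Lp 2 M" for n unfolding v_def using u by (intro L2_cmult L2_abs)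
  have v0: "0 \<le> v n x" for n x using c[of n] by (simp add: v_def)
  have vn: "Lp_norm 2 M (v n) \<le> (1/2)^n" for n
  proof -
    have "Lp_norm 2 M (v n) = c n * Lp_norm 2 M (u n)"
      using c[of n] unfolding v_def L2_norm_cmult by (simp add: L2_norm_eq pairing_def)
    also have "\<dots> = (1/2)^n" using pos[of n] by (simp add: c_def)
    finally show ?thesis by simp
  qed
  obtain U where U: "U \<in> Lp 2 M" and sums: "AE x in M. summable (\<lambda>n. v n x) \<and> (\<Sum>n. v n x) = U x"
    by (rule L2_series_bound[of v M, OF v v0 vn])
  have low: "2 ^ n < Lp_norm 2 M (P (t n) U)" for n
  proof -
    have "AE x in M. v n x \<le> U x"
      using sums
    proof eventually_elim
      case (elim x)
      then show ?case using sum_le_suminf[of "\<lambda>n. v n x" "{n}"] v0 by auto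
    qed
    then have "AE x in M. P (t n) (v n) x \<le> P (t n) U x" by (rule P_mono[OF t(1) v U])
    moreover have "AE x in M. P (t n) (v n) x = c n * P (t n) (\<lambda>y. \<bar>u n y\<bar>) x"
      unfolding v_def using t u by (intro P_cmult) auto
    moreover have "AE x in M. \<bar>P (t n) (u n) x\<bar> \<le> P (t n) (\<lambda>y. \<bar>u n y\<bar>) x"
      using t u by (intro P_abs)
    ultimately have "AE x in M. \<bar>c n * P (t n) (u n) x\<bar> \<le> \<bar>P (t n) U x\<bar>"
    proof eventually_elim
      case (elim x)
      have "\<bar>c n * P (t n) (u n) x\<bar> = c n * \<bar>P (t n) (u n) x\<bar>" using c[of n] by (simp add: abs_mult)
      also have "\<dots> \<le> c n * P (t n) (\<lambda>y. \<bar>u n y\<bar>) x" using c[of n] elim by (intro mult_left_mono) auto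
      finally show ?case using elim by linarith
    qed
    then have "Lp_norm 2 M (\<lambda>x. c n * P (t n) (u n) x) \<le> Lp_norm 2 M (P (t n) U)"
      using U u t by (intro L2_norm_mono P_in borel_measurable_times P_meas) auto
    then have "c n * Lp_norm 2 M (P (t n) (u n)) \<le> Lp_norm 2 M (P (t n) U)"
      using c[of n] by (simp add: L2_norm_cmult)
    moreover have "c n * (4 ^ n * Lp_norm 2 M (u n)) < c n * Lp_norm 2 M (P (t n) (u n))"
      using c[of n] big[of n] by simp
    moreover have "c n * (4 ^ n * Lp_norm 2 M (u n)) = 2 ^ n"
      using pos[of n] by (simp add: c_def power_divide flip: power_mult_distrib) (simp add: power_mult_distrib[symmetric] field_simps)
    ultimately show ?thesis by linarith
  qed
  have "\<forall>\<^sub>F s in at_right 0. Lp_norm 2 M (\<lambda>x. P s U x - U x) < 1"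
    using strong[OF U] by (rule order_tendstoD) simp
  then obtain d where d: "0 < d" "\<And>s. 0 < s \<Longrightarrow> s < d \<Longrightarrow> Lp_norm 2 M (\<lambda>x. P s U x - U x) < 1"
    unfolding eventually_at_right_field by auto
  have d': "Lp_norm 2 M (\<lambda>x. P s U x - U x) < 1" if "0 \<le> s" "s < d" for s
  proof (cases "s = 0")
    case True
    have "Lp_norm 2 M (\<lambda>x. P 0 U x - U x) = Lp_norm 2 M (\<lambda>x. 0)"
      using P_0[OF U] U P_in[OF order.refl U] by (intro L2_norm_cong_AE) (auto intro: Lp_measurable[of _ 2])
    then show ?thesis using True by (simp add: L2_norm_eq pairing_def)
  qed (use d that in simp)
  \<comment> \<open>t n tends to 0, so strong continuity at the one vector U keeps P(t n)U within
    distance 1 of U. This caps its norm, while \<open>low\<close> makes it unbounded.\<close>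
  obtain m where m: "1 / real (Suc m) < d" using reals_Archimedean[OF d(1)] by (auto simp: inverse_eq_divide)
  obtain k where k: "1 + Lp_norm 2 M U < 2 ^ k" using real_arch_pow[of 2] by auto
  define n where "n = max m k"
  have "1 / real (Suc n) \<le> 1 / real (Suc m)" by (intro divide_left_mono) (auto simp: n_def)
  then have "t n < d" using t(2)[of n] m by linarith
  have Pn: "P (t n) U \<in> Lp 2 M" using t U by (intro P_in)
  have "Lp_norm 2 M (P (t n) U) = Lp_norm 2 M (\<lambda>x. (P (t n) U x - U x) + U x)" by simp
  also have "\<dots> \<le> Lp_norm 2 M (\<lambda>x. P (t n) U x - U x) + Lp_norm 2 M U"
    using Pn U by (intro L2_norm_triangle) auto
  also have "\<dots> < 1 + Lp_norm 2 M U" using d'[OF t(1) \<open>t n < d\<close>] by simp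
  also have "\<dots> < 2 ^ k" by (rule k)
  also have "\<dots> \<le> 2 ^ n" by (rule power_increasing) (auto simp: n_def)
  finally show False using low[of n] by simp
qed

text \<open>Iterating the bound on [0,\<delta>] costs one factor k per step, and k^n \<le> e^(t ln k
  / \<delta>) for n \<le> t/\<delta>. That k \<ge> 1 makes ln k nonnegative and lets shorter times
  use the larger power.\<close>

lemma P_exponentially_bounded:
  assumes \<delta>: "0 < \<delta>" and k: "1 \<le> k"
    and b: "\<And>t u. 0 \<le> t \<Longrightarrow> t \<le> \<delta> \<Longrightarrow> u \<in> Lp 2 M \<Longrightarrow> Lp_norm 2 M (P t u) \<le> k * Lp_norm 2 M u"
    and t: "0 \<le> t" and u: "u \<in> Lp 2 M"
  shows "Lp_norm 2 M (P t u) \<le> k * exp (ln k / \<delta> * t) * Lp_norm 2 M u"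
proof -
  have step: "Lp_norm 2 M (P t u) \<le> k ^ Suc n * Lp_norm 2 M u" if "0 \<le> t" "t \<le> real (Suc n) * \<delta>" for n t
    using that
  proof (induction n arbitrary: t)
    case 0
    then show ?case using b u by simp
  next
    case (Suc n)
    show ?case
    proof (cases "t \<le> \<delta>")
      case True
      have "1 * k \<le> k ^ Suc n * k" using k by (intro mult_right_mono one_le_power) auto
      then have "k * Lp_norm 2 M u \<le> k ^ Suc (Suc n) * Lp_norm 2 M u"
        by (intro mult_right_mono) (auto simp: Lp_norm_nonneg mult_ac)
      then show ?thesis using b[OF Suc(2) True u] by linarith
    next
      case False
      then have t': "0 \<le> t - \<delta>" "t - \<delta> \<le> real (Suc n) * \<delta>" using Suc(3) by (auto simp: algebra_simps)
      have "Lp_norm 2 M (P t u) = Lp_norm 2 M (P \<delta> (P (t - \<delta>) u))"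
        using P_plus[of \<delta> "t - \<delta>" u] Suc(2) \<delta> t' u
        by (intro L2_norm_cong_AE) (auto intro!: P_meas P_in)
      also have "\<dots> \<le> k * Lp_norm 2 M (P (t - \<delta>) u)" using \<delta> t' u by (intro b P_in) auto
      also have "\<dots> \<le> k * (k ^ Suc n * Lp_norm 2 M u)" using k Suc(1)[OF t'] by (intro mult_left_mono) auto
      finally show ?thesis by (simp add: mult.assoc)
    qed
  qed
  define n where "n = nat \<lfloor>t / \<delta>\<rfloor>"
  have n: "real n \<le> t / \<delta>" "t / \<delta> \<le> real (Suc n)" unfolding n_def using t \<delta> by auto linarith+
  have "Lp_norm 2 M (P t u) \<le> k ^ Suc n * Lp_norm 2 M u"
    using n(2) \<delta> t by (intro step) (auto simp: field_simps)
  also have "\<dots> \<le> (k * exp (ln k / \<delta> * t)) * Lp_norm 2 M u"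
  proof (rule mult_right_mono)
    have "k ^ n = exp (ln k * real n)" using k by (simp add: exp_of_nat2_mult)
    also have "\<dots> \<le> exp (ln k * (t / \<delta>))" using mult_left_mono[OF n(1), of "ln k"] k by simp
    finally have "k * k ^ n \<le> k * exp (ln k * (t / \<delta>))" using k by (intro mult_left_mono) auto
    then show "k ^ Suc n \<le> k * exp (ln k / \<delta> * t)" by simp
  qed (rule Lp_norm_nonneg)
  finally show ?thesis .
qed

end

text \<open>The locale layers are entered one at a time: order first, from it the bound near 0, then
  the exponential bound, and with it continuity of orbits at every time.\<close>

lemma C0_semigroup_strong_L2_semigroup:
  assumes C0: "C0_semigroup_Lp 2 M T" and pos: "positive_semigroup_Lp 2 M T"
  shows "\<exists>K w. strong_L2_semigroup M T K w"
proof -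
  have bo: "bounded_operator_Lp 2 M (T t)" if "0 \<le> t" for t using C0 that by (auto simp: C0_semigroup_Lp_def)
  have strong: "((\<lambda>t. Lp_norm 2 M (\<lambda>x. T t u x - u x)) \<longlongrightarrow> 0) (at_right 0)" if "u \<in> Lp 2 M" for u
    using C0 that by (auto simp: C0_semigroup_Lp_def)
  interpret T: positive_L2_semigroup M T
    by unfold_locales
      (use bo C0 pos in \<open>auto simp: bounded_operator_Lp_def C0_semigroup_Lp_def positive_semigroup_Lp_def\<close>)
  have bdd: "\<exists>k. \<forall>u\<in>Lp 2 M. Lp_norm 2 M (T t u) \<le> k * Lp_norm 2 M u" if "0 \<le> t" for t
    using bo[OF that] by (auto simp: bounded_operator_Lp_def)
  obtain \<delta> k0 where \<delta>: "0 < \<delta>"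
    and k0: "\<And>t u. 0 \<le> t \<Longrightarrow> t \<le> \<delta> \<Longrightarrow> u \<in> Lp 2 M \<Longrightarrow> Lp_norm 2 M (T t u) \<le> k0 * Lp_norm 2 M u"
    using T.P_bounded_near_0[OF bdd strong] by blast
  define k where "k = max 1 k0"
  have k: "Lp_norm 2 M (T t u) \<le> k * Lp_norm 2 M u" if "0 \<le> t" "t \<le> \<delta>" "u \<in> Lp 2 M" for t u
    using k0[OF that] mult_right_mono[of k0 k "Lp_norm 2 M u"] by (simp add: k_def Lp_norm_nonneg)
  interpret T: bounded_L2_semigroup M T k "ln k / \<delta>"
  proof
    show "Lp_norm 2 M (T t u) \<le> k * exp (ln k / \<delta> * t) * Lp_norm 2 M u" if "0 \<le> t" "u \<in> Lp 2 M" for t u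
      using k that by (intro T.P_exponentially_bounded[OF \<delta>]) (auto simp: k_def)
  qed (simp add: k_def)
  have "strong_L2_semigroup M T k (ln k / \<delta>)"
  proof
    show "continuous_on {0..} (\<lambda>t. pairing M (T t u) v)" if uv: "u \<in> Lp 2 M" "v \<in> Lp 2 M" for u v
      unfolding continuous_on_def
    proof
      fix s :: real assume "s \<in> {0..}"
      then have s: "0 \<le> s" by simp
      show "((\<lambda>t. pairing M (T t u) v) \<longlongrightarrow> pairing M (T s u) v) (at s within {0..})"
      proof (rule pairing_tendsto)
        show "\<forall>\<^sub>F t in at s within {0..}. T t u \<in> Lp 2 M"
          using uv by (auto simp: eventually_at_filter T.P_in)
      qed (use T.P_strong_continuous[OF strong] uv s T.P_in in auto)
    qed
  qed (rule strong)
  then show ?thesis by blast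
qed

section \<open>Averages and generators in norm\<close>

context strong_L2_semigroup
begin

lemma P_scaled_strong:
  assumes u: "u \<in> Lp 2 M"
  shows "((\<lambda>t. Lp_norm 2 M (\<lambda>x. exp (- (l * t)) * P t u x - u x)) \<longlongrightarrow> 0) (at_right 0)"
proof (rule Lim_null_comparison)
  let ?b = "\<lambda>t. exp (- (l * t)) * Lp_norm 2 M (\<lambda>x. P t u x - u x) + \<bar>exp (- (l * t)) - 1\<bar> * Lp_norm 2 M u"
  show "\<forall>\<^sub>F t in at_right 0. norm (Lp_norm 2 M (\<lambda>x. exp (- (l * t)) * P t u x - u x)) \<le> ?b t"
  proof (rule eventually_at_rightI[of 0 1])
    fix t :: real assume "t \<in> {0<..<1}"
    then have t: "0 \<le> t" by simp
    have "(\<lambda>x. exp (- (l * t)) * P t u x - u x) = (\<lambda>x. exp (- (l * t)) * (P t u x - u x) + (exp (- (l * t)) - 1) * u x)"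
      by (auto simp: algebra_simps)
    then have "Lp_norm 2 M (\<lambda>x. exp (- (l * t)) * P t u x - u x)
      \<le> Lp_norm 2 M (\<lambda>x. exp (- (l * t)) * (P t u x - u x)) + Lp_norm 2 M (\<lambda>x. (exp (- (l * t)) - 1) * u x)"
      using P_in[OF t u] u by (simp only:) (intro L2_norm_triangle L2_cmult L2_diff)
    then show "norm (Lp_norm 2 M (\<lambda>x. exp (- (l * t)) * P t u x - u x)) \<le> ?b t"
      unfolding L2_norm_cmult by (simp add: Lp_norm_nonneg)
  qed simp
  have "(?b \<longlongrightarrow> exp (- (l * 0)) * 0 + \<bar>exp (- (l * 0)) - 1\<bar> * Lp_norm 2 M u) (at_right 0)"
    by (intro tendsto_intros P_strong u)
  then show "(?b \<longlongrightarrow> 0) (at_right 0)" by simp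
qed

text \<open>By the shift identity the pairing with v is an average of <e^(-lt)P(t)u - u, v> over
  [0,h), for small h at most \<epsilon>/2 times the norm of v. The bound is uniform in v, so weak
  integrals still give convergence in norm.\<close>

lemma R_average_strong:
  assumes l: "w < l" and u: "u \<in> Lp 2 M"
  shows "((\<lambda>h. Lp_norm 2 M (\<lambda>x. (R l u x - exp (- (l * h)) * P h (R l u) x) / h - u x)) \<longlongrightarrow> 0) (at_right 0)"
proof (rule tendstoI)
  fix \<epsilon> :: real assume \<epsilon>: "0 < \<epsilon>"
  have "\<forall>\<^sub>F t in at_right 0. Lp_norm 2 M (\<lambda>x. exp (- (l * t)) * P t u x - u x) < \<epsilon> / 2"
    using P_scaled_strong[OF u] by (rule order_tendstoD) (use \<epsilon> in simp)
  then obtain d where d: "0 < d"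
    "\<And>t. 0 < t \<Longrightarrow> t < d \<Longrightarrow> Lp_norm 2 M (\<lambda>x. exp (- (l * t)) * P t u x - u x) < \<epsilon> / 2"
    unfolding eventually_at_right_field by auto
  have "Lp_norm 2 M (\<lambda>x. (R l u x - exp (- (l * h)) * P h (R l u) x) / h - u x) \<le> \<epsilon> / 2" if h: "0 < h" "h < d" for h
  proof (rule L2_norm_leI)
    have in': "R l u \<in> Lp 2 M" "P h (R l u) \<in> Lp 2 M" using l u h by (auto intro: R_in P_in)
    then show "(\<lambda>x. (R l u x - exp (- (l * h)) * P h (R l u) x) / h - u x) \<in> Lp 2 M"
      using u by (intro L2_diff L2_divide L2_cmult)
    fix v assume v: "v \<in> Lp 2 M"
    have "pairing M (\<lambda>x. (R l u x - exp (- (l * h)) * P h (R l u) x) / h - u x) v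
        = (pairing M (R l u) v - exp (- (l * h)) * pairing M (P h (R l u)) v) / h - pairing M u v"
      using in' u v by (simp add: pairing_linear L2_cmult L2_diff L2_divide)
    also have "\<dots> = laplace_part l h (\<lambda>t. pairing M (P t u) v) / h - pairing M u v"
      using P_R_pair_part[OF l u v, of h] h by simp
    also have "\<bar>\<dots>\<bar> \<le> \<epsilon> / 2 * Lp_norm 2 M v"
    proof (rule laplace_part_average[OF P_cont[OF u v] h(1)])
      fix t assume t: "0 \<le> t" "t < h"
      show "\<bar>exp (- (l * t)) * pairing M (P t u) v - pairing M u v\<bar> \<le> \<epsilon> / 2 * Lp_norm 2 M v"
      proof (cases "t = 0")
        case True
        then show ?thesis using u v \<epsilon> by (simp add: P_pair_0 Lp_measurable Lp_norm_nonneg)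
      next
        case False
        have "exp (- (l * t)) * pairing M (P t u) v - pairing M u v = pairing M (\<lambda>x. exp (- (l * t)) * P t u x - u x) v"
          using P_in[OF t(1) u] u v by (simp add: pairing_linear L2_cmult)
        also have "\<bar>\<dots>\<bar> \<le> Lp_norm 2 M (\<lambda>x. exp (- (l * t)) * P t u x - u x) * Lp_norm 2 M v"
          using P_in[OF t(1) u] u v by (intro L2_Cauchy_Schwarz L2_diff L2_cmult)
        also have "\<dots> \<le> \<epsilon> / 2 * Lp_norm 2 M v"
          using d(2)[of t] False t h by (intro mult_right_mono) (auto simp: Lp_norm_nonneg)
        finally show ?thesis .
      qed
    qed
    finally show "\<bar>pairing M (\<lambda>x. (R l u x - exp (- (l * h)) * P h (R l u) x) / h - u x) v\<bar> \<le> \<epsilon> / 2 * Lp_norm 2 M v" .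
  qed (use \<epsilon> in simp)
  then show "\<forall>\<^sub>F h in at_right 0. dist (Lp_norm 2 M (\<lambda>x. (R l u x - exp (- (l * h)) * P h (R l u) x) / h - u x)) 0 < \<epsilon>"
    unfolding eventually_at_right_field using d(1) \<epsilon> by (intro exI[of _ d]) (force simp: Lp_norm_nonneg)
qed

lemma R_generator:
  assumes l: "w < l" and u: "u \<in> Lp 2 M"
  shows "(R l u, \<lambda>x. l * R l u x - u x) \<in> generator_Lp 2 M P"
proof -
  have E: "R l u \<in> Lp 2 M" using l u by (rule R_in)
  let ?a = "\<lambda>h x. (R l u x - exp (- (l * h)) * P h (R l u) x) / h - u x"
  let ?n = "\<lambda>h. Lp_norm 2 M (\<lambda>x. (P h (R l u) x - R l u x) / h - (l * R l u x - u x))"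
  let ?b = "\<lambda>h. exp (l * h) * Lp_norm 2 M (?a h)
    + (\<bar>1 - exp (l * h)\<bar> * Lp_norm 2 M u + \<bar>(exp (l * h) - 1) / h - l\<bar> * Lp_norm 2 M (R l u))"
  have "(?n \<longlongrightarrow> 0) (at_right 0)"
  proof (rule Lim_null_comparison)
    show "\<forall>\<^sub>F h in at_right 0. norm (?n h) \<le> ?b h"
    proof (rule eventually_at_rightI[of 0 1])
      fix h :: real assume "h \<in> {0<..<1}"
      then have h: "0 < h" by simp
      have Ph: "P h (R l u) \<in> Lp 2 M" using h by (intro P_in E) simp
      \<comment> \<open>The averages (R(l)u - e^(-lh)P(h)R(l)u)/h are known to tend to u; what
        remains are multiples of u and R(l)u with vanishing coefficients.\<close>
      have "(P h (R l u) x - R l u x) / h - (l * R l u x - u x)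
        = - exp (l * h) * ?a h x + ((1 - exp (l * h)) * u x + ((exp (l * h) - 1) / h - l) * R l u x)" for x
      proof -
        have "exp (l * h) * (exp (- (l * h)) * P h (R l u) x) = P h (R l u) x"
          by (simp flip: mult.assoc exp_add)
        then show ?thesis using h by (simp add: field_simps)
      qed
      then have "?n h = Lp_norm 2 M (\<lambda>x. - exp (l * h) * ?a h x + ((1 - exp (l * h)) * u x + ((exp (l * h) - 1) / h - l) * R l u x))"
        by simp
      also have "\<dots> \<le> Lp_norm 2 M (\<lambda>x. - exp (l * h) * ?a h x)
          + Lp_norm 2 M (\<lambda>x. (1 - exp (l * h)) * u x + ((exp (l * h) - 1) / h - l) * R l u x)"
        using E u Ph by (intro L2_norm_triangle L2_cmult L2_diff L2_add L2_divide)
      also have "\<dots> \<le> Lp_norm 2 M (\<lambda>x. - exp (l * h) * ?a h x)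
          + (Lp_norm 2 M (\<lambda>x. (1 - exp (l * h)) * u x) + Lp_norm 2 M (\<lambda>x. ((exp (l * h) - 1) / h - l) * R l u x))"
        using E u by (intro add_left_mono L2_norm_triangle L2_cmult)
      finally show "norm (?n h) \<le> ?b h" unfolding L2_norm_cmult by (simp add: Lp_norm_nonneg)
    qed simp
    have "(?b \<longlongrightarrow> exp (l * 0) * 0 + (\<bar>1 - exp (l * 0)\<bar> * Lp_norm 2 M u + \<bar>l - l\<bar> * Lp_norm 2 M (R l u))) (at_right 0)"
      by (intro tendsto_intros R_average_strong l u exp_quotient_tendsto)
    then show "(?b \<longlongrightarrow> 0) (at_right 0)" by simp
  qed
  then show ?thesis using E u by (auto simp: generator_Lp_def intro: L2_diff[OF L2_cmult])
qed

lemma generator_subset_weak: "generator_Lp 2 M P \<subseteq> weak_generator M P"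
proof clarify
  fix u z assume "(u, z) \<in> generator_Lp 2 M P"
  then have uz: "u \<in> Lp 2 M" "z \<in> Lp 2 M"
    and lim: "((\<lambda>t. Lp_norm 2 M (\<lambda>x. (P t u x - u x) / t - z x)) \<longlongrightarrow> 0) (at_right 0)"
    by (auto simp: generator_Lp_def)
  have ev: "\<forall>\<^sub>F t in at_right 0. (\<lambda>x. (P t u x - u x) / t) \<in> Lp 2 M"
    using uz by (intro eventually_at_rightI[of 0 1]) (auto intro: L2_divide[OF L2_diff[OF P_in]])
  show "(u, z) \<in> weak_generator M P"
    using uz pairing_tendsto[OF ev uz(2) _ lim] by (auto simp: weak_generator_def pairing_commute)
qed

lemma generator_P:
  assumes uz: "(u, z) \<in> generator_Lp 2 M P" and r: "0 \<le> r"
  shows "(P r u, P r z) \<in> generator_Lp 2 M P"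
proof -
  have uz': "u \<in> Lp 2 M" "z \<in> Lp 2 M"
    and lim: "((\<lambda>t. Lp_norm 2 M (\<lambda>x. (P t u x - u x) / t - z x)) \<longlongrightarrow> 0) (at_right 0)"
    using uz by (auto simp: generator_Lp_def)
  have "((\<lambda>t. Lp_norm 2 M (\<lambda>x. (P t (P r u) x - P r u x) / t - P r z x)) \<longlongrightarrow> 0) (at_right 0)"
  proof (rule Lim_null_comparison)
    show "\<forall>\<^sub>F t in at_right 0. norm (Lp_norm 2 M (\<lambda>x. (P t (P r u) x - P r u x) / t - P r z x))
        \<le> K * exp (w * r) * Lp_norm 2 M (\<lambda>x. (P t u x - u x) / t - z x)"
    proof (rule eventually_at_rightI[of 0 1])
      fix t :: real assume "t \<in> {0<..<1}"
      then have t: "0 \<le> t" by simp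
      have Pt: "P t u \<in> Lp 2 M" "P r u \<in> Lp 2 M" "P t (P r u) \<in> Lp 2 M" using t r uz' by (auto intro: P_in)
      have d: "(\<lambda>x. P t u x - u x) \<in> Lp 2 M" using Pt uz' by auto
      \<comment> \<open>The quotient is written as a product with 1/t so that \<open>P_cmult\<close>
        applies to it literally.\<close>
      have q: "(\<lambda>x. 1 / t * (P t u x - u x)) \<in> Lp 2 M" using d by (rule L2_cmult)
      have "AE x in M. P r (\<lambda>x. 1 / t * (P t u x - u x) - z x) x = P r (\<lambda>x. 1 / t * (P t u x - u x)) x - P r z x"
        by (rule P_diff[OF r q uz'(2)])
      moreover have "AE x in M. P r (\<lambda>x. 1 / t * (P t u x - u x)) x = 1 / t * P r (\<lambda>x. P t u x - u x) x"
        by (rule P_cmult[OF r d])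
      moreover have "AE x in M. P r (\<lambda>x. P t u x - u x) x = P r (P t u) x - P r u x"
        by (rule P_diff[OF r Pt(1) uz'(1)])
      moreover have "AE x in M. P (r + t) u x = P r (P t u) x" by (rule P_plus[OF r t uz'(1)])
      moreover have "AE x in M. P (r + t) u x = P t (P r u) x"
        using P_plus[OF t r uz'(1)] by (simp add: add.commute)
      ultimately have "AE x in M. (P t (P r u) x - P r u x) / t - P r z x = P r (\<lambda>x. 1 / t * (P t u x - u x) - z x) x"
        by eventually_elim simp
      then have "Lp_norm 2 M (\<lambda>x. (P t (P r u) x - P r u x) / t - P r z x) = Lp_norm 2 M (P r (\<lambda>x. 1 / t * (P t u x - u x) - z x))"
        using Pt uz' q r t
        by (intro L2_norm_cong_AE) (auto intro!: borel_measurable_diff borel_measurable_divide P_meas L2_diff P_in intro: Lp_measurable[of _ 2])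
      also have "\<dots> \<le> K * exp (w * r) * Lp_norm 2 M (\<lambda>x. 1 / t * (P t u x - u x) - z x)"
        using q uz' r by (intro P_bound L2_diff)
      finally show "norm (Lp_norm 2 M (\<lambda>x. (P t (P r u) x - P r u x) / t - P r z x))
        \<le> K * exp (w * r) * Lp_norm 2 M (\<lambda>x. (P t u x - u x) / t - z x)"
        by (simp add: Lp_norm_nonneg)
    qed simp
    show "((\<lambda>t. K * exp (w * r) * Lp_norm 2 M (\<lambda>x. (P t u x - u x) / t - z x)) \<longlongrightarrow> 0) (at_right 0)"
      by (rule tendsto_mult_right_zero[OF lim])
  qed
  then show ?thesis using uz' r by (auto simp: generator_Lp_def intro: P_in)
qed

end

section \<open>Strong continuity on L1\<close>

lemma L1_norm_triangle:
  assumes "f \<in> Lp 1 M" "g \<in> Lp 1 M"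
  shows "Lp_norm 1 M (\<lambda>x. f x + g x) \<le> Lp_norm 1 M f + Lp_norm 1 M g"
proof -
  have "(\<integral>x. \<bar>f x + g x\<bar> \<partial>M) \<le> (\<integral>x. \<bar>f x\<bar> + \<bar>g x\<bar> \<partial>M)"
    using assms by (intro integral_mono) (auto simp: L1_iff)
  then show ?thesis using assms by (simp add: L1_norm L1_iff)
qed

lemma L1_norm_cmult: "Lp_norm 1 M (\<lambda>x. c * f x) = \<bar>c\<bar> * Lp_norm 1 M f"
  by (simp add: L1_norm abs_mult)

lemma L1_norm_minus_commute: "Lp_norm 1 M (\<lambda>x. f x - g x) = Lp_norm 1 M (\<lambda>x. g x - f x)"
  by (simp add: L1_norm abs_minus_commute)

lemma L1_norm_cong_AE:
  assumes "f \<in> borel_measurable M" "g \<in> borel_measurable M" "AE x in M. f x = g x"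
  shows "Lp_norm 1 M f = Lp_norm 1 M g"
  unfolding L1_norm using assms by (intro integral_cong_AE) auto

lemma L1_cmult: "f \<in> Lp 1 M \<Longrightarrow> (\<lambda>x. c * f x) \<in> Lp 1 M"
  by (simp add: L1_iff)

lemma L1_add: "f \<in> Lp 1 M \<Longrightarrow> g \<in> Lp 1 M \<Longrightarrow> (\<lambda>x. f x + g x) \<in> Lp 1 M"
  by (simp add: L1_iff)

lemma L1_diff: "f \<in> Lp 1 M \<Longrightarrow> g \<in> Lp 1 M \<Longrightarrow> (\<lambda>x. f x - g x) \<in> Lp 1 M"
  by (simp add: L1_iff)

lemma L1_norm_triangle_diff:
  assumes "f \<in> Lp 1 M" "g \<in> Lp 1 M"
  shows "Lp_norm 1 M (\<lambda>x. f x - g x) \<le> Lp_norm 1 M f + Lp_norm 1 M g"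
  using L1_norm_triangle[OF assms(1) L1_cmult[OF assms(2), of "-1"]] L1_norm_cmult[of M "-1" g] by simp

lemma L1_min: "f \<in> Lp 1 M \<Longrightarrow> g \<in> Lp 1 M \<Longrightarrow> (\<lambda>x. min (f x) (g x)) \<in> Lp 1 M"
  by (simp add: L1_iff)

lemma L1_max: "f \<in> Lp 1 M \<Longrightarrow> g \<in> Lp 1 M \<Longrightarrow> (\<lambda>x. max (f x) (g x)) \<in> Lp 1 M"
  by (simp add: L1_iff)

text \<open>Over the set where d is tiny the integral of d is small and bounds that of x(t); the
  rest has finite measure, so its indicator is in L_2 and Cauchy-Schwarz applies. This is dominated
  convergence along an arbitrary filter, with convergence in L_2 instead of pointwise
  limits.\<close>

lemma dominated_L2_tendsto_L1_tendsto:
  assumes ev: "\<forall>\<^sub>F t in F. x t \<in> Lp 2 M \<and> (AE y in M. \<bar>x t y\<bar> \<le> d y)"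
    and d: "d \<in> Lp 1 M" and lim: "((\<lambda>t. Lp_norm 2 M (x t)) \<longlongrightarrow> 0) F"
  shows "((\<lambda>t. Lp_norm 1 M (x t)) \<longlongrightarrow> 0) F"
proof (rule tendstoI)
  fix \<epsilon> :: real assume \<epsilon>: "0 < \<epsilon>"
  have di: "integrable M d" using d by (simp add: L1_iff)
  have dm [measurable]: "d \<in> borel_measurable M" using di by auto
  \<comment> \<open>The zero set of d stays inside every \<open>B n\<close> but contributes nothing;
    any other point leaves \<open>B n\<close> eventually, so the integral of |d| over
    \<open>B n\<close> tends to 0.\<close>
  define B where "B n = {y. \<bar>d y\<bar> < 1 / real (Suc n)}" for n
  have Bm [measurable]: "Measurable.pred M (\<lambda>y. y \<in> B n)" for n unfolding B_def by simp
  have "(\<lambda>n. \<integral>y. \<bar>d y\<bar> * indicator (B n) y \<partial>M) \<longlonglongrightarrow> (\<integral>y. 0 \<partial>M)"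
  proof (rule integral_dominated_convergence[where w = "\<lambda>y. \<bar>d y\<bar>"])
    show "AE y in M. (\<lambda>n. \<bar>d y\<bar> * indicator (B n) y) \<longlonglongrightarrow> 0"
    proof (rule AE_I2)
      fix y
      show "(\<lambda>n. \<bar>d y\<bar> * indicator (B n) y) \<longlonglongrightarrow> 0"
      proof (cases "d y = 0")
        case False
        then obtain m where m: "1 / real (Suc m) < \<bar>d y\<bar>"
          using reals_Archimedean[of "\<bar>d y\<bar>"] by (auto simp: inverse_eq_divide)
        have "\<bar>d y\<bar> * indicator (B n) y = 0" if "m \<le> n" for n
        proof -
          have "1 / real (Suc n) \<le> 1 / real (Suc m)" using that by (intro divide_left_mono) auto
          then have "y \<notin> B n" using m unfolding B_def mem_Collect_eq by linarith
          then show ?thesis by simp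
        qed
        then have "\<forall>\<^sub>F n in sequentially. \<bar>d y\<bar> * indicator (B n) y = 0"
          unfolding eventually_sequentially by blast
        then show ?thesis by (rule tendsto_eventually)
      qed simp
    qed
    show "AE y in M. norm (\<bar>d y\<bar> * indicator (B n) y) \<le> \<bar>d y\<bar>" for n
      by (auto simp: indicator_def)
  qed (use di in auto)
  then have "\<forall>\<^sub>F n in sequentially. (\<integral>y. \<bar>d y\<bar> * indicator (B n) y \<partial>M) < \<epsilon> / 2"
    using \<epsilon> by (intro order_tendstoD(2)) auto
  then obtain n where n: "(\<integral>y. \<bar>d y\<bar> * indicator (B n) y \<partial>M) < \<epsilon> / 2"
    by (auto simp: eventually_sequentially)
  define I where "I y = (1 - indicator (B n) y :: real)" for y
  have Im [measurable]: "I \<in> borel_measurable M" unfolding I_def by measurable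
  have I: "I \<in> Lp 2 M"
    unfolding L2_iff
  proof (intro conjI Im, rule Bochner_Integration.integrable_bound)
    show "integrable M (\<lambda>y. real (Suc n) * d y)" using di by simp
    show "AE y in M. norm (I y * I y) \<le> norm (real (Suc n) * d y)"
    proof (rule AE_I2)
      fix y
      show "norm (I y * I y) \<le> norm (real (Suc n) * d y)"
      proof (cases "y \<in> B n")
        case False
        then have "1 / real (Suc n) \<le> \<bar>d y\<bar>" by (simp add: B_def)
        then have "1 \<le> real (Suc n) * \<bar>d y\<bar>" by (simp add: field_simps)
        then show ?thesis using False by (simp add: I_def abs_mult)
      qed (simp add: I_def)
    qed
  qed simp
  have "((\<lambda>t. Lp_norm 2 M (x t) * Lp_norm 2 M I) \<longlongrightarrow> 0) F"
    using tendsto_mult_left_zero[OF lim] .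
  then have "\<forall>\<^sub>F t in F. Lp_norm 2 M (x t) * Lp_norm 2 M I < \<epsilon> / 2"
    using \<epsilon> by (intro order_tendstoD(2)) auto
  then show "\<forall>\<^sub>F t in F. dist (Lp_norm 1 M (x t)) 0 < \<epsilon>"
    using ev
  proof eventually_elim
    case (elim t)
    then have xt: "x t \<in> Lp 2 M" "(\<lambda>y. \<bar>x t y\<bar>) \<in> Lp 2 M" by auto
    have xm [measurable]: "x t \<in> borel_measurable M" using xt(1) Lp_measurable by blast
    have "integrable M (x t)"
    proof (rule Bochner_Integration.integrable_bound[OF di xm])
      show "AE y in M. norm (x t y) \<le> norm (d y)"
        using elim(2) by (auto elim: eventually_mono)
    qed
    moreover have i1: "integrable M (\<lambda>y. \<bar>d y\<bar> * indicator (B n) y)"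
      by (rule Bochner_Integration.integrable_bound[OF di]) (auto simp: indicator_def)
    moreover have i2: "integrable M (\<lambda>y. \<bar>x t y\<bar> * I y)" by (rule L2_mult_integrable[OF xt(2) I])
    moreover have "AE y in M. \<bar>x t y\<bar> \<le> \<bar>d y\<bar> * indicator (B n) y + \<bar>x t y\<bar> * I y"
      using conjunct2[OF elim(2)] by eventually_elim (auto simp: I_def indicator_def)
    ultimately have "(\<integral>y. \<bar>x t y\<bar> \<partial>M) \<le> (\<integral>y. \<bar>d y\<bar> * indicator (B n) y + \<bar>x t y\<bar> * I y \<partial>M)"
      by (intro integral_mono_AE) auto
    also have "\<dots> = (\<integral>y. \<bar>d y\<bar> * indicator (B n) y \<partial>M) + pairing M (\<lambda>y. \<bar>x t y\<bar>) I"
      unfolding pairing_def by (rule Bochner_Integration.integral_add[OF i1 i2])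
    finally have "(\<integral>y. \<bar>x t y\<bar> \<partial>M)
        \<le> (\<integral>y. \<bar>d y\<bar> * indicator (B n) y \<partial>M) + pairing M (\<lambda>y. \<bar>x t y\<bar>) I" .
    moreover have "pairing M (\<lambda>y. \<bar>x t y\<bar>) I \<le> Lp_norm 2 M (x t) * Lp_norm 2 M I"
      using L2_Cauchy_Schwarz[OF xt(2) I] by (simp add: L2_norm_eq pairing_def)
    moreover have "0 \<le> (\<integral>y. \<bar>x t y\<bar> \<partial>M)" by simp
    ultimately have "\<bar>\<integral>y. \<bar>x t y\<bar> \<partial>M\<bar> < \<epsilon>" using n elim(1) by linarith
    then show ?case by (simp add: L1_norm)
  qed
qed

section \<open>Supermedian functions and continuity of orbits in L_1\<close>

context strong_L2_semigroup
begin

text \<open>The potential-theoretic notion for e^(-lt)P(t). Membership in L_1 is built in, so that e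
  itself can serve as the dominating function.\<close>

definition supermedian :: "real \<Rightarrow> ('a \<Rightarrow> real) \<Rightarrow> bool" where
  "supermedian l e \<longleftrightarrow> e \<in> Lp 2 M \<and> e \<in> Lp 1 M \<and> nonneg_ae M e \<and>
     (\<forall>t\<ge>0. AE x in M. exp (- (l * t)) * P t e x \<le> e x)"

definition L1_continuous :: "('a \<Rightarrow> real) \<Rightarrow> bool" where
  "L1_continuous v \<longleftrightarrow> v \<in> Lp 2 M \<and> v \<in> Lp 1 M \<and>
     ((\<lambda>t. Lp_norm 1 M (\<lambda>x. P t v x - v x)) \<longlongrightarrow> 0) (at_right 0)"

lemma supermedian_add:
  assumes "supermedian l e" "supermedian l f"
  shows "supermedian l (\<lambda>x. e x + f x)"
proof -
  have "AE x in M. exp (- (l * t)) * P t (\<lambda>y. e y + f y) x \<le> e x + f x" if t: "0 \<le> t" for t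
  proof -
    have "AE x in M. P t (\<lambda>y. e y + f y) x = P t e x + P t f x"
      using assms t by (intro P_add) (auto simp: supermedian_def)
    moreover have "AE x in M. exp (- (l * t)) * P t e x \<le> e x" "AE x in M. exp (- (l * t)) * P t f x \<le> f x"
      using assms t by (auto simp: supermedian_def)
    ultimately show ?thesis by eventually_elim (simp add: distrib_left)
  qed
  moreover have "nonneg_ae M (\<lambda>x. e x + f x)"
    using assms unfolding supermedian_def nonneg_ae_def by (auto elim: eventually_elim2)
  ultimately show ?thesis using assms by (auto simp: supermedian_def intro: L1_add)
qed

lemma supermedian_cmult:
  assumes "supermedian l e" and c: "0 \<le> c"
  shows "supermedian l (\<lambda>x. c * e x)"
proof -
  have "AE x in M. exp (- (l * t)) * P t (\<lambda>y. c * e y) x \<le> c * e x" if t: "0 \<le> t" for t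
  proof -
    have "AE x in M. P t (\<lambda>y. c * e y) x = c * P t e x"
      using assms t by (intro P_cmult) (auto simp: supermedian_def)
    moreover have "AE x in M. exp (- (l * t)) * P t e x \<le> e x"
      using assms t by (auto simp: supermedian_def)
    ultimately show ?thesis
    proof eventually_elim
      case (elim x)
      then show ?case using mult_left_mono[OF elim(2) c] by (simp add: mult_ac)
    qed
  qed
  moreover have "nonneg_ae M (\<lambda>x. c * e x)"
    using assms unfolding supermedian_def nonneg_ae_def by (auto elim: eventually_mono)
  ultimately show ?thesis using assms by (auto simp: supermedian_def intro: L1_cmult)
qed

text \<open>P(t) is monotone, so P(t) of the minimum lies below both P(t)e and P(t)f.\<close>

lemma supermedian_min:
  assumes "supermedian l e" "supermedian l f"
  shows "supermedian l (\<lambda>x. min (e x) (f x))"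
proof -
  have ef: "e \<in> Lp 2 M" "f \<in> Lp 2 M" using assms by (auto simp: supermedian_def)
  have "AE x in M. exp (- (l * t)) * P t (\<lambda>y. min (e y) (f y)) x \<le> min (e x) (f x)" if t: "0 \<le> t" for t
  proof -
    have "AE x in M. P t (\<lambda>y. min (e y) (f y)) x \<le> P t e x"
      using ef t by (intro P_mono) auto
    moreover have "AE x in M. P t (\<lambda>y. min (e y) (f y)) x \<le> P t f x"
      using ef t by (intro P_mono) auto
    moreover have "AE x in M. exp (- (l * t)) * P t e x \<le> e x" "AE x in M. exp (- (l * t)) * P t f x \<le> f x"
      using assms t by (auto simp: supermedian_def)
    ultimately show ?thesis
    proof eventually_elim
      case (elim x)
      have "exp (- (l * t)) * P t (\<lambda>y. min (e y) (f y)) x \<le> exp (- (l * t)) * P t e x"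
        "exp (- (l * t)) * P t (\<lambda>y. min (e y) (f y)) x \<le> exp (- (l * t)) * P t f x"
        using elim by (auto intro: mult_left_mono)
      then show ?case using elim by linarith
    qed
  qed
  moreover have "nonneg_ae M (\<lambda>x. min (e x) (f x))"
    using assms unfolding supermedian_def nonneg_ae_def by (auto elim: eventually_elim2)
  ultimately show ?thesis using assms by (auto simp: supermedian_def intro: L1_min)
qed

lemma L1_continuous_cmult:
  assumes "L1_continuous v"
  shows "L1_continuous (\<lambda>x. c * v x)"
proof -
  have v: "v \<in> Lp 2 M" "v \<in> Lp 1 M" using assms by (auto simp: L1_continuous_def)
  have "((\<lambda>t. Lp_norm 1 M (\<lambda>x. P t (\<lambda>y. c * v y) x - c * v x)) \<longlongrightarrow> 0) (at_right 0)"
  proof (rule Lim_transform_eventually)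
    show "((\<lambda>t. \<bar>c\<bar> * Lp_norm 1 M (\<lambda>x. P t v x - v x)) \<longlongrightarrow> 0) (at_right 0)"
      using assms by (intro tendsto_mult_right_zero) (auto simp: L1_continuous_def)
    show "\<forall>\<^sub>F t in at_right 0. \<bar>c\<bar> * Lp_norm 1 M (\<lambda>x. P t v x - v x) = Lp_norm 1 M (\<lambda>x. P t (\<lambda>y. c * v y) x - c * v x)"
    proof (rule eventually_at_rightI[of 0 1])
      fix t :: real assume "t \<in> {0<..<1}"
      then have t: "0 \<le> t" by simp
      have m [measurable]: "v \<in> borel_measurable M" "P t v \<in> borel_measurable M" "P t (\<lambda>y. c * v y) \<in> borel_measurable M"
        using v t by (auto intro: P_meas Lp_measurable)
      have "Lp_norm 1 M (\<lambda>x. P t (\<lambda>y. c * v y) x - c * v x) = Lp_norm 1 M (\<lambda>x. c * (P t v x - v x))"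
      proof (rule L1_norm_cong_AE)
        show "AE x in M. P t (\<lambda>y. c * v y) x - c * v x = c * (P t v x - v x)"
          using P_cmult[OF t v(1), of c] by eventually_elim (simp add: algebra_simps)
      qed measurable
      then show "\<bar>c\<bar> * Lp_norm 1 M (\<lambda>x. P t v x - v x) = Lp_norm 1 M (\<lambda>x. P t (\<lambda>y. c * v y) x - c * v x)"
        by (simp only: L1_norm_cmult)
    qed simp
  qed
  then show ?thesis using v by (auto simp: L1_continuous_def intro: L1_cmult)
qed

context
  fixes K\<^sub>1 w\<^sub>1 :: real
  assumes acts: "\<And>u t. u \<in> Lp 2 M \<Longrightarrow> u \<in> Lp 1 M \<Longrightarrow> 0 \<le> t \<Longrightarrow>
      P t u \<in> Lp 1 M \<and> Lp_norm 1 M (P t u) \<le> K\<^sub>1 * exp (w\<^sub>1 * t) * Lp_norm 1 M u"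
    and K\<^sub>1: "0 \<le> K\<^sub>1"
begin

lemma supermedian_L1_continuous:
  assumes e: "supermedian l e"
  shows "L1_continuous e"
proof -
  have eL: "e \<in> Lp 2 M" "e \<in> Lp 1 M" and e0: "nonneg_ae M e"
    using e by (auto simp: supermedian_def)
  let ?x = "\<lambda>t x. exp (- (l * t)) * P t e x - e x"
  have "((\<lambda>t. Lp_norm 1 M (?x t)) \<longlongrightarrow> 0) (at_right 0)"
  proof (rule dominated_L2_tendsto_L1_tendsto[OF _ eL(2) P_scaled_strong[OF eL(1)]])
    show "\<forall>\<^sub>F t in at_right 0. ?x t \<in> Lp 2 M \<and> (AE y in M. \<bar>?x t y\<bar> \<le> e y)"
    proof (rule eventually_at_rightI[of 0 1])
      fix t :: real assume "t \<in> {0<..<1}"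
      then have t: "0 \<le> t" by simp
      have "AE y in M. exp (- (l * t)) * P t e y \<le> e y" using e t by (auto simp: supermedian_def)
      moreover have "AE y in M. 0 \<le> P t e y" using P_pos[OF t eL(1) e0] by (simp add: nonneg_ae_def)
      ultimately have "AE y in M. \<bar>?x t y\<bar> \<le> e y"
      proof eventually_elim
        case (elim y)
        have "0 \<le> exp (- (l * t)) * P t e y" using elim(2) by simp
        then show ?case using elim(1) by simp
      qed
      moreover have "?x t \<in> Lp 2 M" using P_in[OF t eL(1)] eL(1) by (intro L2_diff L2_cmult)
      ultimately show "?x t \<in> Lp 2 M \<and> (AE y in M. \<bar>?x t y\<bar> \<le> e y)" by blast
    qed simp
  qed
  \<comment> \<open>Convergence is known for e^(-lt)P(t)e; undoing the factor costs the second term,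
    a multiple of the norm of e with vanishing coefficient.\<close>
  then have "((\<lambda>t. exp (l * t) * Lp_norm 1 M (?x t) + \<bar>exp (l * t) - 1\<bar> * Lp_norm 1 M e)
      \<longlongrightarrow> exp (l * 0) * 0 + \<bar>exp (l * 0) - 1\<bar> * Lp_norm 1 M e) (at_right 0)"
    by (intro tendsto_intros)
  then have lim: "((\<lambda>t. exp (l * t) * Lp_norm 1 M (?x t) + \<bar>exp (l * t) - 1\<bar> * Lp_norm 1 M e) \<longlongrightarrow> 0) (at_right 0)"
    by simp
  have "((\<lambda>t. Lp_norm 1 M (\<lambda>x. P t e x - e x)) \<longlongrightarrow> 0) (at_right 0)"
  proof (rule Lim_null_comparison[OF _ lim])
    show "\<forall>\<^sub>F t in at_right 0. norm (Lp_norm 1 M (\<lambda>x. P t e x - e x))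
        \<le> exp (l * t) * Lp_norm 1 M (?x t) + \<bar>exp (l * t) - 1\<bar> * Lp_norm 1 M e"
    proof (rule eventually_at_rightI[of 0 1])
      fix t :: real assume "t \<in> {0<..<1}"
      then have t: "0 \<le> t" by simp
      have P1: "P t e \<in> Lp 1 M" using acts[OF eL t] by blast
      have eq: "(\<lambda>x. P t e x - e x) = (\<lambda>x. exp (l * t) * ?x t x + (exp (l * t) - 1) * e x)"
      proof
        fix x
        have "exp (l * t) * (exp (- (l * t)) * P t e x) = P t e x" by (simp flip: mult.assoc exp_add)
        then show "P t e x - e x = exp (l * t) * ?x t x + (exp (l * t) - 1) * e x"
          by (simp add: algebra_simps)
      qed
      have "Lp_norm 1 M (\<lambda>x. P t e x - e x)
          \<le> Lp_norm 1 M (\<lambda>x. exp (l * t) * ?x t x) + Lp_norm 1 M (\<lambda>x. (exp (l * t) - 1) * e x)"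
        unfolding eq using P1 eL by (intro L1_norm_triangle L1_cmult L1_diff)
      then show "norm (Lp_norm 1 M (\<lambda>x. P t e x - e x))
        \<le> exp (l * t) * Lp_norm 1 M (?x t) + \<bar>exp (l * t) - 1\<bar> * Lp_norm 1 M e"
        unfolding L1_norm_cmult by (simp add: Lp_norm_nonneg)
    qed simp
  qed
  then show ?thesis using eL by (simp add: L1_continuous_def)
qed

lemma L1_continuous_diff:
  assumes "L1_continuous u" "L1_continuous v"
  shows "L1_continuous (\<lambda>x. u x - v x)"
proof -
  have uv: "u \<in> Lp 2 M" "u \<in> Lp 1 M" "v \<in> Lp 2 M" "v \<in> Lp 1 M" using assms by (auto simp: L1_continuous_def)
  have lim: "((\<lambda>t. Lp_norm 1 M (\<lambda>x. P t u x - u x) + Lp_norm 1 M (\<lambda>x. P t v x - v x)) \<longlongrightarrow> 0) (at_right 0)"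
    using assms unfolding L1_continuous_def by (intro tendsto_add_zero) auto
  have "((\<lambda>t. Lp_norm 1 M (\<lambda>x. P t (\<lambda>y. u y - v y) x - (u x - v x))) \<longlongrightarrow> 0) (at_right 0)"
  proof (rule Lim_null_comparison[OF _ lim])
    show "\<forall>\<^sub>F t in at_right 0. norm (Lp_norm 1 M (\<lambda>x. P t (\<lambda>y. u y - v y) x - (u x - v x)))
        \<le> Lp_norm 1 M (\<lambda>x. P t u x - u x) + Lp_norm 1 M (\<lambda>x. P t v x - v x)"
    proof (rule eventually_at_rightI[of 0 1])
      fix t :: real assume "t \<in> {0<..<1}"
      then have t: "0 \<le> t" by simp
      have i: "P t u \<in> Lp 1 M" "P t v \<in> Lp 1 M" using acts uv t by auto
      have d: "(\<lambda>y. u y - v y) \<in> Lp 2 M" using uv by auto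
      have m [measurable]: "u \<in> borel_measurable M" "v \<in> borel_measurable M"
        "P t u \<in> borel_measurable M" "P t v \<in> borel_measurable M" "P t (\<lambda>y. u y - v y) \<in> borel_measurable M"
        using uv t d by (auto intro: P_meas Lp_measurable)
      have "Lp_norm 1 M (\<lambda>x. P t (\<lambda>y. u y - v y) x - (u x - v x)) = Lp_norm 1 M (\<lambda>x. (P t u x - u x) - (P t v x - v x))"
      proof (rule L1_norm_cong_AE)
        show "AE x in M. P t (\<lambda>y. u y - v y) x - (u x - v x) = (P t u x - u x) - (P t v x - v x)"
          using P_diff[OF t uv(1,3)] by eventually_elim simp
      qed measurable
      also have "\<dots> \<le> Lp_norm 1 M (\<lambda>x. P t u x - u x) + Lp_norm 1 M (\<lambda>x. P t v x - v x)"
        using uv i by (intro L1_norm_triangle_diff L1_diff)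
      finally show "norm (Lp_norm 1 M (\<lambda>x. P t (\<lambda>y. u y - v y) x - (u x - v x)))
        \<le> Lp_norm 1 M (\<lambda>x. P t u x - u x) + Lp_norm 1 M (\<lambda>x. P t v x - v x)"
        by (simp add: Lp_norm_nonneg)
    qed simp
  qed
  then show ?thesis using uv by (auto simp: L1_continuous_def intro: L1_diff)
qed

lemma L1_continuous_closed:
  assumes u: "u \<in> Lp 2 M" "u \<in> Lp 1 M"
    and approx: "\<And>\<epsilon>. 0 < \<epsilon> \<Longrightarrow> \<exists>v. L1_continuous v \<and> Lp_norm 1 M (\<lambda>x. v x - u x) < \<epsilon>"
  shows "L1_continuous u"
proof -
  have "((\<lambda>t. Lp_norm 1 M (\<lambda>x. P t u x - u x)) \<longlongrightarrow> 0) (at_right 0)"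
  proof (rule tendstoI)
    fix \<epsilon> :: real assume \<epsilon>: "0 < \<epsilon>"
    \<comment> \<open>For t \<le> 1 the factor \<open>K\<^sub>1 * exp \<bar>w\<^sub>1\<bar>\<close>
      bounds P(t) on v - u; the 1 accounts for v - u itself.\<close>
    define C where "C = K\<^sub>1 * exp \<bar>w\<^sub>1\<bar> + 1"
    have C: "1 \<le> C" using K\<^sub>1 by (simp add: C_def)
    obtain v where v: "L1_continuous v" and vu: "Lp_norm 1 M (\<lambda>x. v x - u x) < \<epsilon> / (2 * C)"
      using approx[of "\<epsilon> / (2 * C)"] \<epsilon> C by auto
    have vL: "v \<in> Lp 2 M" "v \<in> Lp 1 M" using v by (auto simp: L1_continuous_def)
    have "\<forall>\<^sub>F t in at_right 0. Lp_norm 1 M (\<lambda>x. P t v x - v x) < \<epsilon> / 2"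
      using v \<epsilon> unfolding L1_continuous_def by (intro order_tendstoD(2)) auto
    moreover have "\<forall>\<^sub>F t in at_right 0. t \<in> {0<..<(1::real)}"
      by (rule eventually_at_rightI[of 0 1]) auto
    ultimately show "\<forall>\<^sub>F t in at_right 0. dist (Lp_norm 1 M (\<lambda>x. P t u x - u x)) 0 < \<epsilon>"
    proof eventually_elim
      case (elim t)
      then have t: "0 \<le> t" "t \<le> 1" by auto
      have i: "P t u \<in> Lp 1 M" "P t v \<in> Lp 1 M" using acts u vL t by auto
      have d: "(\<lambda>y. v y - u y) \<in> Lp 2 M" "(\<lambda>y. v y - u y) \<in> Lp 1 M" using u vL by (auto intro: L1_diff)
      have Pd: "P t (\<lambda>y. v y - u y) \<in> Lp 1 M" using acts[OF d t(1)] by blast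
      have m [measurable]: "u \<in> borel_measurable M" "v \<in> borel_measurable M"
        "P t u \<in> borel_measurable M" "P t v \<in> borel_measurable M" "P t (\<lambda>y. v y - u y) \<in> borel_measurable M"
        using u vL t d by (auto intro: P_meas Lp_measurable)
      have "Lp_norm 1 M (\<lambda>x. P t u x - u x)
          = Lp_norm 1 M (\<lambda>x. ((P t v x - v x) - P t (\<lambda>y. v y - u y) x) + (v x - u x))"
      proof (rule L1_norm_cong_AE)
        show "AE x in M. P t u x - u x = ((P t v x - v x) - P t (\<lambda>y. v y - u y) x) + (v x - u x)"
          using P_diff[OF t(1) vL(1) u(1)] by eventually_elim simp
      qed measurable
      also have "\<dots> \<le> Lp_norm 1 M (\<lambda>x. (P t v x - v x) - P t (\<lambda>y. v y - u y) x) + Lp_norm 1 M (\<lambda>x. v x - u x)"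
        using i Pd vL u by (intro L1_norm_triangle L1_diff)
      finally have "Lp_norm 1 M (\<lambda>x. P t u x - u x)
          \<le> Lp_norm 1 M (\<lambda>x. (P t v x - v x) - P t (\<lambda>y. v y - u y) x) + Lp_norm 1 M (\<lambda>x. v x - u x)" .
      moreover have "Lp_norm 1 M (\<lambda>x. (P t v x - v x) - P t (\<lambda>y. v y - u y) x)
          \<le> Lp_norm 1 M (\<lambda>x. P t v x - v x) + Lp_norm 1 M (P t (\<lambda>y. v y - u y))"
        using i Pd vL by (intro L1_norm_triangle_diff L1_diff)
      moreover have "Lp_norm 1 M (P t (\<lambda>y. v y - u y)) \<le> K\<^sub>1 * exp \<bar>w\<^sub>1\<bar> * Lp_norm 1 M (\<lambda>x. v x - u x)"
      proof -
        have "w\<^sub>1 * t \<le> \<bar>w\<^sub>1\<bar> * 1" using t by (intro mult_mono) auto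
        then have "K\<^sub>1 * exp (w\<^sub>1 * t) * Lp_norm 1 M (\<lambda>x. v x - u x) \<le> K\<^sub>1 * exp \<bar>w\<^sub>1\<bar> * Lp_norm 1 M (\<lambda>x. v x - u x)"
          using K\<^sub>1 by (intro mult_right_mono mult_left_mono) (auto simp: Lp_norm_nonneg)
        then show ?thesis using acts[OF d t(1)] by linarith
      qed
      ultimately have "Lp_norm 1 M (\<lambda>x. P t u x - u x)
          \<le> Lp_norm 1 M (\<lambda>x. P t v x - v x) + C * Lp_norm 1 M (\<lambda>x. v x - u x)"
        unfolding C_def distrib_right mult_1_left by linarith
      moreover have "C * Lp_norm 1 M (\<lambda>x. v x - u x) < \<epsilon> / 2"
        using vu C by (simp add: field_simps)
      ultimately show ?case using elim by (simp add: Lp_norm_nonneg)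
    qed
  qed
  then show ?thesis using u by (simp add: L1_continuous_def)
qed

text \<open>The defect R(l)u - e^(-lt)P(t)R(l)u is, in every pairing with a nonnegative v, an
  integral of nonnegative terms over [0,t).\<close>

lemma supermedian_R:
  assumes l: "w < l" and u: "u \<in> Lp 2 M" "nonneg_ae M u" and R1: "R l u \<in> Lp 1 M"
  shows "supermedian l (R l u)"
proof -
  have E: "R l u \<in> Lp 2 M" using l u by (intro R_in)
  have "AE x in M. exp (- (l * t)) * P t (R l u) x \<le> R l u x" if t: "0 \<le> t" for t
  proof (rule L2_leI)
    fix v assume v: "v \<in> Lp 2 M" "nonneg_ae M v"
    have "0 \<le> laplace_part l t (\<lambda>t. pairing M (P t u) v)"
      using u v by (intro laplace_part_nonneg pairing_nonneg P_pos)
    then show "pairing M (\<lambda>x. exp (- (l * t)) * P t (R l u) x) v \<le> pairing M (R l u) v"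
      using P_R_pair_part[OF l u(1) v(1) t] by (simp add: pairing_linear)
  qed (use E t in \<open>auto intro: L2_cmult[OF P_in]\<close>)
  then show ?thesis using E R1 R_nonneg[OF l u] by (auto simp: supermedian_def)
qed

lemma supermedian_P:
  assumes e: "supermedian l e" and h: "0 \<le> h"
  shows "supermedian l (\<lambda>x. exp (- (l * h)) * P h e x)"
proof -
  have eL: "e \<in> Lp 2 M" "e \<in> Lp 1 M" and e0: "nonneg_ae M e"
    using e by (auto simp: supermedian_def)
  have Ph: "P h e \<in> Lp 2 M" by (rule P_in[OF h eL(1)])
  have "AE x in M. exp (- (l * t)) * P t (P h e) x \<le> P h e x" if t: "0 \<le> t" for t
  proof -
    have Pt: "P t e \<in> Lp 2 M" by (rule P_in[OF t eL(1)])
    have "AE x in M. exp (- (l * t)) * P t e x \<le> e x" using e t by (auto simp: supermedian_def)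
    then have "AE x in M. P h (\<lambda>y. exp (- (l * t)) * P t e y) x \<le> P h e x"
      using Pt eL h by (intro P_mono L2_cmult)
    moreover have "AE x in M. P h (\<lambda>y. exp (- (l * t)) * P t e y) x = exp (- (l * t)) * P h (P t e) x"
      by (rule P_cmult[OF h Pt])
    moreover have "AE x in M. P (t + h) e x = P t (P h e) x" by (rule P_plus[OF t h eL(1)])
    moreover have "AE x in M. P (t + h) e x = P h (P t e) x"
      using P_plus[OF h t eL(1)] by (simp add: add.commute)
    ultimately show ?thesis by eventually_elim simp
  qed
  moreover have "P h e \<in> Lp 1 M" using acts[OF eL h] by blast
  ultimately have "supermedian l (P h e)"
    using Ph P_pos[OF h eL(1) e0] by (auto simp: supermedian_def)
  then show ?thesis by (rule supermedian_cmult) simp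
qed

text \<open>The quotients (E - E_h)/h are known to tend to u in L_2; truncating them by cE supplies
  the integrable bound that turns this into convergence in L_1. Membership of E in L_1 is a
  hypothesis here because it comes from duality, which is treated later for all exponents at
  once.\<close>

lemma L1_continuous_nonneg:
  assumes l: "w < l" and u: "u \<in> Lp 2 M" "u \<in> Lp 1 M" "nonneg_ae M u" and R1: "R l u \<in> Lp 1 M"
  shows "L1_continuous u"
proof -
  define E where "E = R l u"
  have E: "E \<in> Lp 2 M" "E \<in> Lp 1 M" "nonneg_ae M E"
    unfolding E_def using l u R1 by (auto intro: R_in R_nonneg)
  have um [measurable]: "u \<in> borel_measurable M" and Em [measurable]: "E \<in> borel_measurable M"
    using u E Lp_measurable by blast+
  have supE: "supermedian l E" unfolding E_def by (rule supermedian_R[OF l u(1,3) R1])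
  define Eh where "Eh h x = exp (- (l * h)) * P h E x" for h x
  have Eh: "Eh h \<in> Lp 2 M" "nonneg_ae M (Eh h)" "AE x in M. Eh h x \<le> E x" "supermedian l (Eh h)" if "0 \<le> h" for h
  proof -
    show s: "supermedian l (Eh h)" unfolding Eh_def using supE that by (rule supermedian_P)
    then show "Eh h \<in> Lp 2 M" "nonneg_ae M (Eh h)" by (auto simp: supermedian_def)
    show "AE x in M. Eh h x \<le> E x" unfolding Eh_def using supE that by (auto simp: supermedian_def)
  qed
  define W where "W h x = (E x - Eh h x) / h" for h x
  have W: "W h \<in> Lp 2 M" if "0 \<le> h" for h unfolding W_def using E Eh(1)[OF that] by (intro L2_divide L2_diff)
  have Wlim: "((\<lambda>h. Lp_norm 2 M (\<lambda>x. W h x - u x)) \<longlongrightarrow> 0) (at_right 0)"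
    unfolding W_def Eh_def E_def by (rule R_average_strong[OF l u(1)])
  have trunc: "L1_continuous (\<lambda>x. min (u x) (c * E x))" if c: "0 \<le> c" for c
  proof (rule L1_continuous_closed)
    show "(\<lambda>x. min (u x) (c * E x)) \<in> Lp 2 M" using u E by auto
    show "(\<lambda>x. min (u x) (c * E x)) \<in> Lp 1 M" using u E by (intro L1_min L1_cmult)
    fix \<epsilon> :: real assume \<epsilon>: "0 < \<epsilon>"
    let ?y = "\<lambda>h x. min (W h x) (c * E x)"
    let ?d = "\<lambda>h x. ?y h x - min (u x) (c * E x)"
    have "((\<lambda>h. Lp_norm 1 M (?d h)) \<longlongrightarrow> 0) (at_right 0)"
    proof (rule dominated_L2_tendsto_L1_tendsto)
      show "(\<lambda>x. c * E x) \<in> Lp 1 M" using E by (intro L1_cmult)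
      show "\<forall>\<^sub>F h in at_right 0. ?d h \<in> Lp 2 M \<and> (AE x in M. \<bar>?d h x\<bar> \<le> c * E x)"
      proof (rule eventually_at_rightI[of 0 1])
        fix h :: real assume "h \<in> {0<..<1}"
        then have h: "0 < h" "0 \<le> h" by auto
        have "AE x in M. \<bar>?d h x\<bar> \<le> c * E x"
          using Eh(3)[OF h(2)] u(3) E(3) unfolding nonneg_ae_def
        proof eventually_elim
          case (elim x)
          have "0 \<le> W h x" using elim h by (simp add: W_def)
          moreover have "0 \<le> c * E x" using elim c by simp
          ultimately show ?case using elim by linarith
        qed
        then show "?d h \<in> Lp 2 M \<and> (AE x in M. \<bar>?d h x\<bar> \<le> c * E x)"
          using W[OF h(2)] E u by (auto intro!: L2_diff L2_min L2_cmult)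
      qed simp
      show "((\<lambda>h. Lp_norm 2 M (?d h)) \<longlongrightarrow> 0) (at_right 0)"
      proof (rule Lim_null_comparison[OF _ Wlim])
        show "\<forall>\<^sub>F h in at_right 0. norm (Lp_norm 2 M (?d h)) \<le> Lp_norm 2 M (\<lambda>x. W h x - u x)"
        proof (rule eventually_at_rightI[of 0 1])
          fix h :: real assume "h \<in> {0<..<1}"
          then have h: "0 \<le> h" by auto
          have "Lp_norm 2 M (?d h) \<le> Lp_norm 2 M (\<lambda>x. W h x - u x)"
          proof (rule L2_norm_mono)
            have "?d h \<in> Lp 2 M" using W[OF h] E u by (intro L2_diff L2_min L2_cmult)
            then show "?d h \<in> borel_measurable M" by (rule Lp_measurable)
            have "\<bar>min a k - min b k\<bar> \<le> \<bar>a - b\<bar>" for a b k :: real by linarith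
            then show "AE x in M. \<bar>?d h x\<bar> \<le> \<bar>W h x - u x\<bar>" by blast
          qed (use W[OF h] u in auto)
          then show "norm (Lp_norm 2 M (?d h)) \<le> Lp_norm 2 M (\<lambda>x. W h x - u x)"
            by (simp add: Lp_norm_nonneg)
        qed simp
      qed
    qed
    then have "\<forall>\<^sub>F h in at_right 0. Lp_norm 1 M (?d h) < \<epsilon>" using \<epsilon> by (rule order_tendstoD(2))
    then obtain b where "0 < b" "\<And>h. 0 < h \<Longrightarrow> h < b \<Longrightarrow> Lp_norm 1 M (?d h) < \<epsilon>"
      unfolding eventually_at_right_field by auto
    then obtain h where h: "0 < h" "Lp_norm 1 M (?d h) < \<epsilon>" by (meson dense)
    have sup: "supermedian l (\<lambda>x. min (E x) ((h * c) * E x + Eh h x))"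
      using supE Eh(4)[of h] h c by (intro supermedian_min supermedian_add supermedian_cmult) auto
    \<comment> \<open>Multiplying by h and adding E_h turns the minimum of (E - E_h)/h and cE into
      that of E and hcE + E_h. So the truncated quotient is a scaled difference of two supermedian
      functions.\<close>
    have "?y h = (\<lambda>x. 1 / h * (min (E x) ((h * c) * E x + Eh h x) - Eh h x))"
      using h(1) by (auto simp: W_def min_def field_simps)
    moreover have "L1_continuous (\<lambda>x. 1 / h * (min (E x) ((h * c) * E x + Eh h x) - Eh h x))"
      using sup Eh(4)[of h] h(1)
      by (intro L1_continuous_cmult L1_continuous_diff supermedian_L1_continuous) auto
    ultimately show "\<exists>v. L1_continuous v \<and> Lp_norm 1 M (\<lambda>x. v x - min (u x) (c * E x)) < \<epsilon>"
      using h(2) by (intro exI[of _ "?y h"]) simp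
  qed
  \<comment> \<open>nE can catch up with a positive value of u only where E > 0. On {E \<le> 0} the
    quotient W is at most 0, so u is at most |W - u| there, which tends to 0 in L_2; hence u
    vanishes there.\<close>
  have E_pos: "AE x in M. 0 < u x \<longrightarrow> 0 < E x"
  proof -
    define Z where "Z x = (if E x \<le> 0 then max (u x) 0 else 0)" for x
    have Z: "Z \<in> Lp 2 M"
      by (rule L2_dominated[OF u(1)]) (auto simp: Z_def[abs_def])
    have "Lp_norm 2 M Z \<le> Lp_norm 2 M (\<lambda>x. W h x - u x)" if h: "0 < h" for h
    proof (rule L2_norm_mono)
      show "(\<lambda>x. W h x - u x) \<in> Lp 2 M" using W[of h] h u by auto
      show "AE x in M. \<bar>Z x\<bar> \<le> \<bar>W h x - u x\<bar>"
        using Eh(2)[of h, unfolded nonneg_ae_def, OF less_imp_le[OF h]] u(3)[unfolded nonneg_ae_def]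
      proof eventually_elim
        case (elim x)
        show ?case
        proof (cases "E x \<le> 0")
          case True
          have "E x - Eh h x \<le> 0" using True elim by linarith
          then have "W h x \<le> 0" unfolding W_def using h by (simp add: divide_nonpos_pos)
          then show ?thesis using elim by (simp add: Z_def)
        qed (simp add: Z_def)
      qed
    qed (use Z Lp_measurable in blast)
    then have "\<forall>\<^sub>F h in at_right 0. Lp_norm 2 M Z \<le> Lp_norm 2 M (\<lambda>x. W h x - u x)"
      by (intro eventually_at_rightI[of 0 1]) auto
    then have "Lp_norm 2 M Z \<le> 0"
      by (intro tendsto_lowerbound[OF Wlim]) auto
    then have "pairing M Z Z \<le> 0" by (simp add: L2_norm_eq)
    then have "AE x in M. Z x = 0" by (rule L2_AE_zeroI[OF Z])
    then show ?thesis by eventually_elim (auto simp: Z_def split: if_splits)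
  qed
  show ?thesis
  proof (rule L1_continuous_closed[OF u(1,2)])
    fix \<epsilon> :: real assume \<epsilon>: "0 < \<epsilon>"
    have "(\<lambda>n. \<integral>x. \<bar>min (u x) (real n * E x) - u x\<bar> \<partial>M) \<longlonglongrightarrow> (\<integral>x. 0 \<partial>M)"
    proof (rule integral_dominated_convergence[where w = "\<lambda>x. \<bar>u x\<bar>"])
      show "integrable M (\<lambda>x. \<bar>u x\<bar>)" using u by (simp add: L1_iff)
      show "AE x in M. (\<lambda>n. \<bar>min (u x) (real n * E x) - u x\<bar>) \<longlonglongrightarrow> 0"
        using E_pos u(3) E(3) unfolding nonneg_ae_def
      proof eventually_elim
        case (elim x)
        have "\<exists>N. \<forall>n\<ge>N. \<bar>min (u x) (real n * E x) - u x\<bar> = 0"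
        proof (cases "0 < u x")
          case True
          then have "0 < E x" using elim by blast
          then obtain N where N: "u x < real N * E x" using reals_Archimedean3 by blast
          have "u x \<le> real n * E x" if "N \<le> n" for n
          proof -
            have "real N * E x \<le> real n * E x" using that \<open>0 < E x\<close> by (intro mult_right_mono) auto
            then show ?thesis using N by linarith
          qed
          then show ?thesis by (intro exI[of _ N]) auto
        next
          case False
          then have "u x = 0" using elim by linarith
          then show ?thesis using elim by auto
        qed
        then have "\<forall>\<^sub>F n in sequentially. \<bar>min (u x) (real n * E x) - u x\<bar> = 0"
          unfolding eventually_sequentially .
        then show ?case by (rule tendsto_eventually)
      qed
      show "AE x in M. norm \<bar>min (u x) (real n * E x) - u x\<bar> \<le> \<bar>u x\<bar>" for n
        using u(3) E(3) unfolding nonneg_ae_def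
      proof eventually_elim
        case (elim x)
        have "0 \<le> real n * E x" using elim by simp
        then show ?case using elim by (simp add: min_def)
      qed
    qed auto
    then have "\<forall>\<^sub>F n in sequentially. (\<integral>x. \<bar>min (u x) (real n * E x) - u x\<bar> \<partial>M) < \<epsilon>"
      using \<epsilon> by (intro order_tendstoD(2)) auto
    then obtain n where "(\<integral>x. \<bar>min (u x) (real n * E x) - u x\<bar> \<partial>M) < \<epsilon>"
      by (auto simp: eventually_sequentially)
    then show "\<exists>v. L1_continuous v \<and> Lp_norm 1 M (\<lambda>x. v x - u x) < \<epsilon>"
      using trunc[of "real n"] unfolding L1_norm by auto
  qed
qed

end

end

section \<open>Semigroups acting on Lr\<close>

lemma conjugate_exponents_ge_1:
  fixes r r' :: ennreal
  assumes "1 \<le> r" "1 / r + 1 / r' = 1"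
  shows "1 \<le> r'"
  using assms by (cases rule: conjugate_exponents_cases) auto

lemma pairing_diff_right_Lp:
  assumes "1 \<le> r" "1 / r + 1 / r' = (1::ennreal)" "x \<in> Lp r M" "h \<in> Lp r' M" "k \<in> Lp r' M"
  shows "pairing M x (\<lambda>y. h y - k y) = pairing M x h - pairing M x k"
  using Holder(1)[OF assms(1-4)] Holder(1)[OF assms(1-3,5)]
  by (simp add: pairing_def right_diff_distrib)

text \<open>The error is proportional to the L_r-norm of x, hence uniform along orbits of bounded
  norm; one and the same k serves all times.\<close>

lemma pairing_L2_approx:
  fixes r r' :: ennreal
  assumes r: "1 \<le> r" "1 / r + 1 / r' = 1" "r' < \<infinity>" and h: "h \<in> Lp r' M" and \<epsilon>: "0 < \<epsilon>"
  obtains k where "k \<in> Lp 2 M" "k \<in> Lp r' M"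
    "\<And>x. x \<in> Lp r M \<Longrightarrow> \<bar>pairing M x h - pairing M x k\<bar> \<le> \<epsilon> * Lp_norm r M x"
proof -
  obtain k where k: "k \<in> Lp 2 M" "k \<in> Lp r' M" and d: "(\<lambda>x. h x - k x) \<in> Lp r' M"
    and n: "Lp_norm r' M (\<lambda>x. h x - k x) < \<epsilon>"
    by (rule L2_dense_Lp[OF conjugate_exponents_ge_1[OF r(1,2)] r(3) h \<epsilon>])
  have "\<bar>pairing M x h - pairing M x k\<bar> \<le> \<epsilon> * Lp_norm r M x" if x: "x \<in> Lp r M" for x
  proof -
    have "\<bar>pairing M x h - pairing M x k\<bar> = \<bar>pairing M x (\<lambda>y. h y - k y)\<bar>"
      by (simp add: pairing_diff_right_Lp[OF r(1,2) x h k(2)])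
    also have "\<dots> \<le> Lp_norm r M x * Lp_norm r' M (\<lambda>y. h y - k y)" by (rule Holder(2)[OF r(1,2) x d])
    also have "\<dots> \<le> Lp_norm r M x * \<epsilon>" using n by (intro mult_left_mono) (auto simp: Lp_norm_nonneg)
    finally show ?thesis by (simp add: mult.commute)
  qed
  then show thesis using that[OF k] by blast
qed

context L2_semigroup
begin

text \<open>As in \<open>also_acts_on_Lp\<close>, but with the constants exposed, because the
  adjoint semigroup inherits them for the conjugate exponent.\<close>

definition acts_on :: "ennreal \<Rightarrow> real \<Rightarrow> real \<Rightarrow> bool" where
  "acts_on r k v \<longleftrightarrow> 0 \<le> k \<and> (\<forall>u\<in>Lp 2 M. u \<in> Lp r M \<longrightarrow> (\<forall>t\<ge>0.
     P t u \<in> Lp r M \<and> Lp_norm r M (P t u) \<le> k * exp (v * t) * Lp_norm r M u))"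

lemma acts_onD:
  assumes "acts_on r k v" "u \<in> Lp 2 M" "u \<in> Lp r M" "0 \<le> t"
  shows "P t u \<in> Lp r M" "Lp_norm r M (P t u) \<le> k * exp (v * t) * Lp_norm r M u"
  using assms by (auto simp: acts_on_def)

lemma also_acts_on_acts_on:
  assumes "also_acts_on_Lp r M P"
  shows "\<exists>k v. acts_on r k v"
proof -
  obtain k v where "1 \<le> k" "\<forall>u\<in>Lp 2 M \<inter> Lp r M. \<forall>t\<ge>0.
      P t u \<in> Lp r M \<and> Lp_norm r M (P t u) \<le> k * exp (v * t) * Lp_norm r M u"
    using assms unfolding also_acts_on_Lp_def by (elim exE conjE)
  then have "acts_on r k v" by (simp add: acts_on_def)
  then show ?thesis by blast
qed

lemma acts_on_nonneg: "acts_on r k v \<Longrightarrow> 0 \<le> k"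
  by (simp add: acts_on_def)

text \<open>Moving \<open>P t\<close> across the pairing, Hoelder bounds the pairings of the adjoint
  orbit with L_2 \<inter> L_r; the converse Hoelder inequality reads off membership in L_r',
  including r' = 1 and r' = \<infinity>.\<close>

lemma acts_on_dual:
  assumes a: "acts_on r k v" and r: "1 \<le> r" "1 / r + 1 / r' = 1"
  shows "L2_semigroup.acts_on M (\<lambda>t. L2_dual M (P t)) r' k v"
proof -
  interpret adj: L2_semigroup M "\<lambda>t. L2_dual M (P t)" K w by (rule L2_semigroup_dual)
  have r': "1 \<le> r'" "1 / r' + 1 / r = 1"
    using conjugate_exponents_ge_1[OF r] r by (simp_all add: add.commute)
  have "L2_dual M (P t) u \<in> Lp r' M \<and> Lp_norm r' M (L2_dual M (P t) u) \<le> k * exp (v * t) * Lp_norm r' M u"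
    if u: "u \<in> Lp 2 M" "u \<in> Lp r' M" and t: "0 \<le> t" for t u
  proof (rule converse_Holder[OF r'])
    fix x assume x: "x \<in> Lp 2 M" "x \<in> Lp r M"
    have "\<bar>pairing M (L2_dual M (P t) u) x\<bar> = \<bar>pairing M (P t x) u\<bar>" using L2_dual_pair[OF t u(1) x(1)] by simp
    also have "\<dots> \<le> Lp_norm r M (P t x) * Lp_norm r' M u"
      by (rule Holder(2)[OF r acts_onD(1)[OF a x t] u(2)])
    also have "\<dots> \<le> (k * exp (v * t) * Lp_norm r M x) * Lp_norm r' M u"
      by (intro mult_right_mono acts_onD(2)[OF a x t]) (rule Lp_norm_nonneg)
    finally show "\<bar>pairing M (L2_dual M (P t) u) x\<bar> \<le> k * exp (v * t) * Lp_norm r' M u * Lp_norm r M x"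
      by (simp add: mult_ac)
  qed (use L2_dual_in[OF t u(1)] acts_on_nonneg[OF a] in \<open>auto simp: Lp_norm_nonneg\<close>)
  then show ?thesis using acts_on_nonneg[OF a] by (auto simp: adj.acts_on_def)
qed

text \<open>Again by duality: every pairing with L_2 \<inter> L_r' is a scalar Laplace transform,
  which replaces an integral with values in L_r. Only continuity of L_2 pairings enters, so the
  result is available before continuity in L_1 is known.\<close>

lemma R_in_Lp:
  assumes a: "acts_on r k v" and r: "1 \<le> r" "1 / r + 1 / r' = 1"
    and l: "w < l" "v < l" and u: "u \<in> Lp 2 M" "u \<in> Lp r M"
  shows "R l u \<in> Lp r M \<and> Lp_norm r M (R l u) \<le> k * Lp_norm r M u / (l - v)"
proof (rule converse_Holder[OF r R_in[OF l(1) u(1)]])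
  fix x assume x: "x \<in> Lp 2 M" "x \<in> Lp r' M"
  have "\<bar>laplace l (\<lambda>t. pairing M (P t u) x)\<bar> \<le> (k * Lp_norm r M u * Lp_norm r' M x) / (l - v)"
  proof (rule laplace_bound[OF P_cont[OF u(1) x(1)] _ l(2)])
    fix t :: real assume t: "0 \<le> t"
    have "\<bar>pairing M (P t u) x\<bar> \<le> Lp_norm r M (P t u) * Lp_norm r' M x"
      by (rule Holder(2)[OF r acts_onD(1)[OF a u t] x(2)])
    also have "\<dots> \<le> (k * exp (v * t) * Lp_norm r M u) * Lp_norm r' M x"
      by (intro mult_right_mono acts_onD(2)[OF a u t]) (rule Lp_norm_nonneg)
    finally show "\<bar>pairing M (P t u) x\<bar> \<le> k * Lp_norm r M u * Lp_norm r' M x * exp (v * t)"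
      by (simp add: mult_ac)
  qed
  then show "\<bar>pairing M (R l u) x\<bar> \<le> k * Lp_norm r M u / (l - v) * Lp_norm r' M x"
    using R_pair[OF l(1) u(1) x(1)] by simp
qed (use acts_on_nonneg[OF a] l in \<open>auto simp: Lp_norm_nonneg\<close>)

lemma acts_on_pair_bound:
  assumes a: "acts_on r k v" and r: "1 \<le> r" "1 / r + 1 / r' = 1"
    and u: "u \<in> Lp 2 M" "u \<in> Lp r M" and h: "h \<in> Lp r' M" and t: "0 \<le> t"
  shows "\<bar>pairing M (P t u) h\<bar> \<le> k * exp (v * t) * Lp_norm r M u * Lp_norm r' M h"
proof -
  have "\<bar>pairing M (P t u) h\<bar> \<le> Lp_norm r M (P t u) * Lp_norm r' M h"
    by (rule Holder(2)[OF r acts_onD(1)[OF a u t] h])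
  also have "\<dots> \<le> (k * exp (v * t) * Lp_norm r M u) * Lp_norm r' M h"
    by (intro mult_right_mono acts_onD(2)[OF a u t]) (rule Lp_norm_nonneg)
  finally show ?thesis .
qed

lemma scaled_R_bound:
  assumes a: "acts_on r k v" and r: "1 \<le> r" "1 / r + 1 / r' = 1"
    and l: "w < l" "2 * \<bar>v\<bar> < l" and u: "u \<in> Lp 2 M" "u \<in> Lp r M"
  shows "l * Lp_norm r M (R l u) \<le> 2 * k * Lp_norm r M u"
proof -
  \<comment> \<open>l > 2|v| gives l \<le> 2(l - v), which bounds l/(l - v) independently of
    l.\<close>
  have l': "v < l" "0 < l" "l \<le> 2 * (l - v)" using l(2) by auto
  have "l * Lp_norm r M (R l u) \<le> 2 * (l - v) * (k * Lp_norm r M u / (l - v))"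
    using R_in_Lp[OF a r l(1) l'(1) u] l' by (intro mult_mono) (auto simp: Lp_norm_nonneg)
  moreover have "2 * a * (b / a) = 2 * b" if "0 < a" for a b :: real using that by simp
  ultimately show ?thesis using l'(1) by (simp only: mult.assoc diff_gt_0_iff_gt)
qed

text \<open>Exactly the two limits that the comparison takes from a functional h. They are proved by
  approximation if r' is finite and by continuity in L_1 if r = 1; the comparison does not see the
  difference.\<close>

definition admissible :: "ennreal \<Rightarrow> ('a \<Rightarrow> real) \<Rightarrow> bool" where
  "admissible r h \<longleftrightarrow> (\<forall>u\<in>Lp 2 M. u \<in> Lp r M \<longrightarrow>
     continuous_on {0..} (\<lambda>t. pairing M (P t u) h) \<and>
     (\<forall>t\<ge>0. ((\<lambda>l. l * pairing M (P t (R l u)) h) \<longlongrightarrow> pairing M (P t u) h) at_top))"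

lemma P_R_pair_Abelian:
  assumes "u \<in> Lp 2 M" "v \<in> Lp 2 M" "0 \<le> t"
  shows "((\<lambda>l. l * pairing M (P t (R l u)) v) \<longlongrightarrow> pairing M (P t u) v) at_top"
proof -
  have "((\<lambda>l. l * pairing M (R l u) (L2_dual M (P t) v)) \<longlongrightarrow> pairing M u (L2_dual M (P t) v)) at_top"
    using assms by (intro R_pair_Abelian L2_dual_in)
  moreover have "\<forall>\<^sub>F l in at_top. l * pairing M (R l u) (L2_dual M (P t) v) = l * pairing M (P t (R l u)) v"
    using eventually_gt_at_top[of w]
  proof eventually_elim
    case (elim l)
    then show ?case
      using L2_dual_pair[OF assms(3,2) R_in[OF elim assms(1)]] by (simp add: pairing_commute)
  qed
  ultimately have "((\<lambda>l. l * pairing M (P t (R l u)) v) \<longlongrightarrow> pairing M u (L2_dual M (P t) v)) at_top"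
    by (rule Lim_transform_eventually)
  then show ?thesis
    using L2_dual_pair[OF assms(3,2,1)] by (simp add: pairing_commute)
qed

text \<open>An L_2 approximant of h has error proportional to the L_r-norm of the orbit, and this
  norm is bounded near each time, and for l R(l)u uniformly in large l.\<close>

lemma admissible_finite:
  assumes a: "acts_on r k v" and r: "1 \<le> r" "1 / r + 1 / r' = 1" "r' < \<infinity>" and h: "h \<in> Lp r' M"
  shows "admissible r h"
  unfolding admissible_def
proof (intro ballI impI conjI allI)
  fix u assume u: "u \<in> Lp 2 M" "u \<in> Lp r M"
  have k0: "0 \<le> k" by (rule acts_on_nonneg[OF a])
  show "continuous_on {0..} (\<lambda>t. pairing M (P t u) h)"
    unfolding continuous_on_def
  proof
    fix s :: real assume "s \<in> {0..}"
    then have s: "0 \<le> s" by simp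
    define B where "B = k * exp (\<bar>v\<bar> * (s + 1)) * Lp_norm r M u + 1"
    have B: "0 < B" using k0 by (simp add: B_def Lp_norm_nonneg add_nonneg_pos)
    have Bt: "Lp_norm r M (P t u) \<le> B" if t: "0 \<le> t" "t \<le> s + 1" for t
    proof -
      have "v * t \<le> \<bar>v\<bar> * (s + 1)" using t by (intro mult_mono) auto
      then have "k * exp (v * t) * Lp_norm r M u \<le> k * exp (\<bar>v\<bar> * (s + 1)) * Lp_norm r M u"
        using k0 by (intro mult_right_mono mult_left_mono) (auto simp: Lp_norm_nonneg)
      then show ?thesis using acts_onD(2)[OF a u t(1)] by (simp add: B_def)
    qed
    show "((\<lambda>t. pairing M (P t u) h) \<longlongrightarrow> pairing M (P s u) h) (at s within {0..})"
    proof (rule tendstoI)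
      fix \<epsilon> :: real assume \<epsilon>: "0 < \<epsilon>"
      \<comment> \<open>Two approximation errors of at most \<epsilon>/4 each leave \<epsilon>/2 for
        the L_2 pairing.\<close>
      define \<delta> where "\<delta> = \<epsilon> / (4 * B)"
      have \<delta>: "0 < \<delta>" using \<epsilon> B by (simp add: \<delta>_def)
      obtain g where g: "g \<in> Lp 2 M"
        and gh: "\<And>x. x \<in> Lp r M \<Longrightarrow> \<bar>pairing M x h - pairing M x g\<bar> \<le> \<delta> * Lp_norm r M x"
        using pairing_L2_approx[OF r h \<delta>] by metis
      have gh': "\<bar>pairing M (P t u) h - pairing M (P t u) g\<bar> \<le> \<epsilon> / 4" if t: "0 \<le> t" "t \<le> s + 1" for t
      proof -
        have "\<bar>pairing M (P t u) h - pairing M (P t u) g\<bar> \<le> \<delta> * Lp_norm r M (P t u)"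
          by (rule gh[OF acts_onD(1)[OF a u t(1)]])
        also have "\<dots> \<le> \<delta> * B" using Bt[OF t] \<delta> by (intro mult_left_mono) auto
        also have "\<dots> = \<epsilon> / 4" using B by (simp add: \<delta>_def)
        finally show ?thesis .
      qed
      have "((\<lambda>t. pairing M (P t u) g) \<longlongrightarrow> pairing M (P s u) g) (at s within {0..})"
        using P_cont[OF u(1) g] s unfolding continuous_on_def by auto
      then have "\<forall>\<^sub>F t in at s within {0..}. dist (pairing M (P t u) g) (pairing M (P s u) g) < \<epsilon> / 2"
        using \<epsilon> by (intro tendstoD) auto
      moreover have "\<forall>\<^sub>F t in at s within {0..}. t \<in> {0..s+1}"
        unfolding eventually_at by (intro exI[of _ 1]) (auto simp: dist_real_def)
      ultimately show "\<forall>\<^sub>F t in at s within {0..}. dist (pairing M (P t u) h) (pairing M (P s u) h) < \<epsilon>"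
      proof eventually_elim
        case (elim t)
        have "\<bar>pairing M (P t u) h - pairing M (P t u) g\<bar> \<le> \<epsilon> / 4" using gh'[of t] elim(2) by auto
        moreover have "\<bar>pairing M (P s u) h - pairing M (P s u) g\<bar> \<le> \<epsilon> / 4" using gh'[of s] s by auto
        ultimately show ?case using elim(1) unfolding dist_real_def by linarith
      qed
    qed
  qed
  fix t :: real assume t: "0 \<le> t"
  \<comment> \<open>One constant for both orbits: the term with 2k comes from l R(l)u, the other
    from u, and the 1 makes the divisor positive.\<close>
  define B where "B = k * exp (v * t) * (2 * k * Lp_norm r M u + Lp_norm r M u) + 1"
  have B: "0 < B" using k0 by (auto simp: B_def Lp_norm_nonneg intro!: add_nonneg_pos mult_nonneg_nonneg add_nonneg_nonneg)
  show "((\<lambda>l. l * pairing M (P t (R l u)) h) \<longlongrightarrow> pairing M (P t u) h) at_top"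
  proof (rule tendstoI)
    fix \<epsilon> :: real assume \<epsilon>: "0 < \<epsilon>"
    define \<delta> where "\<delta> = \<epsilon> / (4 * B)"
    have \<delta>: "0 < \<delta>" using \<epsilon> B by (simp add: \<delta>_def)
    obtain g where g: "g \<in> Lp 2 M"
      and gh: "\<And>x. x \<in> Lp r M \<Longrightarrow> \<bar>pairing M x h - pairing M x g\<bar> \<le> \<delta> * Lp_norm r M x"
      using pairing_L2_approx[OF r h \<delta>] by metis
    have "\<forall>\<^sub>F l in at_top. dist (l * pairing M (P t (R l u)) g) (pairing M (P t u) g) < \<epsilon> / 2"
      using \<epsilon> by (intro tendstoD P_R_pair_Abelian u g t) auto
    moreover have "\<forall>\<^sub>F l in at_top. max w (2 * \<bar>v\<bar>) < l" by (rule eventually_gt_at_top)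
    ultimately show "\<forall>\<^sub>F l in at_top. dist (l * pairing M (P t (R l u)) h) (pairing M (P t u) h) < \<epsilon>"
    proof eventually_elim
      case (elim l)
      then have l: "w < l" "2 * \<bar>v\<bar> < l" "v < l" "0 < l" by auto
      have Rr: "R l u \<in> Lp 2 M" "R l u \<in> Lp r M" using R_in R_in_Lp[OF a r(1,2) l(1,3) u] l u by auto
      have "l * \<bar>pairing M (P t (R l u)) h - pairing M (P t (R l u)) g\<bar> \<le> l * (\<delta> * Lp_norm r M (P t (R l u)))"
        using l by (intro mult_left_mono gh acts_onD(1)[OF a Rr t]) auto
      also have "\<dots> \<le> l * (\<delta> * (k * exp (v * t) * Lp_norm r M (R l u)))"
        using l \<delta> by (intro mult_left_mono acts_onD(2)[OF a Rr t]) auto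
      also have "\<dots> = \<delta> * (k * exp (v * t) * (l * Lp_norm r M (R l u)))" by (simp add: mult_ac)
      also have "\<dots> \<le> \<delta> * (k * exp (v * t) * (2 * k * Lp_norm r M u))"
        using scaled_R_bound[OF a r(1,2) l(1,2) u] \<delta> k0 by (intro mult_left_mono) auto
      also have "\<dots> \<le> \<delta> * B"
        using \<delta> k0 by (intro mult_left_mono) (auto simp: B_def distrib_left Lp_norm_nonneg)
      also have "\<dots> = \<epsilon> / 4" using B by (simp add: \<delta>_def)
      finally have 1: "\<bar>l * pairing M (P t (R l u)) h - l * pairing M (P t (R l u)) g\<bar> \<le> \<epsilon> / 4"
        using l by (simp add: abs_mult flip: right_diff_distrib)
      have "\<bar>pairing M (P t u) h - pairing M (P t u) g\<bar> \<le> \<delta> * Lp_norm r M (P t u)"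
        by (rule gh[OF acts_onD(1)[OF a u t]])
      also have "\<dots> \<le> \<delta> * (k * exp (v * t) * Lp_norm r M u)"
        using \<delta> by (intro mult_left_mono acts_onD(2)[OF a u t]) auto
      also have "\<dots> \<le> \<delta> * B"
        using \<delta> k0 by (intro mult_left_mono) (auto simp: B_def distrib_left Lp_norm_nonneg)
      also have "\<dots> = \<epsilon> / 4" using B by (simp add: \<delta>_def)
      finally have 2: "\<bar>pairing M (P t u) h - pairing M (P t u) g\<bar> \<le> \<epsilon> / 4" .
      show ?case using 1 2 elim(1) unfolding dist_real_def by linarith
    qed
  qed
qed

end

context strong_L2_semigroup
begin

lemma strongly_continuous_L1:
  assumes a: "acts_on 1 k v" and u: "u \<in> Lp 2 M" "u \<in> Lp 1 M"
  shows "L1_continuous u"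
proof -
  have acts: "P t u \<in> Lp 1 M \<and> Lp_norm 1 M (P t u) \<le> k * exp (v * t) * Lp_norm 1 M u"
    if "u \<in> Lp 2 M" "u \<in> Lp 1 M" "0 \<le> t" for u t using acts_onD[OF a that] by blast
  \<comment> \<open>Above both growth bounds: w for R(l)u to exist in L_2, v for it to lie in
    L_1.\<close>
  define l where "l = max w v + 1"
  have l: "w < l" "v < l" by (auto simp: l_def)
  have pos: "L1_continuous x" if x: "x \<in> Lp 2 M" "x \<in> Lp 1 M" "nonneg_ae M x" for x
    using R_in_Lp[OF a _ _ l x(1,2), of \<infinity>]
    by (intro L1_continuous_nonneg[OF acts acts_on_nonneg[OF a] l(1) x]) auto
  have "L1_continuous (\<lambda>x. max (u x) 0 - max (- u x) 0)"
    using u by (intro L1_continuous_diff[OF acts acts_on_nonneg[OF a]] pos L1_max)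
      (auto simp: nonneg_ae_def L1_iff)
  moreover have "(\<lambda>x. max (u x) 0 - max (- u x) 0) = u" by auto
  ultimately show ?thesis by simp
qed

lemma P_continuous_L1:
  assumes a: "acts_on 1 k v" and u: "u \<in> Lp 2 M" "u \<in> Lp 1 M" and s: "0 \<le> s"
  shows "((\<lambda>t. Lp_norm 1 M (\<lambda>x. P t u x - P s u x)) \<longlongrightarrow> 0) (at s within {0..})"
proof (rule orbit_modulus_tendsto[OF _ s acts_on_nonneg[OF a], where w = v
        and N = "\<lambda>t r. Lp_norm 1 M (\<lambda>x. P t u x - P r u x)"
        and g = "\<lambda>t. Lp_norm 1 M (\<lambda>x. P t u x - u x)"])
  show "((\<lambda>t. Lp_norm 1 M (\<lambda>x. P t u x - u x)) \<longlongrightarrow> 0) (at_right 0)"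
    using strongly_continuous_L1[OF a u] by (simp add: L1_continuous_def)
  fix r t :: real assume rt: "0 \<le> r" "r \<le> t"
  then have tr: "0 \<le> t - r" by simp
  note i = P_in[OF tr u(1)] and i1 = acts_onD(1)[OF a u tr]
  have d: "(\<lambda>y. P (t - r) u y - u y) \<in> Lp 2 M" "(\<lambda>y. P (t - r) u y - u y) \<in> Lp 1 M"
    using i i1 u by (auto intro: L1_diff)
  have m [measurable]: "P t u \<in> borel_measurable M" "P r u \<in> borel_measurable M"
    "P r (\<lambda>y. P (t - r) u y - u y) \<in> borel_measurable M"
    using rt u d by (auto intro: P_meas)
  have "AE x in M. P t u x - P r u x = P r (\<lambda>y. P (t - r) u y - u y) x"
    using P_plus[OF rt(1) tr u(1)] P_diff[OF rt(1) i u(1)] by (auto elim: eventually_elim2)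
  then have "Lp_norm 1 M (\<lambda>x. P t u x - P r u x) = Lp_norm 1 M (P r (\<lambda>y. P (t - r) u y - u y))"
    by (intro L1_norm_cong_AE) measurable
  then show "Lp_norm 1 M (\<lambda>x. P t u x - P r u x) \<le> k * exp (v * r) * Lp_norm 1 M (\<lambda>x. P (t - r) u x - u x)"
    using acts_onD(2)[OF a d rt(1)] by simp
qed (auto simp: Lp_norm_nonneg intro: L1_norm_minus_commute)

text \<open>l R(l)u - u is l times the Laplace integral of P(t)u - u, so its L_1-norm is at most l
  times the Laplace transform of \<psi>(t), the L_1-norm of P(t)u - u. By the scalar Abelian theorem
  this tends to \<psi>(0) = 0. The norm estimate goes through pairings with L_2 \<inter>
  L_\<infinity>.\<close>

lemma scaled_R_tendsto_L1:
  assumes a: "acts_on 1 k v" and u: "u \<in> Lp 2 M" "u \<in> Lp 1 M"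
  shows "((\<lambda>l. Lp_norm 1 M (\<lambda>x. l * R l u x - u x)) \<longlongrightarrow> 0) at_top"
proof -
  define \<psi> where "\<psi> t = Lp_norm 1 M (\<lambda>x. P t u x - u x)" for t
  have P1: "P t u \<in> Lp 1 M" if "0 \<le> t" for t by (rule acts_onD(1)[OF a u that])
  have \<psi>0: "0 \<le> \<psi> t" for t by (simp add: \<psi>_def Lp_norm_nonneg)
  have \<psi>_cont: "continuous_on {0..} \<psi>"
    unfolding continuous_on_def
  proof
    fix s :: real assume "s \<in> {0..}"
    then have s: "0 \<le> s" by simp
    show "(\<psi> \<longlongrightarrow> \<psi> s) (at s within {0..})"
    proof (rule LIM_zero_cancel, rule Lim_null_comparison[OF _ P_continuous_L1[OF a u s]])
      have "norm (\<psi> t - \<psi> s) \<le> Lp_norm 1 M (\<lambda>x. P t u x - P s u x)" if t: "0 \<le> t" for t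
      proof -
        have *: "\<psi> t \<le> Lp_norm 1 M (\<lambda>x. P t u x - P s u x) + \<psi> s" if "0 \<le> s" "0 \<le> t" for s t
          using L1_norm_triangle[OF L1_diff[OF P1[OF that(2)] P1[OF that(1)]] L1_diff[OF P1[OF that(1)] u(2)]]
          by (simp add: \<psi>_def)
        show ?thesis
          using *[OF s t] *[OF t s] L1_norm_minus_commute[of M "P t u" "P s u"] by (simp add: abs_le_iff)
      qed
      then show "\<forall>\<^sub>F t in at s within {0..}. norm (\<psi> t - \<psi> s) \<le> Lp_norm 1 M (\<lambda>x. P t u x - P s u x)"
        by (auto simp: eventually_at_filter)
    qed
  qed
  \<comment> \<open>The bound for \<psi> contains the constant norm of u, which a negative growth
    rate v would not dominate.\<close>
  define v' where "v' = max v 0"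
  have \<psi>_bound: "\<bar>\<psi> t\<bar> \<le> ((k + 1) * Lp_norm 1 M u) * exp (v' * t)" if t: "0 \<le> t" for t
  proof -
    have "\<psi> t \<le> Lp_norm 1 M (P t u) + Lp_norm 1 M u"
      unfolding \<psi>_def by (rule L1_norm_triangle_diff[OF P1[OF t] u(2)])
    also have "\<dots> \<le> k * exp (v * t) * Lp_norm 1 M u + Lp_norm 1 M u"
      using acts_onD(2)[OF a u t] by simp
    also have "\<dots> \<le> k * exp (v' * t) * Lp_norm 1 M u + exp (v' * t) * Lp_norm 1 M u"
    proof (rule add_mono)
      have "v * t \<le> v' * t" using t by (intro mult_right_mono) (auto simp: v'_def)
      then show "k * exp (v * t) * Lp_norm 1 M u \<le> k * exp (v' * t) * Lp_norm 1 M u"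
        using acts_on_nonneg[OF a] by (intro mult_right_mono mult_left_mono) (auto simp: Lp_norm_nonneg)
      have "1 \<le> exp (v' * t)" using t by (simp add: v'_def)
      then show "Lp_norm 1 M u \<le> exp (v' * t) * Lp_norm 1 M u"
        using mult_right_mono[of 1 "exp (v' * t)" "Lp_norm 1 M u"] by (simp add: Lp_norm_nonneg)
    qed
    finally show ?thesis using \<psi>0 by (simp add: algebra_simps)
  qed
  have "((\<lambda>l. l * laplace l \<psi>) \<longlongrightarrow> \<psi> 0) at_top"
    by (rule laplace_Abelian[OF \<psi>_cont \<psi>_bound])
  moreover have "\<psi> 0 = 0"
  proof -
    have "\<psi> 0 = Lp_norm 1 M (\<lambda>x. 0)"
      unfolding \<psi>_def using P_0[OF u(1)] P_in[OF order.refl u(1)] u(1)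
      by (intro L1_norm_cong_AE) (auto intro: Lp_measurable[of _ 2])
    then show ?thesis by (simp add: L1_norm)
  qed
  ultimately have lim: "((\<lambda>l. l * laplace l \<psi>) \<longlongrightarrow> 0) at_top" by simp
  show ?thesis
  proof (rule Lim_null_comparison[OF _ lim])
    have "\<forall>\<^sub>F l in at_top. max w v' < l" by (rule eventually_gt_at_top)
    then show "\<forall>\<^sub>F l in at_top. norm (Lp_norm 1 M (\<lambda>x. l * R l u x - u x)) \<le> l * laplace l \<psi>"
    proof eventually_elim
      case (elim l)
      then have l: "w < l" "v' < l" "0 < l" by (auto simp: v'_def)
      have Ru: "R l u \<in> Lp 2 M" by (rule R_in[OF l(1) u(1)])
      have "(\<lambda>x. l * R l u x - u x) \<in> Lp 1 M \<and> Lp_norm 1 M (\<lambda>x. l * R l u x - u x) \<le> l * laplace l \<psi>"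
      proof (rule converse_Holder[of 1 \<infinity>])
        show "(\<lambda>x. l * R l u x - u x) \<in> Lp 2 M" using Ru u by auto
        show "0 \<le> l * laplace l \<psi>" using l \<psi>0 by (intro mult_nonneg_nonneg laplace_nonneg) auto
        fix y assume y: "y \<in> Lp 2 M" "y \<in> Lp \<infinity> M"
        let ?\<phi> = "\<lambda>t. pairing M (P t u) y"
        have c: "laplace l (\<lambda>t. - pairing M u y) = - pairing M u y / l"
          unfolding laplace_def
          using has_bochner_integral_mult_left[OF has_bochner_integral_exp[OF l(3)], of "- pairing M u y"]
          by (simp add: has_bochner_integral_iff mult.assoc)
        \<comment> \<open>The constant <u,y> enters the same Laplace integral, so the common growth
          rate must be nonnegative.\<close>
        have max: "K * Lp_norm 2 M u * Lp_norm 2 M y * exp (w * t) \<le> K * Lp_norm 2 M u * Lp_norm 2 M y * exp (max w 0 * t)"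
          if "0 \<le> t" for t
          using that K_nonneg by (intro mult_left_mono) (auto simp: Lp_norm_nonneg mult_right_mono)
        have "laplace l (\<lambda>t. ?\<phi> t + - pairing M u y) = laplace l ?\<phi> + laplace l (\<lambda>t. - pairing M u y)"
        proof (rule laplace_add[OF P_cont[OF u(1) y(1)]])
          show "\<bar>?\<phi> t\<bar> \<le> K * Lp_norm 2 M u * Lp_norm 2 M y * exp (max w 0 * t)" if "0 \<le> t" for t
            using P_pair_bound[OF u(1) y(1) that] max[OF that] by linarith
          show "\<bar>- pairing M u y\<bar> \<le> \<bar>pairing M u y\<bar> * exp (max w 0 * t)" if "0 \<le> t" for t
            using mult_left_mono[of 1 "exp (max w 0 * t)" "\<bar>pairing M u y\<bar>"] that by simp
        qed (use l in \<open>auto simp: v'_def\<close>)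
        then have "pairing M (\<lambda>x. l * R l u x - u x) y = l * laplace l (\<lambda>t. ?\<phi> t - pairing M u y)"
          using Ru u y l by (simp add: pairing_linear L2_cmult R_pair c field_simps)
        also have "\<bar>\<dots>\<bar> \<le> l * laplace l (\<lambda>t. Lp_norm \<infinity> M y * \<psi> t)"
        proof -
          have c1: "continuous_on {0..} (\<lambda>t. ?\<phi> t - pairing M u y)"
            by (intro continuous_intros P_cont u y)
          have b: "\<bar>?\<phi> t - pairing M u y\<bar> \<le> Lp_norm \<infinity> M y * \<psi> t" if t: "0 \<le> t" for t
          proof -
            have "?\<phi> t - pairing M u y = pairing M (\<lambda>x. P t u x - u x) y"
              using u y P_in[OF t u(1)] by (simp add: pairing_linear)
            then show ?thesis
              using Holder_1_inf(2)[OF L1_diff[OF P1[OF t] u(2)] y(2)] by (simp add: \<psi>_def mult.commute)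
          qed
          have c2: "continuous_on {0..} (\<lambda>t. Lp_norm \<infinity> M y * \<psi> t)"
            by (intro continuous_intros \<psi>_cont)
          have b2: "\<bar>Lp_norm \<infinity> M y * \<psi> t\<bar>
              \<le> Lp_norm \<infinity> M y * ((k + 1) * Lp_norm 1 M u) * exp (v' * t)" if "0 \<le> t" for t
            using mult_left_mono[OF \<psi>_bound[OF that] Lp_norm_nonneg[of \<infinity> M y]]
            by (simp only: abs_mult abs_of_nonneg[OF Lp_norm_nonneg] mult.assoc)
          have "\<bar>laplace l (\<lambda>t. ?\<phi> t - pairing M u y)\<bar> \<le> laplace l (\<lambda>t. Lp_norm \<infinity> M y * \<psi> t)"
            by (rule laplace_abs_le[OF c1 c2 b b2 l(2)])
          then show ?thesis using l by (simp add: abs_mult)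
        qed
        finally show "\<bar>pairing M (\<lambda>x. l * R l u x - u x) y\<bar> \<le> l * laplace l \<psi> * Lp_norm \<infinity> M y"
          unfolding laplace_cmult by (simp add: mult_ac)
      qed auto
      then show ?case by (simp add: Lp_norm_nonneg)
    qed
  qed
qed

text \<open>For bounded h the pairing is controlled by the L_1-norm, so both limits follow from the
  two convergence statements in L_1.\<close>

lemma admissible_L1:
  assumes a: "acts_on 1 k v" and h: "h \<in> Lp \<infinity> M"
  shows "admissible 1 h"
  unfolding admissible_def
proof (intro ballI impI conjI allI)
  fix u assume u: "u \<in> Lp 2 M" "u \<in> Lp 1 M"
  have r: "1 \<le> (1::ennreal)" "1 / 1 + 1 / \<infinity> = (1::ennreal)" by auto
  have P1: "P t x \<in> Lp 1 M" if "x \<in> Lp 2 M" "x \<in> Lp 1 M" "0 \<le> t" for x t by (rule acts_onD(1)[OF a that])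
  have diff: "\<bar>pairing M x h - pairing M y h\<bar> \<le> Lp_norm 1 M (\<lambda>z. x z - y z) * Lp_norm \<infinity> M h"
    if xy: "x \<in> Lp 1 M" "y \<in> Lp 1 M" for x y
  proof -
    have "pairing M x h - pairing M y h = pairing M (\<lambda>z. x z - y z) h"
      using Holder_1_inf(1)[OF xy(1) h] Holder_1_inf(1)[OF xy(2) h]
      by (simp add: pairing_def left_diff_distrib)
    then show ?thesis using Holder_1_inf(2)[OF L1_diff[OF xy] h] by simp
  qed
  show "continuous_on {0..} (\<lambda>t. pairing M (P t u) h)"
    unfolding continuous_on_def
  proof
    fix s :: real assume "s \<in> {0..}"
    then have s: "0 \<le> s" by simp
    show "((\<lambda>t. pairing M (P t u) h) \<longlongrightarrow> pairing M (P s u) h) (at s within {0..})"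
    proof (rule LIM_zero_cancel, rule Lim_null_comparison)
      show "((\<lambda>t. Lp_norm 1 M (\<lambda>z. P t u z - P s u z) * Lp_norm \<infinity> M h) \<longlongrightarrow> 0) (at s within {0..})"
        by (rule tendsto_mult_left_zero[OF P_continuous_L1[OF a u s]])
      show "\<forall>\<^sub>F t in at s within {0..}. norm (pairing M (P t u) h - pairing M (P s u) h)
          \<le> Lp_norm 1 M (\<lambda>z. P t u z - P s u z) * Lp_norm \<infinity> M h"
        using diff P1[OF u] s by (auto simp: eventually_at_filter)
    qed
  qed
  fix t :: real assume t: "0 \<le> t"
  have lim: "((\<lambda>l. k * exp (v * t) * Lp_norm 1 M (\<lambda>x. l * R l u x - u x) * Lp_norm \<infinity> M h) \<longlongrightarrow> 0) at_top"
    by (intro tendsto_mult_left_zero tendsto_mult_right_zero scaled_R_tendsto_L1[OF a u])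
  show "((\<lambda>l. l * pairing M (P t (R l u)) h) \<longlongrightarrow> pairing M (P t u) h) at_top"
  proof (rule LIM_zero_cancel, rule Lim_null_comparison[OF _ lim])
    have "\<forall>\<^sub>F l in at_top. max w v < l" by (rule eventually_gt_at_top)
    then show "\<forall>\<^sub>F l in at_top. norm (l * pairing M (P t (R l u)) h - pairing M (P t u) h)
        \<le> k * exp (v * t) * Lp_norm 1 M (\<lambda>x. l * R l u x - u x) * Lp_norm \<infinity> M h"
    proof eventually_elim
      case (elim l)
      then have l: "w < l" "v < l" by auto
      have R: "R l u \<in> Lp 2 M" "R l u \<in> Lp 1 M" using R_in[OF l(1) u(1)] R_in_Lp[OF a r l u] by auto
      have lR: "(\<lambda>x. l * R l u x) \<in> Lp 2 M" "(\<lambda>x. l * R l u x) \<in> Lp 1 M"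
        using R by (auto intro: L1_cmult)
      have d: "(\<lambda>x. l * R l u x - u x) \<in> Lp 2 M" "(\<lambda>x. l * R l u x - u x) \<in> Lp 1 M"
        using lR u by (auto intro: L1_diff)
      have "AE x in M. l * P t (R l u) x - P t u x = P t (\<lambda>x. l * R l u x - u x) x"
        using P_diff[OF t lR(1) u(1)] P_cmult[OF t R(1), of l] by eventually_elim simp
      then have eq: "Lp_norm 1 M (\<lambda>x. l * P t (R l u) x - P t u x) = Lp_norm 1 M (P t (\<lambda>x. l * R l u x - u x))"
        using P_in[OF t R(1)] P_in[OF t u(1)] P_in[OF t d(1)]
        by (intro L1_norm_cong_AE Lp_measurable[of _ 2]) auto
      have "\<bar>l * pairing M (P t (R l u)) h - pairing M (P t u) h\<bar>
          \<le> Lp_norm 1 M (\<lambda>x. l * P t (R l u) x - P t u x) * Lp_norm \<infinity> M h"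
        using diff[OF L1_cmult[OF P1[OF R t]] P1[OF u t]] by (simp add: pairing_cmult_left)
      also have "\<dots> \<le> k * exp (v * t) * Lp_norm 1 M (\<lambda>x. l * R l u x - u x) * Lp_norm \<infinity> M h"
        unfolding eq by (intro mult_right_mono acts_onD(2)[OF a d t] Lp_norm_nonneg)
      finally show ?case by simp
    qed
  qed
qed

end

section \<open>Comparison of two semigroups\<close>

lemma set_integral_average_bound:
  fixes \<phi> :: "real \<Rightarrow> real"
  assumes c: "continuous_on {0..t} \<phi>" and t: "0 < t" and e: "\<And>s. 0 \<le> s \<Longrightarrow> s \<le> t \<Longrightarrow> \<bar>\<phi> s - a\<bar> \<le> \<epsilon>"
  shows "\<bar>(LINT s:{0..t}|lborel. \<phi> s) / t - a\<bar> \<le> \<epsilon>"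
proof -
  have int: "set_integrable lborel {0..t} \<phi>" by (rule borel_integrable_atLeastAtMost'[OF c])
  have const: "set_integrable lborel {0..t} (\<lambda>_. k)" "(LINT s:{0..t}|lborel. k) = t * k" for k :: real
    using t by (auto intro: borel_integrable_atLeastAtMost' simp: set_lebesgue_integral_def)
  have b: "a - \<epsilon> \<le> \<phi> s" "\<phi> s \<le> a + \<epsilon>" if "s \<in> {0..t}" for s
    using e[of s] that by (simp_all add: abs_le_iff)
  have "t * (a - \<epsilon>) \<le> (LINT s:{0..t}|lborel. \<phi> s)"
    unfolding const(2)[symmetric] using b by (intro set_integral_mono const int)
  moreover have "(LINT s:{0..t}|lborel. \<phi> s) \<le> t * (a + \<epsilon>)"
    unfolding const(2)[symmetric] using b by (intro set_integral_mono const int)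
  ultimately show ?thesis using t by (auto simp: abs_le_iff field_simps)
qed

text \<open>The integrand is \<alpha>(r)\<beta>(s) with r + s = t, so joint continuity of the
  product at (0,0) makes it uniformly close to \<alpha>(0)\<beta>(0) on [0,t].\<close>

lemma convolution_average_tendsto:
  fixes \<alpha> \<beta> :: "real \<Rightarrow> real"
  assumes \<alpha>: "continuous_on {0..} \<alpha>" and \<beta>: "continuous_on {0..} \<beta>"
  shows "((\<lambda>t. (LINT s:{0..t}|lborel. \<alpha> (t - s) * \<beta> s) / t) \<longlongrightarrow> \<alpha> 0 * \<beta> 0) (at_right 0)"
proof (rule tendstoI)
  fix \<epsilon> :: real assume \<epsilon>: "0 < \<epsilon>"
  have "((\<lambda>(r, s). \<alpha> r * \<beta> s) \<longlongrightarrow> \<alpha> 0 * \<beta> 0) (at (0, 0) within {0..} \<times> {0..})"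
  proof -
    have c: "continuous_on ({0..} \<times> {0..}) (\<lambda>x. \<alpha> (fst x) * \<beta> (snd x))"
      by (intro continuous_intros continuous_on_compose2[OF \<alpha>] continuous_on_compose2[OF \<beta>]) auto
    from c[unfolded continuous_on_def, rule_format, of "(0, 0)"] show ?thesis
      by (simp add: case_prod_beta')
  qed
  then have "\<forall>\<^sub>F x in at (0, 0) within {0..} \<times> {0..}. dist (case x of (r, s) \<Rightarrow> \<alpha> r * \<beta> s) (\<alpha> 0 * \<beta> 0) < \<epsilon> / 2"
    using \<epsilon> by (intro tendstoD) auto
  then obtain d where d: "0 < d" "\<And>r s. 0 \<le> r \<Longrightarrow> 0 \<le> s \<Longrightarrow> (r, s) \<noteq> (0, 0) \<Longrightarrow> dist (r, s) (0, 0) < d \<Longrightarrow>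
      dist (\<alpha> r * \<beta> s) (\<alpha> 0 * \<beta> 0) < \<epsilon> / 2"
    unfolding eventually_at by auto
  have *: "\<bar>\<alpha> r * \<beta> s - \<alpha> 0 * \<beta> 0\<bar> \<le> \<epsilon> / 2" if "0 \<le> r" "0 \<le> s" "r + s < d" for r s
  proof (cases "(r, s) = (0, 0)")
    case False
    have "dist (r, s) (0, 0) \<le> \<bar>r\<bar> + \<bar>s\<bar>"
      by (simp add: dist_Pair_Pair sqrt_sum_squares_le_sum_abs)
    then show ?thesis using d(2)[OF that(1,2) False] that by (simp add: dist_real_def less_imp_le)
  qed (use \<epsilon> in simp)
  have "\<bar>(LINT s:{0..t}|lborel. \<alpha> (t - s) * \<beta> s) / t - \<alpha> 0 * \<beta> 0\<bar> \<le> \<epsilon> / 2" if t: "0 < t" "t < d" for t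
  proof (rule set_integral_average_bound[OF _ t(1)])
    show "continuous_on {0..t} (\<lambda>s. \<alpha> (t - s) * \<beta> s)"
      by (intro continuous_intros continuous_on_compose2[OF \<alpha>] continuous_on_subset[OF \<beta>]) auto
  qed (use * t in auto)
  then show "\<forall>\<^sub>F t in at_right 0. dist ((LINT s:{0..t}|lborel. \<alpha> (t - s) * \<beta> s) / t) (\<alpha> 0 * \<beta> 0) < \<epsilon>"
    unfolding eventually_at_right_field dist_real_def using d(1) \<epsilon> by (intro exI[of _ d]) force
qed

text \<open>A mean value argument for right derivatives. If G(t) < G(0) - \<epsilon>t, let m be the
  infimum of the points with G(s) + \<epsilon>s < G(0). By continuity the inequality fails at m, and
  the right derivative makes it fail on an interval beyond m, so m is not the infimum.\<close>

lemma right_derivative_nonneg_le: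
  fixes G :: "real \<Rightarrow> real"
  assumes cont: "continuous_on {0..t} G" and t: "0 \<le> t"
    and der: "\<And>s. 0 \<le> s \<Longrightarrow> s < t \<Longrightarrow> \<exists>D\<ge>0. ((\<lambda>h. (G (s + h) - G s) / h) \<longlongrightarrow> D) (at_right 0)"
  shows "G 0 \<le> G t"
proof -
  have le: "G 0 - \<epsilon> * t \<le> G t" if \<epsilon>: "0 < \<epsilon>" for \<epsilon>
  proof (rule ccontr)
    assume neg: "\<not> ?thesis"
    define H where "H s = G s + \<epsilon> * s - G 0" for s
    have H_cont: "continuous_on {0..t} H" unfolding H_def by (intro continuous_intros cont)
    define B where "B = {s \<in> {0..t}. H s < 0}"
    define m where "m = Inf B"
    have tB: "t \<in> B" using neg t by (simp add: B_def H_def)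
    have bdd: "bdd_below B" by (intro bdd_belowI[of _ 0]) (auto simp: B_def)
    have m: "0 \<le> m" "m \<le> t" unfolding m_def
      using tB bdd by (auto intro!: cInf_greatest cInf_lower simp: B_def)
    have below: "0 \<le> H r" if "0 \<le> r" "r < m" for r
    proof (rule ccontr)
      assume "\<not> 0 \<le> H r"
      then have "r \<in> B" using that m by (auto simp: B_def)
      then have "m \<le> r" unfolding m_def using bdd by (rule cInf_lower)
      then show False using that by simp
    qed
    have Hm: "0 \<le> H m"
    proof (cases "m = 0")
      case False
      then have m0: "0 < m" using m by simp
      have "(H \<longlongrightarrow> H m) (at m within {0..t})" using H_cont m unfolding continuous_on_def by auto
      then have "(H \<longlongrightarrow> H m) (at m within {0..m})" by (rule tendsto_within_subset) (use m in auto)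
      then have "(H \<longlongrightarrow> H m) (at_left m)" using at_within_Icc_at_left[OF m0] by simp
      moreover have "\<forall>\<^sub>F r in at_left m. 0 \<le> H r"
        using m0 below by (intro eventually_at_leftI[of 0 m]) auto
      ultimately show ?thesis by (intro tendsto_lowerbound) auto
    qed (simp add: H_def)
    have mt: "m < t" using tB Hm m by (cases "m = t") (auto simp: B_def)
    obtain D where D: "0 \<le> D" "((\<lambda>h. (G (m + h) - G m) / h) \<longlongrightarrow> D) (at_right 0)"
      using der[OF m(1) mt] by auto
    have "\<forall>\<^sub>F h in at_right 0. - \<epsilon> < (G (m + h) - G m) / h"
      using D(2) by (rule order_tendstoD) (use D(1) \<epsilon> in simp)
    then obtain d where d: "0 < d" "\<And>h. 0 < h \<Longrightarrow> h < d \<Longrightarrow> - \<epsilon> < (G (m + h) - G m) / h"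
      unfolding eventually_at_right_field by auto
    have "m + d \<le> s" if s: "s \<in> B" for s
    proof (rule ccontr)
      assume "\<not> m + d \<le> s"
      have "m \<le> s" unfolding m_def using s bdd by (rule cInf_lower)
      moreover have "s \<noteq> m" using s Hm by (auto simp: B_def)
      ultimately have h: "0 < s - m" "s - m < d" using \<open>\<not> m + d \<le> s\<close> by auto
      have "- \<epsilon> * (s - m) < G s - G m" using d(2)[OF h] h(1) by (simp add: field_simps)
      then have "0 \<le> H s" using Hm by (simp add: H_def algebra_simps)
      then show False using s by (simp add: B_def)
    qed
    then have "m + d \<le> Inf B" using tB by (intro cInf_greatest) auto
    then show False using d(1) by (simp add: m_def)
  qed
  show ?thesis
  proof (rule field_le_epsilon)
    fix e :: real assume e: "0 < e"
    \<comment> \<open>Dividing by t + 1 keeps the slope positive and finite also for t = 0.\<close>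
    have "G 0 - e / (t + 1) * t \<le> G t" using e t by (intro le) auto
    moreover have "e / (t + 1) * t \<le> e" using e t by (simp add: field_simps)
    ultimately show "G 0 \<le> G t + e" by linarith
  qed
qed

text \<open>For continuous integrands the set integral equals the gauge integral, to which the
  fundamental theorem of calculus applies; its two-sided derivative is then restricted to the
  right.\<close>

lemma set_integral_Icc_right_derivative:
  fixes \<gamma> :: "real \<Rightarrow> real"
  assumes c: "continuous_on {0..t} \<gamma>"
  shows "continuous_on {0..t} (\<lambda>s. LINT r:{0..s}|lborel. \<gamma> r)"
    and "0 \<le> s \<Longrightarrow> s < t \<Longrightarrow>
      ((\<lambda>h. ((LINT r:{0..s + h}|lborel. \<gamma> r) - (LINT r:{0..s}|lborel. \<gamma> r)) / h) \<longlongrightarrow> \<gamma> s) (at_right 0)"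
proof -
  have eq: "(LINT r:{0..s}|lborel. \<gamma> r) = integral {0..s} \<gamma>" if "s \<le> t" for s
    by (intro set_borel_integral_eq_integral(2) borel_integrable_atLeastAtMost' continuous_on_subset[OF c]) (use that in auto)
  have "continuous_on {0..t} (\<lambda>s. integral {0..s} \<gamma>)"
    by (intro indefinite_integral_continuous_1 integrable_continuous_real c)
  then show "continuous_on {0..t} (\<lambda>s. LINT r:{0..s}|lborel. \<gamma> r)"
    by (rule continuous_on_eq) (simp add: eq)
  assume s: "0 \<le> s" "s < t"
  have "((\<lambda>u. integral {0..u} \<gamma>) has_vector_derivative \<gamma> s) (at s within {0..t})"
    using s by (intro integral_has_vector_derivative c) auto
  then have "((\<lambda>u. integral {0..u} \<gamma>) has_field_derivative \<gamma> s) (at s within {0..t})"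
    by (simp add: has_real_derivative_iff_has_vector_derivative)
  then have "((\<lambda>u. integral {0..u} \<gamma>) has_field_derivative \<gamma> s) (at s within {s..t})"
    by (rule DERIV_subset) (use s in auto)
  then have "((\<lambda>u. (integral {0..u} \<gamma> - integral {0..s} \<gamma>) / (u - s)) \<longlongrightarrow> \<gamma> s) (at_right s)"
    using at_within_Icc_at_right[OF s(2)] by (simp add: has_field_derivative_iff)
  then have "((\<lambda>h. (integral {0..h + s} \<gamma> - integral {0..s} \<gamma>) / (h + s - s)) \<longlongrightarrow> \<gamma> s) (at_right 0)"
    by (subst (asm) filterlim_at_right_to_0)
  then show "((\<lambda>h. ((LINT r:{0..s + h}|lborel. \<gamma> r) - (LINT r:{0..s}|lborel. \<gamma> r)) / h) \<longlongrightarrow> \<gamma> s) (at_right 0)"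
    by (rule Lim_transform_eventually)
      (rule eventually_at_rightI[of 0 "t - s"], use s in \<open>auto simp: eq add.commute\<close>)
qed

lemma set_integral_Icc_dominated_tendsto:
  fixes \<phi> :: "nat \<Rightarrow> real \<Rightarrow> real"
  assumes "\<And>n. continuous_on {0..t} (\<phi> n)" "continuous_on {0..t} \<psi>"
    and b: "\<And>n s. 0 \<le> s \<Longrightarrow> s \<le> t \<Longrightarrow> \<bar>\<phi> n s\<bar> \<le> B"
    and lim: "\<And>s. 0 \<le> s \<Longrightarrow> s \<le> t \<Longrightarrow> (\<lambda>n. \<phi> n s) \<longlonglongrightarrow> \<psi> s"
  shows "(\<lambda>n. LINT s:{0..t}|lborel. \<phi> n s) \<longlonglongrightarrow> (LINT s:{0..t}|lborel. \<psi> s)"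
  unfolding set_lebesgue_integral_def
proof (rule integral_dominated_convergence[where w = "\<lambda>s. indicator {0..t} s *\<^sub>R B"])
  have "set_integrable lborel {0..t} \<psi>" "set_integrable lborel {0..t} (\<phi> n)" "set_integrable lborel {0..t} (\<lambda>_. B)" for n
    using assms by (auto intro: borel_integrable_atLeastAtMost')
  then show "(\<lambda>s. indicator {0..t} s *\<^sub>R \<psi> s) \<in> borel_measurable lborel"
    "(\<lambda>s. indicator {0..t} s *\<^sub>R \<phi> n s) \<in> borel_measurable lborel"
    "integrable lborel (\<lambda>s. indicator {0..t} s *\<^sub>R B)" for n
    unfolding set_integrable_def by auto
qed (use b lim in \<open>auto simp: indicator_def\<close>)

section \<open>Products of a strongly and a weakly continuous orbit\<close>

context strong_L2_semigroup
begin

text \<open>In T(t-s)u time runs backwards, so a right derivative in s is a left derivative of the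
  orbit. It is wanted in norm, since the other factor of the product converges only weakly.\<close>

lemma generator_left_difference:
  assumes uz: "(u, z) \<in> generator_Lp 2 M P" and r: "0 < r"
  shows "((\<lambda>h. Lp_norm 2 M (\<lambda>x. (P (r - h) u x - P r u x) / h + P r z x)) \<longlongrightarrow> 0) (at_right 0)"
proof -
  have uz': "u \<in> Lp 2 M" "z \<in> Lp 2 M"
    and lim: "((\<lambda>t. Lp_norm 2 M (\<lambda>x. (P t u x - u x) / t - z x)) \<longlongrightarrow> 0) (at_right 0)"
    using uz by (auto simp: generator_Lp_def)
  let ?C = "K * exp (\<bar>w\<bar> * r)"
  have lim': "((\<lambda>h. ?C * (Lp_norm 2 M (\<lambda>x. (P h u x - u x) / h - z x) + Lp_norm 2 M (\<lambda>x. P h z x - z x))) \<longlongrightarrow> 0) (at_right 0)"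
    by (intro tendsto_mult_right_zero tendsto_add_zero lim P_strong uz')
  show ?thesis
  proof (rule Lim_null_comparison[OF _ lim'], rule eventually_at_rightI[of 0 r])
    fix h assume "h \<in> {0<..<r}"
    then have h: "0 \<le> h" "h < r" "0 < h" "0 \<le> r - h" by auto
    have E: "K * exp (w * (r - h)) \<le> ?C"
    proof -
      have "w * (r - h) \<le> \<bar>w\<bar> * r" using h by (intro mult_mono) auto
      then show ?thesis using K_nonneg by (intro mult_left_mono) auto
    qed
    have Ph: "P h u \<in> Lp 2 M" "P h z \<in> Lp 2 M" "P r z \<in> Lp 2 M" "P (r - h) z \<in> Lp 2 M"
      using h r uz' by (auto intro: P_in)
    have d: "(\<lambda>x. P h u x - u x) \<in> Lp 2 M" using Ph uz' by auto
    have q: "(\<lambda>x. 1 / h * (P h u x - u x)) \<in> Lp 2 M" using d by (rule L2_cmult)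
    have y: "(\<lambda>x. 1 / h * (P h u x - u x) - z x) \<in> Lp 2 M" using q uz' by auto
    let ?Y = "P (r - h) (\<lambda>x. 1 / h * (P h u x - u x) - z x)"
    have Y: "?Y \<in> Lp 2 M" by (rule P_in[OF h(4) y])
    have "AE x in M. ?Y x = P (r - h) (\<lambda>x. 1 / h * (P h u x - u x)) x - P (r - h) z x"
      by (rule P_diff[OF h(4) q uz'(2)])
    moreover have "AE x in M. P (r - h) (\<lambda>x. 1 / h * (P h u x - u x)) x = 1 / h * P (r - h) (\<lambda>x. P h u x - u x) x"
      by (rule P_cmult[OF h(4) d])
    moreover have "AE x in M. P (r - h) (\<lambda>x. P h u x - u x) x = P (r - h) (P h u) x - P (r - h) u x"
      by (rule P_diff[OF h(4) Ph(1) uz'(1)])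
    moreover have "AE x in M. P r u x = P (r - h) (P h u) x"
      using P_plus[OF h(4) h(1) uz'(1)] by simp
    \<comment> \<open>P(r) = P(r-h)P(h) splits the error into P(r)z - P(r-h)z, small by strong
      continuity at z, and P(r-h) applied to the error of the right difference quotient.\<close>
    ultimately have "AE x in M. (P (r - h) u x - P r u x) / h + P r z x = (P r z x - P (r - h) z x) - ?Y x"
      by eventually_elim (simp add: diff_divide_distrib)
    then have "Lp_norm 2 M (\<lambda>x. (P (r - h) u x - P r u x) / h + P r z x)
        = Lp_norm 2 M (\<lambda>x. (P r z x - P (r - h) z x) - ?Y x)"
      using P_in[OF h(4) uz'(1)] P_in[of r u] r uz' Ph Y
      by (intro L2_norm_cong_AE Lp_measurable[of _ 2] L2_add L2_diff L2_divide) auto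
    also have "\<dots> \<le> Lp_norm 2 M (\<lambda>x. P r z x - P (r - h) z x) + Lp_norm 2 M ?Y"
      using Ph Y by (intro L2_norm_triangle_diff L2_diff)
    also have "\<dots> \<le> ?C * Lp_norm 2 M (\<lambda>x. P h z x - z x) + ?C * Lp_norm 2 M (\<lambda>x. 1 / h * (P h u x - u x) - z x)"
    proof (rule add_mono)
      have "Lp_norm 2 M (\<lambda>x. P r z x - P (r - h) z x) \<le> K * exp (w * (r - h)) * Lp_norm 2 M (\<lambda>x. P (r - (r - h)) z x - z x)"
        using h uz' by (intro P_diff_norm_le) auto
      also have "\<dots> \<le> ?C * Lp_norm 2 M (\<lambda>x. P (r - (r - h)) z x - z x)"
        by (intro mult_right_mono E Lp_norm_nonneg)
      finally show "Lp_norm 2 M (\<lambda>x. P r z x - P (r - h) z x) \<le> ?C * Lp_norm 2 M (\<lambda>x. P h z x - z x)" by simp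
      have "Lp_norm 2 M ?Y \<le> K * exp (w * (r - h)) * Lp_norm 2 M (\<lambda>x. 1 / h * (P h u x - u x) - z x)"
        by (rule P_bound[OF h(4) y])
      also have "\<dots> \<le> ?C * Lp_norm 2 M (\<lambda>x. 1 / h * (P h u x - u x) - z x)"
        by (intro mult_right_mono E Lp_norm_nonneg)
      finally show "Lp_norm 2 M ?Y \<le> ?C * Lp_norm 2 M (\<lambda>x. 1 / h * (P h u x - u x) - z x)" .
    qed
    finally show "norm (Lp_norm 2 M (\<lambda>x. (P (r - h) u x - P r u x) / h + P r z x))
        \<le> ?C * (Lp_norm 2 M (\<lambda>x. (P h u x - u x) / h - z x) + Lp_norm 2 M (\<lambda>x. P h z x - z x))"
      by (simp add: Lp_norm_nonneg distrib_left)
  qed (rule r)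
qed

end

text \<open>A norm convergent and a bounded weakly convergent factor have a convergent pairing; this
  is why strong continuity is asked of one side and weak continuity of the other.\<close>

locale semigroup_pair = T: strong_L2_semigroup M T K\<^sub>T w\<^sub>T + Q: L2_semigroup M Q K\<^sub>Q w\<^sub>Q
  for M :: "'a measure" and T K\<^sub>T w\<^sub>T Q K\<^sub>Q w\<^sub>Q
begin

lemma Q_norm_bound:
  assumes v: "v \<in> Lp 2 M" and x: "0 \<le> x" "x \<le> t"
  shows "Lp_norm 2 M (Q x v) \<le> K\<^sub>Q * exp (\<bar>w\<^sub>Q\<bar> * t) * Lp_norm 2 M v"
proof -
  have "w\<^sub>Q * x \<le> \<bar>w\<^sub>Q\<bar> * t" using x by (intro mult_mono) auto
  then have "K\<^sub>Q * exp (w\<^sub>Q * x) * Lp_norm 2 M v \<le> K\<^sub>Q * exp (\<bar>w\<^sub>Q\<bar> * t) * Lp_norm 2 M v"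
    using Q.K_nonneg by (intro mult_right_mono mult_left_mono) (auto simp: Lp_norm_nonneg)
  then show ?thesis using Q.P_bound[OF x(1) v] by linarith
qed

lemma orbit_product_continuous:
  assumes u: "u \<in> Lp 2 M" and v: "v \<in> Lp 2 M"
  shows "continuous_on {0..t} (\<lambda>s. pairing M (T (t - s) u) (Q s v))"
  unfolding continuous_on_def
proof
  fix s assume "s \<in> {0..t}"
  then have s: "0 \<le> s" "s \<le> t" by auto
  have Ts: "T (t - s) u \<in> Lp 2 M" using s u by (intro T.P_in) auto
  let ?n = "\<lambda>x. Lp_norm 2 M (\<lambda>y. T (t - x) u y - T (t - s) u y)"
  let ?C = "K\<^sub>Q * exp (\<bar>w\<^sub>Q\<bar> * t) * Lp_norm 2 M v"
  have "((\<lambda>x. t - x) \<longlongrightarrow> t - s) (at s within {0..t})" by (intro tendsto_intros)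
  then have "filterlim (\<lambda>x. t - x) (at (t - s) within {0..}) (at s within {0..t})"
    by (auto simp: filterlim_at eventually_at_filter)
  then have n: "(?n \<longlongrightarrow> 0) (at s within {0..t})"
    by (rule filterlim_compose[rotated]) (use s u in \<open>auto intro!: T.P_strong_continuous T.P_strong\<close>)
  have "((\<lambda>x. pairing M (Q x v) (T (t - s) u)) \<longlongrightarrow> pairing M (Q s v) (T (t - s) u)) (at s within {0..})"
    using Q.P_cont[OF v Ts] s unfolding continuous_on_def by auto
  then have q: "((\<lambda>x. pairing M (Q x v) (T (t - s) u)) \<longlongrightarrow> pairing M (Q s v) (T (t - s) u)) (at s within {0..t})"
    by (rule tendsto_within_subset) auto
  have "((\<lambda>x. pairing M (T (t - x) u) (Q x v) - pairing M (Q x v) (T (t - s) u)) \<longlongrightarrow> 0) (at s within {0..t})"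
  proof (rule Lim_null_comparison)
    show "((\<lambda>x. ?n x * ?C) \<longlongrightarrow> 0) (at s within {0..t})" by (rule tendsto_mult_left_zero[OF n])
    have "\<bar>pairing M (T (t - x) u) (Q x v) - pairing M (Q x v) (T (t - s) u)\<bar> \<le> ?n x * ?C" if x: "x \<in> {0..t}" for x
    proof -
      have i: "T (t - x) u \<in> Lp 2 M" "Q x v \<in> Lp 2 M" using x u v by (auto intro: T.P_in Q.P_in)
      have "pairing M (T (t - x) u) (Q x v) - pairing M (Q x v) (T (t - s) u)
          = pairing M (\<lambda>y. T (t - x) u y - T (t - s) u y) (Q x v)"
        using i Ts by (simp add: pairing_diff_left pairing_commute[of M "Q x v"])
      also have "\<bar>\<dots>\<bar> \<le> ?n x * Lp_norm 2 M (Q x v)" using i Ts by (intro L2_Cauchy_Schwarz L2_diff)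
      also have "\<dots> \<le> ?n x * ?C" using x v by (intro mult_left_mono Q_norm_bound) (auto simp: Lp_norm_nonneg)
      finally show ?thesis .
    qed
    then show "\<forall>\<^sub>F x in at s within {0..t}. norm (pairing M (T (t - x) u) (Q x v) - pairing M (Q x v) (T (t - s) u)) \<le> ?n x * ?C"
      by (auto simp: eventually_at_filter)
  qed
  from tendsto_add[OF this q]
  show "((\<lambda>s. pairing M (T (t - s) u) (Q s v)) \<longlongrightarrow> pairing M (T (t - s) u) (Q s v)) (at s within {0..t})"
    by (simp add: pairing_commute[of M "Q s v"])
qed

lemma orbit_product_right_derivative:
  assumes uz: "(u, z) \<in> generator_Lp 2 M T" and vy: "(v, y) \<in> weak_generator M Q"
    and s: "0 \<le> s" "s < t"
  shows "((\<lambda>h. (pairing M (T (t - (s + h)) u) (Q (s + h) v) - pairing M (T (t - s) u) (Q s v)) / h)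
    \<longlongrightarrow> pairing M (T (t - s) u) (Q s y) - pairing M (T (t - s) z) (Q s v)) (at_right 0)"
proof -
  have u: "u \<in> Lp 2 M" and z: "z \<in> Lp 2 M" using uz by (auto simp: generator_Lp_def)
  note v = Q.weak_generatorD(1)[OF vy]
  have ts: "0 < t - s" using s by simp
  define X where "X = T (t - s) u"
  define Z where "Z = T (t - s) z"
  have XZ: "X \<in> Lp 2 M" "Z \<in> Lp 2 M" unfolding X_def Z_def using ts u z by (auto intro: T.P_in)
  have Qs: "Q s v \<in> Lp 2 M" by (rule Q.P_in[OF s(1) v])
  \<comment> \<open>The error of the left difference quotient. It tends to 0 in norm and may
    therefore be paired with the moving vector Q(s+h)v; in the remaining terms one vector is fixed
    and weak limits suffice.\<close>
  let ?e = "\<lambda>h x. (T (t - s - h) u x - X x) / h + Z x"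
  let ?C = "K\<^sub>Q * exp (\<bar>w\<^sub>Q\<bar> * t) * Lp_norm 2 M v"
  have A: "((\<lambda>h. pairing M (?e h) (Q (s + h) v)) \<longlongrightarrow> 0) (at_right 0)"
  proof (rule Lim_null_comparison)
    show "((\<lambda>h. Lp_norm 2 M (?e h) * ?C) \<longlongrightarrow> 0) (at_right 0)"
      unfolding X_def Z_def by (rule tendsto_mult_left_zero[OF T.generator_left_difference[OF uz ts]])
    show "\<forall>\<^sub>F h in at_right 0. norm (pairing M (?e h) (Q (s + h) v)) \<le> Lp_norm 2 M (?e h) * ?C"
    proof (rule eventually_at_rightI[of 0 "t - s"])
      fix h assume "h \<in> {0<..<t - s}"
      then have h: "0 < h" "0 \<le> t - s - h" "0 \<le> s + h" "s + h \<le> t" using s by auto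
      have "?e h \<in> Lp 2 M" using T.P_in[OF h(2) u] XZ by (intro L2_add L2_divide L2_diff)
      then have "\<bar>pairing M (?e h) (Q (s + h) v)\<bar> \<le> Lp_norm 2 M (?e h) * Lp_norm 2 M (Q (s + h) v)"
        by (intro L2_Cauchy_Schwarz Q.P_in h v)
      also have "\<dots> \<le> Lp_norm 2 M (?e h) * ?C"
        by (intro mult_left_mono Q_norm_bound v h Lp_norm_nonneg)
      finally show "norm (pairing M (?e h) (Q (s + h) v)) \<le> Lp_norm 2 M (?e h) * ?C" by simp
    qed (rule ts)
  qed
  have B: "((\<lambda>h. pairing M (Q (s + h) v) Z) \<longlongrightarrow> pairing M (Q s v) Z) (at_right 0)"
  proof -
    have "((\<lambda>x. pairing M (Q x v) Z) \<longlongrightarrow> pairing M (Q s v) Z) (at s within {0..})"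
      using Q.P_cont[OF v XZ(2)] s unfolding continuous_on_def by auto
    then have "((\<lambda>x. pairing M (Q x v) Z) \<longlongrightarrow> pairing M (Q s v) Z) (at_right s)"
      by (rule tendsto_within_subset) (use s in auto)
    then show ?thesis by (subst (asm) filterlim_at_right_to_0) (simp add: add.commute)
  qed
  have Cl: "((\<lambda>h. (pairing M (Q h (Q s v)) X - pairing M (Q s v) X) / h) \<longlongrightarrow> pairing M (Q s y) X) (at_right 0)"
    by (rule Q.weak_generatorD(3)[OF Q.weak_generator_P[OF vy s(1)] XZ(1)])
  have "((\<lambda>h. pairing M (?e h) (Q (s + h) v) - pairing M (Q (s + h) v) Z
      + (pairing M (Q h (Q s v)) X - pairing M (Q s v) X) / h)
    \<longlongrightarrow> 0 - pairing M (Q s v) Z + pairing M (Q s y) X) (at_right 0)"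
    by (intro tendsto_add tendsto_diff A B Cl)
  also have "0 - pairing M (Q s v) Z + pairing M (Q s y) X = pairing M X (Q s y) - pairing M Z (Q s v)"
    by (simp add: pairing_commute)
  finally show ?thesis
    unfolding X_def[symmetric] Z_def[symmetric]
  proof (rule Lim_transform_eventually)
    show "\<forall>\<^sub>F h in at_right 0. pairing M (?e h) (Q (s + h) v) - pairing M (Q (s + h) v) Z
        + (pairing M (Q h (Q s v)) X - pairing M (Q s v) X) / h
      = (pairing M (T (t - (s + h)) u) (Q (s + h) v) - pairing M X (Q s v)) / h"
    proof (rule eventually_at_rightI[of 0 "t - s"])
      fix h assume "h \<in> {0<..<t - s}"
      then have h: "0 < h" "0 \<le> t - s - h" "0 \<le> s + h" "0 \<le> h" using s by auto
      have i: "Q (s + h) v \<in> Lp 2 M" "T (t - s - h) u \<in> Lp 2 M" using h u v by (auto intro: T.P_in Q.P_in)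
      have "pairing M (Q h (Q s v)) X = pairing M (Q (s + h) v) X"
        using Q.P_pair_plus[OF h(4) s(1) v XZ(1)] by (simp add: add.commute)
      moreover have "pairing M (?e h) (Q (s + h) v)
          = (pairing M (T (t - s - h) u) (Q (s + h) v) - pairing M X (Q (s + h) v)) / h + pairing M Z (Q (s + h) v)"
        using i XZ by (simp add: pairing_linear L2_divide L2_diff)
      moreover have "T (t - (s + h)) u = T (t - s - h) u" by (simp add: algebra_simps)
      ultimately show "pairing M (?e h) (Q (s + h) v) - pairing M (Q (s + h) v) Z
        + (pairing M (Q h (Q s v)) X - pairing M (Q s v) X) / h
      = (pairing M (T (t - (s + h)) u) (Q (s + h) v) - pairing M X (Q s v)) / h"
        by (simp add: pairing_commute[of M _ X] pairing_commute[of M _ Z] diff_divide_distrib)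
    qed (rule ts)
  qed
qed

end

section \<open>The three inequalities for an abstract pair\<close>

text \<open>With \<open>Q\<close> the adjoint of \<open>S\<close>, r = p' and r' = p, the second
  semigroup acts on v throughout. The two sides then become interchangeable up to strong
  continuity.\<close>

locale comparison = semigroup_pair M T K\<^sub>T w\<^sub>T Q K\<^sub>Q w\<^sub>Q
  for M :: "'a measure" and T K\<^sub>T w\<^sub>T Q K\<^sub>Q w\<^sub>Q +
  fixes q q' r r' :: ennreal and k\<^sub>T v\<^sub>T k\<^sub>Q v\<^sub>Q :: real and g f :: "'a \<Rightarrow> real" and C :: real
  assumes q: "1 \<le> q" "1 / q + 1 / q' = 1" and r: "1 \<le> r" "1 / r + 1 / r' = 1"
    and T_acts: "T.acts_on q k\<^sub>T v\<^sub>T" and Q_acts: "Q.acts_on r k\<^sub>Q v\<^sub>Q"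
    and g: "g \<in> Lp q' M" and f: "f \<in> Lp r' M"
    and T_admissible: "T.admissible q g" and Q_admissible: "Q.admissible r f"
begin

definition semigroup_inequality :: bool where
  "semigroup_inequality \<longleftrightarrow> (\<forall>t\<ge>0. \<forall>u \<in> Lp 2 M \<inter> Lp q M. \<forall>v \<in> Lp 2 M \<inter> Lp r M.
     nonneg_ae M u \<longrightarrow> nonneg_ae M v \<longrightarrow>
     pairing M (T t u) v \<le> pairing M u (Q t v)
       + C * (LINT s:{0..t}|lborel. pairing M (T (t - s) u) g * pairing M (Q s v) f))"

definition generator_inequality :: bool where
  "generator_inequality \<longleftrightarrow> (\<forall>u z v y.
     (u, z) \<in> generator_Lp 2 M T \<longrightarrow> u \<in> Lp q M \<longrightarrow> nonneg_ae M u \<longrightarrow>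
     (v, y) \<in> weak_generator M Q \<longrightarrow> v \<in> Lp r M \<longrightarrow> nonneg_ae M v \<longrightarrow>
     pairing M z v \<le> pairing M u y + C * pairing M u g * pairing M v f)"

definition resolvent_inequality :: bool where
  "resolvent_inequality \<longleftrightarrow> (\<forall>\<^sub>F l in at_top. \<forall>u \<in> Lp 2 M \<inter> Lp q M. \<forall>v \<in> Lp 2 M \<inter> Lp r M.
     nonneg_ae M u \<longrightarrow> nonneg_ae M v \<longrightarrow>
     pairing M (T.R l u) v \<le> pairing M u (Q.R l v) + C * pairing M (T.R l u) g * pairing M (Q.R l v) f)"

lemma T_continuous: "u \<in> Lp 2 M \<Longrightarrow> u \<in> Lp q M \<Longrightarrow> continuous_on {0..} (\<lambda>t. pairing M (T t u) g)"
  using T_admissible by (auto simp: T.admissible_def)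

lemma Q_continuous: "v \<in> Lp 2 M \<Longrightarrow> v \<in> Lp r M \<Longrightarrow> continuous_on {0..} (\<lambda>t. pairing M (Q t v) f)"
  using Q_admissible by (auto simp: Q.admissible_def)

lemma T_Abelian: "u \<in> Lp 2 M \<Longrightarrow> u \<in> Lp q M \<Longrightarrow> 0 \<le> t \<Longrightarrow>
    ((\<lambda>l. l * pairing M (T t (T.R l u)) g) \<longlongrightarrow> pairing M (T t u) g) at_top"
  using T_admissible by (auto simp: T.admissible_def)

lemma Q_Abelian: "v \<in> Lp 2 M \<Longrightarrow> v \<in> Lp r M \<Longrightarrow> 0 \<le> t \<Longrightarrow>
    ((\<lambda>l. l * pairing M (Q t (Q.R l v)) f) \<longlongrightarrow> pairing M (Q t v) f) at_top"
  using Q_admissible by (auto simp: Q.admissible_def)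

lemma generator_L2: "(u, z) \<in> generator_Lp 2 M T \<Longrightarrow> u \<in> Lp 2 M \<and> z \<in> Lp 2 M"
  by (auto simp: generator_Lp_def)

lemma semigroup_imp_generator:
  assumes a: semigroup_inequality
  shows generator_inequality
  unfolding generator_inequality_def
proof (intro allI impI)
  fix u z v y
  assume uz: "(u, z) \<in> generator_Lp 2 M T" and uq: "u \<in> Lp q M" and u0: "nonneg_ae M u"
    and vy: "(v, y) \<in> weak_generator M Q" and vr: "v \<in> Lp r M" and v0: "nonneg_ae M v"
  have u: "u \<in> Lp 2 M" using generator_L2[OF uz] by blast
  have v: "v \<in> Lp 2 M" by (rule Q.weak_generatorD(1)[OF vy])
  let ?I = "\<lambda>t. (LINT s:{0..t}|lborel. pairing M (T (t - s) u) g * pairing M (Q s v) f)"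
  have "((\<lambda>t. (pairing M (T t u) v - pairing M u v) / t) \<longlongrightarrow> pairing M z v) (at_right 0)"
    using T.weak_generatorD(3)[OF _ v] T.generator_subset_weak uz by blast
  moreover have "((\<lambda>t. (pairing M (Q t v) u - pairing M v u) / t + C * (?I t / t))
      \<longlongrightarrow> pairing M y u + C * (pairing M (T 0 u) g * pairing M (Q 0 v) f)) (at_right 0)"
    by (intro tendsto_intros Q.weak_generatorD(3)[OF vy u]
        convolution_average_tendsto T_continuous Q_continuous u uq v vr)
  moreover have "\<forall>\<^sub>F t in at_right 0. (pairing M (T t u) v - pairing M u v) / t
      \<le> (pairing M (Q t v) u - pairing M v u) / t + C * (?I t / t)"
  proof (rule eventually_at_rightI[of 0 1])
    fix t :: real assume "t \<in> {0<..<1}"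
    then have t: "0 < t" by simp
    have "pairing M (T t u) v \<le> pairing M u (Q t v) + C * ?I t"
      using a u uq u0 v vr v0 t unfolding semigroup_inequality_def by auto
    then have "(pairing M (T t u) v - pairing M u v) / t \<le> (pairing M u (Q t v) + C * ?I t - pairing M u v) / t"
      using t by (intro divide_right_mono) auto
    then show "(pairing M (T t u) v - pairing M u v) / t
      \<le> (pairing M (Q t v) u - pairing M v u) / t + C * (?I t / t)"
      by (simp add: pairing_commute[of M u] add_divide_distrib diff_divide_distrib)
  qed simp
  ultimately have "pairing M z v \<le> pairing M y u + C * (pairing M (T 0 u) g * pairing M (Q 0 v) f)"
    by (intro tendsto_le[of "at_right 0"]) auto
  \<comment> \<open>\<open>T 0\<close> and \<open>Q 0\<close> are the identity only up to null sets,
    so the limit is first obtained at time 0 and then rewritten.\<close>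
  moreover have "pairing M (T 0 u) g = pairing M u g" "pairing M (Q 0 v) f = pairing M v f"
    using u v g f by (auto intro!: T.P_pair_0 Q.P_pair_0 intro: Lp_measurable)
  ultimately show "pairing M z v \<le> pairing M u y + C * pairing M u g * pairing M v f"
    by (simp add: pairing_commute[of M u y] mult.assoc)
qed

lemma eventually_above_growth_bounds: "\<forall>\<^sub>F l in at_top. w\<^sub>T < l \<and> w\<^sub>Q < l \<and> 2 * \<bar>v\<^sub>T\<bar> < l \<and> 2 * \<bar>v\<^sub>Q\<bar> < l"
  by (intro eventually_conj eventually_gt_at_top)

lemma generator_imp_resolvent:
  assumes b: generator_inequality
  shows resolvent_inequality
  unfolding resolvent_inequality_def
  using eventually_above_growth_bounds
proof eventually_elim
  case (elim l)
  then have l: "w\<^sub>T < l" "w\<^sub>Q < l" "v\<^sub>T < l" "v\<^sub>Q < l" by auto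
  show ?case
  proof (intro ballI impI)
    fix u v assume "u \<in> Lp 2 M \<inter> Lp q M" "v \<in> Lp 2 M \<inter> Lp r M" and u0: "nonneg_ae M u" and v0: "nonneg_ae M v"
    then have u: "u \<in> Lp 2 M" "u \<in> Lp q M" and v: "v \<in> Lp 2 M" "v \<in> Lp r M" by auto
    let ?x = "T.R l u" and ?y = "Q.R l v"
    have x: "?x \<in> Lp 2 M" "?x \<in> Lp q M" "nonneg_ae M ?x" "(?x, \<lambda>a. l * ?x a - u a) \<in> generator_Lp 2 M T"
      using T.R_in[OF l(1) u(1)] T.R_in_Lp[OF T_acts q l(1,3) u] T.R_nonneg[OF l(1) u(1) u0]
        T.R_generator[OF l(1) u(1)] by auto
    have y: "?y \<in> Lp 2 M" "?y \<in> Lp r M" "nonneg_ae M ?y" "(?y, \<lambda>a. l * ?y a - v a) \<in> weak_generator M Q"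
      using Q.R_in[OF l(2) v(1)] Q.R_in_Lp[OF Q_acts r l(2,4) v] Q.R_nonneg[OF l(2) v(1) v0]
        Q.R_weak_generator[OF l(2) v(1)] by auto
    \<comment> \<open>The term l<x,y> occurs on both sides and cancels, leaving the resolvent
      inequality.\<close>
    have "pairing M (\<lambda>a. l * ?x a - u a) ?y \<le> pairing M ?x (\<lambda>a. l * ?y a - v a) + C * pairing M ?x g * pairing M ?y f"
      using b x y unfolding generator_inequality_def by blast
    then show "pairing M ?x v \<le> pairing M u ?y + C * pairing M ?x g * pairing M ?y f"
      using x(1) y(1) u(1) v(1) by (simp add: pairing_linear L2_cmult)
  qed
qed

text \<open>By u = l R(l)u - R(l)z, l^2 <R(l)u, v> is l<u,v> + l<R(l)z, v>, and likewise on the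
  other side. The divergent terms l<u,v> cancel, and in the product term the factor l^2 is shared
  out, one l to each pairing.\<close>

lemma resolvent_imp_generator:
  assumes c: resolvent_inequality
  shows generator_inequality
  unfolding generator_inequality_def
proof (intro allI impI)
  fix u z v y
  assume uz: "(u, z) \<in> generator_Lp 2 M T" and uq: "u \<in> Lp q M" and u0: "nonneg_ae M u"
    and vy: "(v, y) \<in> weak_generator M Q" and vr: "v \<in> Lp r M" and v0: "nonneg_ae M v"
  have u: "u \<in> Lp 2 M" "z \<in> Lp 2 M" using generator_L2[OF uz] by auto
  note v = Q.weak_generatorD(1,2)[OF vy]
  have uz': "(u, z) \<in> weak_generator M T" using T.generator_subset_weak uz by blast
  have gm: "g \<in> borel_measurable M" and fm: "f \<in> borel_measurable M" using g f Lp_measurable by blast+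
  have "((\<lambda>l. l * pairing M (T.R l z) v) \<longlongrightarrow> pairing M z v) at_top"
    by (rule T.R_pair_Abelian[OF u(2) v(1)])
  moreover have "((\<lambda>l. l * pairing M (Q.R l y) u
        + C * (l * pairing M (T 0 (T.R l u)) g) * (l * pairing M (Q 0 (Q.R l v)) f))
      \<longlongrightarrow> pairing M y u + C * pairing M (T 0 u) g * pairing M (Q 0 v) f) at_top"
    by (intro tendsto_intros Q.R_pair_Abelian T_Abelian Q_Abelian u v uq vr) auto
  moreover have "\<forall>\<^sub>F l in at_top. l * pairing M (T.R l z) v \<le> l * pairing M (Q.R l y) u
        + C * (l * pairing M (T 0 (T.R l u)) g) * (l * pairing M (Q 0 (Q.R l v)) f)"
    using c[unfolded resolvent_inequality_def] eventually_above_growth_bounds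
  proof eventually_elim
    case (elim l)
    then have l: "w\<^sub>T < l" "w\<^sub>Q < l" "0 < l" by auto
    have "pairing M (T.R l u) v \<le> pairing M u (Q.R l v) + C * pairing M (T.R l u) g * pairing M (Q.R l v) f"
      using elim(1) u(1) uq u0 v(1) vr v0 by auto
    then have "l * (l * pairing M (T.R l u) v)
        \<le> l * (l * (pairing M u (Q.R l v) + C * pairing M (T.R l u) g * pairing M (Q.R l v) f))"
      using l(3) by (intro mult_left_mono) auto
    moreover have "l * (l * pairing M (T.R l u) v) = l * pairing M u v + l * pairing M (T.R l z) v"
      unfolding T.weak_generator_pair[OF uz' v(1) l(1)] by (simp add: right_diff_distrib)
    moreover have "l * (l * pairing M u (Q.R l v)) = l * pairing M u v + l * pairing M (Q.R l y) u"
      unfolding pairing_commute[of M u] Q.weak_generator_pair[OF vy u(1) l(2)]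
      by (simp add: right_diff_distrib)
    moreover have "pairing M (T 0 (T.R l u)) g = pairing M (T.R l u) g" "pairing M (Q 0 (Q.R l v)) f = pairing M (Q.R l v) f"
      using l u v gm fm by (auto intro!: T.P_pair_0 Q.P_pair_0 T.R_in Q.R_in)
    ultimately show ?case by (simp add: algebra_simps)
  qed
  ultimately have "pairing M z v \<le> pairing M y u + C * pairing M (T 0 u) g * pairing M (Q 0 v) f"
    by (intro tendsto_le[of at_top]) auto
  moreover have "pairing M (T 0 u) g = pairing M u g" "pairing M (Q 0 v) f = pairing M v f"
    using u v gm fm by (auto intro!: T.P_pair_0 Q.P_pair_0)
  ultimately show "pairing M z v \<le> pairing M u y + C * pairing M u g * pairing M v f"
    by (simp add: pairing_commute[of M u y])
qed

lemma generator_inequality_integrated: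
  assumes b: generator_inequality and t: "0 \<le> t"
    and uz: "(u, z) \<in> generator_Lp 2 M T" and uq: "u \<in> Lp q M" and u0: "nonneg_ae M u"
    and vy: "(v, y) \<in> weak_generator M Q" and vr: "v \<in> Lp r M" and v0: "nonneg_ae M v"
  shows "pairing M (T t u) v \<le> pairing M u (Q t v)
    + C * (LINT s:{0..t}|lborel. pairing M (T (t - s) u) g * pairing M (Q s v) f)"
proof -
  have u: "u \<in> Lp 2 M" using generator_L2[OF uz] by blast
  note v = Q.weak_generatorD(1,2)[OF vy]
  define \<gamma> where "\<gamma> s = pairing M (T (t - s) u) g * pairing M (Q s v) f" for s
  have \<gamma>: "continuous_on {0..t} \<gamma>"
    unfolding \<gamma>_def
    by (intro continuous_intros continuous_on_compose2[OF T_continuous[OF u uq]]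
        continuous_on_subset[OF Q_continuous[OF v(1) vr]]) auto
  define G where "G s = pairing M (T (t - s) u) (Q s v) + C * (LINT r:{0..s}|lborel. \<gamma> r)" for s
  have "G 0 \<le> G t"
  proof (rule right_derivative_nonneg_le[OF _ t])
    show "continuous_on {0..t} G" unfolding G_def
      by (intro continuous_intros orbit_product_continuous u v set_integral_Icc_right_derivative(1)[OF \<gamma>])
    fix s assume s: "0 \<le> s" "s < t"
    let ?D = "pairing M (T (t - s) u) (Q s y) - pairing M (T (t - s) z) (Q s v) + C * \<gamma> s"
    have ts: "0 \<le> t - s" using s by simp
    \<comment> \<open>Domains, positivity and the spaces L_q and L_r are preserved along the orbits,
      so the generator inequality applies at every intermediate time.\<close>
    have "pairing M (T (t - s) z) (Q s v) \<le> pairing M (T (t - s) u) (Q s y)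
        + C * pairing M (T (t - s) u) g * pairing M (Q s v) f"
      using b T.generator_P[OF uz ts] T.acts_onD(1)[OF T_acts u uq ts] T.P_pos[OF ts u u0]
        Q.weak_generator_P[OF vy s(1)] Q.acts_onD(1)[OF Q_acts v(1) vr s(1)] Q.P_pos[OF s(1) v(1) v0]
      unfolding generator_inequality_def by blast
    then have "0 \<le> ?D" by (simp add: \<gamma>_def mult.assoc)
    moreover have "((\<lambda>h. (pairing M (T (t - (s + h)) u) (Q (s + h) v) - pairing M (T (t - s) u) (Q s v)) / h
        + C * (((LINT r:{0..s + h}|lborel. \<gamma> r) - (LINT r:{0..s}|lborel. \<gamma> r)) / h)) \<longlongrightarrow> ?D) (at_right 0)"
      by (intro tendsto_intros orbit_product_right_derivative[OF uz vy s]
          set_integral_Icc_right_derivative(2)[OF \<gamma> s])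
    then have "((\<lambda>h. (G (s + h) - G s) / h) \<longlongrightarrow> ?D) (at_right 0)"
      by (rule Lim_transform_eventually)
        (rule always_eventually, simp add: G_def add_divide_distrib diff_divide_distrib right_diff_distrib)
    ultimately show "\<exists>D\<ge>0. ((\<lambda>h. (G (s + h) - G s) / h) \<longlongrightarrow> D) (at_right 0)" by blast
  qed
  moreover have "G 0 = pairing M (T t u) v"
  proof -
    have "(LINT r:{0..0}|lborel. \<gamma> r) = integral {0..0} \<gamma>"
      by (intro set_borel_integral_eq_integral(2) borel_integrable_atLeastAtMost') simp
    then have "(LINT r:{0..0}|lborel. \<gamma> r) = 0" by simp
    moreover have "pairing M (T t u) (Q 0 v) = pairing M (T t u) v"
      using Q.P_pair_0[OF v(1) T.P_meas[OF t u]] by (simp add: pairing_commute)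
    ultimately show ?thesis by (simp add: G_def)
  qed
  moreover have "G t = pairing M u (Q t v) + C * (LINT r:{0..t}|lborel. \<gamma> r)"
    using T.P_pair_0[OF u Q.P_meas[OF t v(1)]] by (simp add: G_def)
  ultimately show ?thesis unfolding \<gamma>_def by simp
qed

lemma exp_le_abs: "0 \<le> s \<Longrightarrow> s \<le> t \<Longrightarrow> exp (a * s) \<le> exp (\<bar>a\<bar> * t)" for a s t :: real
  by (simp add: mult_mono)

lemma T_pair_bound:
  assumes "u \<in> Lp 2 M" "u \<in> Lp q M" "0 \<le> s" "s \<le> t"
  shows "\<bar>pairing M (T s u) g\<bar> \<le> k\<^sub>T * exp (\<bar>v\<^sub>T\<bar> * t) * Lp_norm q M u * Lp_norm q' M g"
proof -
  have "\<bar>pairing M (T s u) g\<bar> \<le> k\<^sub>T * exp (v\<^sub>T * s) * Lp_norm q M u * Lp_norm q' M g"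
    using assms by (intro T.acts_on_pair_bound T_acts q g)
  also have "\<dots> \<le> k\<^sub>T * exp (\<bar>v\<^sub>T\<bar> * t) * Lp_norm q M u * Lp_norm q' M g"
    using assms T.acts_on_nonneg[OF T_acts]
    by (intro mult_right_mono mult_left_mono exp_le_abs Lp_norm_nonneg)
  finally show ?thesis .
qed

lemma Q_pair_bound:
  assumes "v \<in> Lp 2 M" "v \<in> Lp r M" "0 \<le> s" "s \<le> t"
  shows "\<bar>pairing M (Q s v) f\<bar> \<le> k\<^sub>Q * exp (\<bar>v\<^sub>Q\<bar> * t) * Lp_norm r M v * Lp_norm r' M f"
proof -
  have "\<bar>pairing M (Q s v) f\<bar> \<le> k\<^sub>Q * exp (v\<^sub>Q * s) * Lp_norm r M v * Lp_norm r' M f"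
    using assms by (intro Q.acts_on_pair_bound Q_acts r f)
  also have "\<dots> \<le> k\<^sub>Q * exp (\<bar>v\<^sub>Q\<bar> * t) * Lp_norm r M v * Lp_norm r' M f"
    using assms Q.acts_on_nonneg[OF Q_acts]
    by (intro mult_right_mono mult_left_mono exp_le_abs Lp_norm_nonneg)
  finally show ?thesis .
qed

text \<open>Dominated convergence of the convolution is used along sequences; as every term lies
  above the bounds, the estimates hold for all n and not just eventually. The factors 2 are those of
  \<open>scaled_R_bound\<close>.\<close>

lemma sequence_above_growth_bounds:
  obtains l :: "nat \<Rightarrow> real" where "filterlim l at_top sequentially"
    "\<And>n. w\<^sub>T < l n \<and> w\<^sub>Q < l n \<and> 2 * \<bar>v\<^sub>T\<bar> < l n \<and> 2 * \<bar>v\<^sub>Q\<bar> < l n"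
proof -
  define L where "L = \<bar>w\<^sub>T\<bar> + \<bar>w\<^sub>Q\<bar> + 2 * \<bar>v\<^sub>T\<bar> + 2 * \<bar>v\<^sub>Q\<bar> + 1"
  have "filterlim (\<lambda>n. L + real n) at_top sequentially"
    by (rule filterlim_tendsto_add_at_top[OF tendsto_const filterlim_real_sequentially])
  moreover have "w\<^sub>T < L + real n \<and> w\<^sub>Q < L + real n \<and> 2 * \<bar>v\<^sub>T\<bar> < L + real n \<and> 2 * \<bar>v\<^sub>Q\<bar> < L + real n" for n
    unfolding L_def by auto
  ultimately show thesis by (rule that)
qed

text \<open>The two arguments are approximated one after the other: v stays in the domain here, so
  only one factor of the convolution varies with n.\<close>

lemma generator_imp_semigroup_left:
  assumes b: generator_inequality and t: "0 \<le> t"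
    and u: "u \<in> Lp 2 M" "u \<in> Lp q M" "nonneg_ae M u"
    and vy: "(v, y) \<in> weak_generator M Q" and vr: "v \<in> Lp r M" and v0: "nonneg_ae M v"
  shows "pairing M (T t u) v \<le> pairing M u (Q t v)
    + C * (LINT s:{0..t}|lborel. pairing M (T (t - s) u) g * pairing M (Q s v) f)"
proof -
  note v = Q.weak_generatorD(1)[OF vy]
  obtain l where l: "filterlim l at_top sequentially"
    "\<And>n. w\<^sub>T < l n \<and> w\<^sub>Q < l n \<and> 2 * \<bar>v\<^sub>T\<bar> < l n \<and> 2 * \<bar>v\<^sub>Q\<bar> < l n"
    using sequence_above_growth_bounds by blast
  have ln: "w\<^sub>T < l n" "2 * \<bar>v\<^sub>T\<bar> < l n" "v\<^sub>T < l n" "0 < l n" for n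
  proof -
    show "w\<^sub>T < l n" "2 * \<bar>v\<^sub>T\<bar> < l n" using l(2)[of n] by auto
    then show "v\<^sub>T < l n" "0 < l n" by auto
  qed
  have x: "T.R (l n) u \<in> Lp 2 M" "T.R (l n) u \<in> Lp q M" "nonneg_ae M (T.R (l n) u)"
    "(T.R (l n) u, \<lambda>a. l n * T.R (l n) u a - u a) \<in> generator_Lp 2 M T" for n
    using T.R_in[OF ln(1) u(1)] T.R_in_Lp[OF T_acts q ln(1,3) u(1,2)] T.R_nonneg[OF ln(1) u(1,3)]
      T.R_generator[OF ln(1) u(1)] by auto
  let ?\<phi> = "\<lambda>n s. (l n * pairing M (T (t - s) (T.R (l n) u)) g) * pairing M (Q s v) f"
  let ?\<psi> = "\<lambda>s. pairing M (T (t - s) u) g * pairing M (Q s v) f"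
  \<comment> \<open>Uniform in n, because l times the norm of R(l)u stays below 2k times the norm of
    u; it dominates the convolution integrands on [0,t].\<close>
  let ?B = "(k\<^sub>T * exp (\<bar>v\<^sub>T\<bar> * t) * (2 * k\<^sub>T * Lp_norm q M u) * Lp_norm q' M g)
    * (k\<^sub>Q * exp (\<bar>v\<^sub>Q\<bar> * t) * Lp_norm r M v * Lp_norm r' M f)"
  have "(\<lambda>n. LINT s:{0..t}|lborel. ?\<phi> n s) \<longlonglongrightarrow> (LINT s:{0..t}|lborel. ?\<psi> s)"
  proof (rule set_integral_Icc_dominated_tendsto)
    show "continuous_on {0..t} (?\<phi> n)" for n
      by (intro continuous_intros continuous_on_compose2[OF T_continuous[OF x(1,2)]]
          continuous_on_subset[OF Q_continuous[OF v vr]]) auto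
    show "continuous_on {0..t} ?\<psi>"
      by (intro continuous_intros continuous_on_compose2[OF T_continuous[OF u(1,2)]]
          continuous_on_subset[OF Q_continuous[OF v vr]]) auto
    fix s assume s: "0 \<le> s" "s \<le> t"
    then have ts: "0 \<le> t - s" "t - s \<le> t" by auto
    show "(\<lambda>n. ?\<phi> n s) \<longlonglongrightarrow> ?\<psi> s"
      by (intro tendsto_mult_right filterlim_compose[OF T_Abelian[OF u(1,2) ts(1)] l(1)])
    fix n
    have "l n * \<bar>pairing M (T (t - s) (T.R (l n) u)) g\<bar>
        \<le> l n * (k\<^sub>T * exp (\<bar>v\<^sub>T\<bar> * t) * Lp_norm q M (T.R (l n) u) * Lp_norm q' M g)"
      using ln(4) by (intro mult_left_mono T_pair_bound x ts) (auto intro: less_imp_le)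
    also have "\<dots> = k\<^sub>T * exp (\<bar>v\<^sub>T\<bar> * t) * (l n * Lp_norm q M (T.R (l n) u)) * Lp_norm q' M g" by simp
    also have "\<dots> \<le> k\<^sub>T * exp (\<bar>v\<^sub>T\<bar> * t) * (2 * k\<^sub>T * Lp_norm q M u) * Lp_norm q' M g"
      using T.acts_on_nonneg[OF T_acts]
      by (intro mult_right_mono mult_left_mono T.scaled_R_bound[OF T_acts q ln(1,2) u(1,2)] Lp_norm_nonneg) auto
    finally have key: "\<bar>l n * pairing M (T (t - s) (T.R (l n) u)) g\<bar>
        \<le> k\<^sub>T * exp (\<bar>v\<^sub>T\<bar> * t) * (2 * k\<^sub>T * Lp_norm q M u) * Lp_norm q' M g"
      using ln(4)[of n] by (simp add: abs_mult)
    show "\<bar>?\<phi> n s\<bar> \<le> ?B"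
      unfolding abs_mult[of _ "pairing M (Q s v) f"]
      by (intro mult_mono Q_pair_bound v vr s key order_trans[OF abs_ge_zero key] abs_ge_zero)
  qed
  then have "(\<lambda>n. l n * pairing M (T.R (l n) u) (Q t v) + C * (LINT s:{0..t}|lborel. ?\<phi> n s))
      \<longlonglongrightarrow> pairing M u (Q t v) + C * (LINT s:{0..t}|lborel. ?\<psi> s)"
    by (intro tendsto_intros filterlim_compose[OF T.R_pair_Abelian l(1)] u Q.P_in t v)
  moreover have "(\<lambda>n. l n * pairing M (T t (T.R (l n) u)) v) \<longlonglongrightarrow> pairing M (T t u) v"
    by (rule filterlim_compose[OF T.P_R_pair_Abelian[OF u(1) v t] l(1)])
  moreover have "l n * pairing M (T t (T.R (l n) u)) v
      \<le> l n * pairing M (T.R (l n) u) (Q t v) + C * (LINT s:{0..t}|lborel. ?\<phi> n s)" for n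
  proof -
    have "l n * pairing M (T t (T.R (l n) u)) v
      \<le> l n * (pairing M (T.R (l n) u) (Q t v)
        + C * (LINT s:{0..t}|lborel. pairing M (T (t - s) (T.R (l n) u)) g * pairing M (Q s v) f))"
      using ln(4)[of n]
      by (intro mult_left_mono generator_inequality_integrated[OF b t x(4) x(2,3) vy vr v0]) auto
    also have "\<dots> = l n * pairing M (T.R (l n) u) (Q t v) + C * (LINT s:{0..t}|lborel. ?\<phi> n s)"
      by (simp add: distrib_left mult.assoc)
    finally show ?thesis .
  qed
  ultimately show ?thesis by (intro LIMSEQ_le) auto
qed

lemma generator_imp_semigroup:
  assumes b: generator_inequality
  shows semigroup_inequality
  unfolding semigroup_inequality_def
proof (intro allI impI ballI)
  fix t :: real and u v :: "'a \<Rightarrow> real"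
  assume t: "0 \<le> t" and "u \<in> Lp 2 M \<inter> Lp q M" "v \<in> Lp 2 M \<inter> Lp r M" and u0: "nonneg_ae M u" and v0: "nonneg_ae M v"
  then have u: "u \<in> Lp 2 M" "u \<in> Lp q M" and v: "v \<in> Lp 2 M" "v \<in> Lp r M" by auto
  obtain l where l: "filterlim l at_top sequentially"
    "\<And>n. w\<^sub>T < l n \<and> w\<^sub>Q < l n \<and> 2 * \<bar>v\<^sub>T\<bar> < l n \<and> 2 * \<bar>v\<^sub>Q\<bar> < l n"
    using sequence_above_growth_bounds by blast
  have ln: "w\<^sub>Q < l n" "2 * \<bar>v\<^sub>Q\<bar> < l n" "v\<^sub>Q < l n" "0 < l n" for n
  proof -
    show "w\<^sub>Q < l n" "2 * \<bar>v\<^sub>Q\<bar> < l n" using l(2)[of n] by auto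
    then show "v\<^sub>Q < l n" "0 < l n" by auto
  qed
  have x: "Q.R (l n) v \<in> Lp 2 M" "Q.R (l n) v \<in> Lp r M" "nonneg_ae M (Q.R (l n) v)"
    "(Q.R (l n) v, \<lambda>a. l n * Q.R (l n) v a - v a) \<in> weak_generator M Q" for n
    using Q.R_in[OF ln(1) v(1)] Q.R_in_Lp[OF Q_acts r ln(1,3) v] Q.R_nonneg[OF ln(1) v(1) v0]
      Q.R_weak_generator[OF ln(1) v(1)] by auto
  let ?\<phi> = "\<lambda>n s. pairing M (T (t - s) u) g * (l n * pairing M (Q s (Q.R (l n) v)) f)"
  let ?\<psi> = "\<lambda>s. pairing M (T (t - s) u) g * pairing M (Q s v) f"
  let ?B = "(k\<^sub>T * exp (\<bar>v\<^sub>T\<bar> * t) * Lp_norm q M u * Lp_norm q' M g)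
    * (k\<^sub>Q * exp (\<bar>v\<^sub>Q\<bar> * t) * (2 * k\<^sub>Q * Lp_norm r M v) * Lp_norm r' M f)"
  have "(\<lambda>n. LINT s:{0..t}|lborel. ?\<phi> n s) \<longlonglongrightarrow> (LINT s:{0..t}|lborel. ?\<psi> s)"
  proof (rule set_integral_Icc_dominated_tendsto)
    show "continuous_on {0..t} (?\<phi> n)" for n
      by (intro continuous_intros continuous_on_compose2[OF T_continuous[OF u]]
          continuous_on_subset[OF Q_continuous[OF x(1,2)]]) auto
    show "continuous_on {0..t} ?\<psi>"
      by (intro continuous_intros continuous_on_compose2[OF T_continuous[OF u]]
          continuous_on_subset[OF Q_continuous[OF v]]) auto
    fix s assume s: "0 \<le> s" "s \<le> t"
    then have ts: "0 \<le> t - s" "t - s \<le> t" by auto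
    show "(\<lambda>n. ?\<phi> n s) \<longlonglongrightarrow> ?\<psi> s"
      by (intro tendsto_mult_left filterlim_compose[OF Q_Abelian[OF v s(1)] l(1)])
    fix n
    have "l n * \<bar>pairing M (Q s (Q.R (l n) v)) f\<bar>
        \<le> l n * (k\<^sub>Q * exp (\<bar>v\<^sub>Q\<bar> * t) * Lp_norm r M (Q.R (l n) v) * Lp_norm r' M f)"
      using ln(4) by (intro mult_left_mono Q_pair_bound x s) (auto intro: less_imp_le)
    also have "\<dots> = k\<^sub>Q * exp (\<bar>v\<^sub>Q\<bar> * t) * (l n * Lp_norm r M (Q.R (l n) v)) * Lp_norm r' M f" by simp
    also have "\<dots> \<le> k\<^sub>Q * exp (\<bar>v\<^sub>Q\<bar> * t) * (2 * k\<^sub>Q * Lp_norm r M v) * Lp_norm r' M f"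
      using Q.acts_on_nonneg[OF Q_acts]
      by (intro mult_right_mono mult_left_mono Q.scaled_R_bound[OF Q_acts r ln(1,2) v] Lp_norm_nonneg) auto
    finally have key: "\<bar>l n * pairing M (Q s (Q.R (l n) v)) f\<bar>
        \<le> k\<^sub>Q * exp (\<bar>v\<^sub>Q\<bar> * t) * (2 * k\<^sub>Q * Lp_norm r M v) * Lp_norm r' M f"
      using ln(4)[of n] by (simp add: abs_mult)
    show "\<bar>?\<phi> n s\<bar> \<le> ?B"
      unfolding abs_mult[of "pairing M (T (t - s) u) g"]
      by (intro mult_mono T_pair_bound u ts key order_trans[OF abs_ge_zero T_pair_bound[OF u ts]] abs_ge_zero)
  qed
  \<comment> \<open>Pairings are turned around because the Abelian limits have the orbit or
    resolvent in the left argument.\<close>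
  then have "(\<lambda>n. l n * pairing M (Q t (Q.R (l n) v)) u + C * (LINT s:{0..t}|lborel. ?\<phi> n s))
      \<longlonglongrightarrow> pairing M (Q t v) u + C * (LINT s:{0..t}|lborel. ?\<psi> s)"
    by (intro tendsto_intros filterlim_compose[OF Q.P_R_pair_Abelian l(1)] u v t)
  moreover have "(\<lambda>n. l n * pairing M (Q.R (l n) v) (T t u)) \<longlonglongrightarrow> pairing M v (T t u)"
    by (rule filterlim_compose[OF Q.R_pair_Abelian[OF v(1) T.P_in[OF t u(1)]] l(1)])
  moreover have "l n * pairing M (Q.R (l n) v) (T t u)
      \<le> l n * pairing M (Q t (Q.R (l n) v)) u + C * (LINT s:{0..t}|lborel. ?\<phi> n s)" for n
  proof -
    have "l n * pairing M (T t u) (Q.R (l n) v)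
      \<le> l n * (pairing M u (Q t (Q.R (l n) v))
        + C * (LINT s:{0..t}|lborel. pairing M (T (t - s) u) g * pairing M (Q s (Q.R (l n) v)) f))"
      using ln(4)[of n]
      by (intro mult_left_mono generator_imp_semigroup_left[OF b t u u0 x(4) x(2,3)]) auto
    also have "\<dots> = l n * pairing M u (Q t (Q.R (l n) v)) + C * (LINT s:{0..t}|lborel. ?\<phi> n s)"
      by (simp add: distrib_left mult.left_commute)
    finally show ?thesis by (simp add: pairing_commute)
  qed
  ultimately have "pairing M v (T t u) \<le> pairing M (Q t v) u + C * (LINT s:{0..t}|lborel. ?\<psi> s)"
    by (intro LIMSEQ_le) auto
  then show "pairing M (T t u) v \<le> pairing M u (Q t v) + C * (LINT s:{0..t}|lborel. ?\<psi> s)"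
    by (simp add: pairing_commute[of M v] pairing_commute[of M _ u])
qed

end

section \<open>From the abstract pair to \<open>S\<close> and \<open>T\<close>\<close>

theorem theorem3p3:
  fixes M :: "'a measure"
    and p q p' q' :: ennreal
    and S T :: "real \<Rightarrow> ('a \<Rightarrow> real) \<Rightarrow> ('a \<Rightarrow> real)"
    and f g' :: "'a \<Rightarrow> real"
    and C :: real
  assumes "localizable_measure M"
    and "1 \<le> p" "p < \<infinity>" "1 / p + 1 / p' = 1"
    and "1 \<le> q" "q < \<infinity>" "1 / q + 1 / q' = 1"
    and "C0_semigroup_Lp 2 M S" "positive_semigroup_Lp 2 M S"
    and "C0_semigroup_Lp 2 M T" "positive_semigroup_Lp 2 M T"
    and "also_acts_on_Lp p M S" "also_acts_on_Lp q M T"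
    and "f \<in> Lp p M" "nonneg_ae M f"
    and "g' \<in> Lp q' M" "nonneg_ae M g'"
    and "0 \<le> C"
  shows "let A\<^sub>S = generator_Lp 2 M S;
             A\<^sub>T = generator_Lp 2 M T;
             A\<^sub>S\<^sub>\<sigma> = L2_weak_star_generator M S;
             a = (\<forall>t\<ge>0. \<forall>u \<in> Lp 2 M \<inter> Lp q M. \<forall>v' \<in> Lp 2 M \<inter> Lp p' M.
                    nonneg_ae M u \<longrightarrow> nonneg_ae M v' \<longrightarrow>
                    pairing M (T t u) v' \<le> pairing M (S t u) v'
                      + C * (LINT s:{0..t}|lborel.
                          pairing M (T (t - s) u) g' * pairing M f (L2_dual M (S s) v')));
             b = (\<forall>u A\<^sub>Tu v' A\<^sub>S\<^sub>\<sigma>v'.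
                    (u, A\<^sub>Tu) \<in> A\<^sub>T \<longrightarrow> u \<in> Lp q M \<longrightarrow> nonneg_ae M u \<longrightarrow>
                    (v', A\<^sub>S\<^sub>\<sigma>v') \<in> A\<^sub>S\<^sub>\<sigma> \<longrightarrow> v' \<in> Lp p' M \<longrightarrow> nonneg_ae M v' \<longrightarrow>
                    pairing M A\<^sub>Tu v' \<le> pairing M u A\<^sub>S\<^sub>\<sigma>v'
                      + C * pairing M u g' * pairing M f v');
             c = (\<forall>\<^sub>F lam in at_top. \<forall>u \<in> Lp 2 M \<inter> Lp q M. \<forall>v' \<in> Lp 2 M \<inter> Lp p' M.
                    nonneg_ae M u \<longrightarrow> nonneg_ae M v' \<longrightarrow>
                    pairing M (resolvent M A\<^sub>T lam u) v' \<le> pairing M (resolvent M A\<^sub>S lam u) v'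
                      + C * pairing M (resolvent M A\<^sub>T lam u) g'
                          * pairing M f (resolvent M A\<^sub>S\<^sub>\<sigma> lam v'))
         in (a \<longleftrightarrow> b) \<and> (b \<longleftrightarrow> c)"
proof -
  obtain K\<^sub>S w\<^sub>S where S: "strong_L2_semigroup M S K\<^sub>S w\<^sub>S"
    using C0_semigroup_strong_L2_semigroup[OF assms(8,9)] by blast
  obtain K\<^sub>T w\<^sub>T where T: "strong_L2_semigroup M T K\<^sub>T w\<^sub>T"
    using C0_semigroup_strong_L2_semigroup[OF assms(10,11)] by blast
  interpret S: strong_L2_semigroup M S K\<^sub>S w\<^sub>S by (rule S)
  interpret T: strong_L2_semigroup M T K\<^sub>T w\<^sub>T by (rule T)
  define Q where "Q = (\<lambda>t. L2_dual M (S t))"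
  interpret Q: L2_semigroup M Q K\<^sub>S w\<^sub>S unfolding Q_def by (rule S.L2_semigroup_dual)
  obtain k\<^sub>S v\<^sub>S where S_acts: "S.acts_on p k\<^sub>S v\<^sub>S"
    using S.also_acts_on_acts_on[OF assms(12)] by blast
  obtain k\<^sub>T v\<^sub>T where T_acts: "T.acts_on q k\<^sub>T v\<^sub>T"
    using T.also_acts_on_acts_on[OF assms(13)] by blast
  have p': "1 \<le> p'" "1 / p' + 1 / p = 1"
    using conjugate_exponents_ge_1[OF assms(2,4)] assms(4) by (simp_all add: add.commute)
  have Q_acts: "Q.acts_on p' k\<^sub>S v\<^sub>S"
    unfolding Q_def by (rule S.acts_on_dual[OF S_acts assms(2,4)])
  \<comment> \<open>The exponent conjugate to p' is p, which is finite, so f can always be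
    approximated from L_2.\<close>
  have Q_admissible: "Q.admissible p' f"
    by (rule Q.admissible_finite[OF Q_acts p' assms(3,14)])
  \<comment> \<open>q' is infinite only for q = 1, where strong continuity of \<open>T\<close> on
    L_1 takes over.\<close>
  have T_admissible: "T.admissible q g'"
  proof (cases "q' < \<infinity>")
    case True
    then show ?thesis by (rule T.admissible_finite[OF T_acts assms(5,7) _ assms(16)])
  next
    case False
    have "q = 1 \<and> q' = \<infinity>"
      using assms(5,7) by (cases rule: conjugate_exponents_cases) (use False in auto)
    then show ?thesis using T.admissible_L1 T_acts assms(16) by simp
  qed
  interpret comparison M T K\<^sub>T w\<^sub>T Q K\<^sub>S w\<^sub>S q q' p' p k\<^sub>T v\<^sub>T k\<^sub>S v\<^sub>S g' f C
    using assms p' T_acts Q_acts T_admissible Q_admissible by unfold_locales auto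
  have fm: "f \<in> borel_measurable M" and gm: "g' \<in> borel_measurable M"
    using assms(14,16) Lp_measurable by blast+
  have SQ: "pairing M (S t u) v = pairing M u (Q t v)" if "0 \<le> t" "u \<in> Lp 2 M" "v \<in> Lp 2 M" for t u v
    using S.L2_dual_pair[OF that(1,3,2)] by (simp add: Q_def pairing_commute)
  have weak_eq: "L2_weak_star_generator M S = weak_generator M Q"
    by (simp add: L2_weak_star_generator_eq Q_def)
  have a: "(\<forall>t\<ge>0. \<forall>u \<in> Lp 2 M \<inter> Lp q M. \<forall>v' \<in> Lp 2 M \<inter> Lp p' M.
      nonneg_ae M u \<longrightarrow> nonneg_ae M v' \<longrightarrow>
      pairing M (T t u) v' \<le> pairing M (S t u) v'
        + C * (LINT s:{0..t}|lborel.
            pairing M (T (t - s) u) g' * pairing M f (L2_dual M (S s) v'))) \<longleftrightarrow> semigroup_inequality"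
    unfolding semigroup_inequality_def by (auto simp: SQ pairing_commute[of M f] Q_def)
  have b: "(\<forall>u A\<^sub>Tu v' A\<^sub>S\<^sub>\<sigma>v'.
      (u, A\<^sub>Tu) \<in> generator_Lp 2 M T \<longrightarrow> u \<in> Lp q M \<longrightarrow> nonneg_ae M u \<longrightarrow>
      (v', A\<^sub>S\<^sub>\<sigma>v') \<in> L2_weak_star_generator M S \<longrightarrow> v' \<in> Lp p' M \<longrightarrow> nonneg_ae M v' \<longrightarrow>
      pairing M A\<^sub>Tu v' \<le> pairing M u A\<^sub>S\<^sub>\<sigma>v'
        + C * pairing M u g' * pairing M f v') \<longleftrightarrow> generator_inequality"
    unfolding generator_inequality_def weak_eq pairing_commute[of M f] ..
  have c: "(\<forall>\<^sub>F lam in at_top. \<forall>u \<in> Lp 2 M \<inter> Lp q M. \<forall>v' \<in> Lp 2 M \<inter> Lp p' M.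
      nonneg_ae M u \<longrightarrow> nonneg_ae M v' \<longrightarrow>
      pairing M (resolvent M (generator_Lp 2 M T) lam u) v' \<le> pairing M (resolvent M (generator_Lp 2 M S) lam u) v'
        + C * pairing M (resolvent M (generator_Lp 2 M T) lam u) g'
            * pairing M f (resolvent M (L2_weak_star_generator M S) lam v')) \<longleftrightarrow> resolvent_inequality"
    unfolding resolvent_inequality_def
  \<comment> \<open>\<open>resolvent\<close> is identified with the Laplace resolvents beyond the
    growth bounds, so the two statements are matched for large l rather than for each l.\<close>
  proof (rule eventually_subst, rule eventually_mono[OF eventually_above_growth_bounds])
    fix l assume "w\<^sub>T < l \<and> w\<^sub>S < l \<and> 2 * \<bar>v\<^sub>T\<bar> < l \<and> 2 * \<bar>v\<^sub>S\<bar> < l"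
    then have l: "w\<^sub>T < l" "w\<^sub>S < l" by auto
    have RT: "pairing M (resolvent M (generator_Lp 2 M T) l u) h = pairing M (T.R l u) h"
      if u: "u \<in> Lp 2 M" and h: "h \<in> borel_measurable M" for u h
      using T.resolvent_AE_R[OF T.generator_subset_weak T.R_generator[OF l(1) u] u l(1)]
      by (intro pairing_cong_left T.R_in l u h)
    \<comment> \<open>The resolvent of \<open>S\<close> is moved to v, where it becomes that of
      \<open>Q\<close>, the form used in \<open>resolvent_inequality\<close>.\<close>
    have RS: "pairing M (resolvent M (generator_Lp 2 M S) l u) v = pairing M u (Q.R l v)"
      if u: "u \<in> Lp 2 M" and v: "v \<in> Lp 2 M" for u v
    proof -
      have "pairing M (resolvent M (generator_Lp 2 M S) l u) v = pairing M (S.R l u) v"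
        using S.resolvent_AE_R[OF S.generator_subset_weak S.R_generator[OF l(2) u] u l(2)]
        by (intro pairing_cong_left S.R_in l u Lp_measurable[OF v])
      then show ?thesis using S.R_adjoint[OF l(2) u v] by (simp add: Q_def)
    qed
    have RQ: "pairing M f (resolvent M (L2_weak_star_generator M S) l v) = pairing M (Q.R l v) f"
      if v: "v \<in> Lp 2 M" for v
      unfolding weak_eq pairing_commute[of M f]
      using Q.resolvent_AE_R[OF subset_refl Q.R_weak_generator[OF l(2) v] v l(2)]
      by (intro pairing_cong_left Q.R_in l v fm)
    show "(\<forall>u \<in> Lp 2 M \<inter> Lp q M. \<forall>v' \<in> Lp 2 M \<inter> Lp p' M.
      nonneg_ae M u \<longrightarrow> nonneg_ae M v' \<longrightarrow>
      pairing M (resolvent M (generator_Lp 2 M T) l u) v' \<le> pairing M (resolvent M (generator_Lp 2 M S) l u) v'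
        + C * pairing M (resolvent M (generator_Lp 2 M T) l u) g'
            * pairing M f (resolvent M (L2_weak_star_generator M S) l v')) \<longleftrightarrow>
      (\<forall>u \<in> Lp 2 M \<inter> Lp q M. \<forall>v \<in> Lp 2 M \<inter> Lp p' M.
        nonneg_ae M u \<longrightarrow> nonneg_ae M v \<longrightarrow>
        pairing M (T.R l u) v \<le> pairing M u (Q.R l v) + C * pairing M (T.R l u) g' * pairing M (Q.R l v) f)"
      using gm by (intro ball_cong refl) (simp add: RT RS RQ Lp_measurable[of _ 2])
  qed
  show ?thesis
    unfolding Let_def a b c
    using semigroup_imp_generator generator_imp_semigroup generator_imp_resolvent resolvent_imp_generator
    by blast
qed

end
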